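(* Let $t \geq 2$, $n \geq 3t-1$ and $k \in \{2t, 2t+1\}$, and let $G$ be a connected $n$-vertex graph containing no path on $k$ vertices. Then $e(G) \leq h(n+1,k+1,t-1) - n$ unless (a) $k = 2t$, $k \neq 6$, and $G$ is isomorphic to a subgraph of $H_{n,k,t-1}$; or (b) $k = 2t+1$ or $k = 6$, and $G - A$ is a star forest for some $A \subseteq V(G)$ with $|A| \leq t-1$.
   Context: For integers $n \geq k$ and $1 \leq a < k/2$, $H_{n,k,a}$ is the $n$-vertex graph whose vertex set is partitioned into sets $A,B,C$ with $|A| = a$, $|B| = n-k+a$, $|C| = k-2a$, and whose edge set consists of all edges between $A$ and $B$ together with all pairs of vertices inside $A \cup C$. Its number of edges is $h(n,k,a) := \binom{k-a}{2} + a(n-k+a)$. A star forest is a vertex-disjoint union of stars. *)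

theory Defs
  imports Main "Graph_Theory.Graph_Theory"
begin

text \<open>
  Finite simple graphs are modelled, as usual for \<^theory>\<open>Graph_Theory.Pair_Digraph\<close>, by the
  locale \<^locale>\<open>pair_graph\<close>: a finite vertex set with an irreflexive symmetric arc relation.
  Every edge uv is represented by the two arcs (u,v) and (v,u), so edges must be counted as
  unordered pairs.
\<close>

definition num_edges :: "'a pair_pre_digraph \<Rightarrow> nat" where
  "num_edges G = card ((\<lambda>(u, v). {u, v}) ` parcs G)"

text \<open>The path is the list of its vertices; k counts vertices, not edges.\<close>

definition has_path_on :: "nat \<Rightarrow> ('a, 'b) pre_digraph \<Rightarrow> bool" where
  "has_path_on k G \<longleftrightarrow> (\<exists>p. vpath p G \<and> length p = k)"

text \<open>
  The subtractions below do not truncate in the range of parameters for which the graph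
  is intended, namely \<open>k \<le> n\<close> and \<open>1 \<le> a < k / 2\<close>.
\<close>

definition H_A :: "nat \<Rightarrow> nat \<Rightarrow> nat \<Rightarrow> nat set" where "H_A n k a = {0..<a}"
definition H_C :: "nat \<Rightarrow> nat \<Rightarrow> nat \<Rightarrow> nat set" where "H_C n k a = {a..<k - a}"
definition H_B :: "nat \<Rightarrow> nat \<Rightarrow> nat \<Rightarrow> nat set" where "H_B n k a = {k - a..<n}"

definition H_graph :: "nat \<Rightarrow> nat \<Rightarrow> nat \<Rightarrow> nat pair_pre_digraph" where
  "H_graph n k a =
    \<lparr> pverts = H_A n k a \<union> H_B n k a \<union> H_C n k a,
      parcs = H_A n k a \<times> H_B n k a \<union> H_B n k a \<times> H_A n k a \<union>
        {(u, v). u \<in> H_A n k a \<union> H_C n k a \<and> v \<in> H_A n k a \<union> H_C n k a \<and> u \<noteq> v} \<rparr>"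

definition h_edges :: "nat \<Rightarrow> nat \<Rightarrow> nat \<Rightarrow> nat" where
  "h_edges n k a = ((k - a) choose 2) + a * (n - k + a)"

text \<open>
  The case \<open>m = 0\<close> is deliberately included: an isolated vertex is a star.
\<close>

definition star :: "('a, 'b) pre_digraph \<Rightarrow> bool" where
  "star S \<longleftrightarrow> (\<exists>m. complete_bipartite_digraph 1 m S)"

definition star_forest :: "('a, 'b) pre_digraph \<Rightarrow> bool" where
  "star_forest F \<longleftrightarrow> (\<exists>\<S>.
     (\<forall>S\<in>\<S>. subgraph S F \<and> star S) \<and>
     pairwise (\<lambda>S T. verts S \<inter> verts T = {}) \<S> \<and>
     verts F = (\<Union>S\<in>\<S>. verts S) \<and>
     arcs F = (\<Union>S\<in>\<S>. arcs S))"

lemma H_graph_pair_graph: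
  assumes "2 * a < k"
  shows "pair_graph (H_graph n k a)"
proof -
  have "parcs (H_graph n k a) \<subseteq> pverts (H_graph n k a) \<times> pverts (H_graph n k a)"
    by (auto simp: H_graph_def)
  moreover have "finite (pverts (H_graph n k a))"
    by (simp add: H_graph_def H_A_def H_B_def H_C_def)
  ultimately have "finite (parcs (H_graph n k a))"
    by (meson finite_SigmaI finite_subset)
  moreover have "sym (parcs (H_graph n k a))"
    by (auto simp: H_graph_def intro!: symI)
  ultimately show ?thesis
    using assms by unfold_locales
      (auto simp: H_graph_def symmetric_def H_A_def H_B_def H_C_def)
qed

lemma H_graph_parts:
  assumes "k \<le> n" "1 \<le> a" "2 * a < k"
  shows "card (H_A n k a) = a" "card (H_B n k a) = n - k + a" "card (H_C n k a) = k - 2 * a"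
    "H_A n k a \<inter> H_B n k a = {}" "H_A n k a \<inter> H_C n k a = {}" "H_B n k a \<inter> H_C n k a = {}"
    "card (pverts (H_graph n k a)) = n"
proof -
  have "pverts (H_graph n k a) = {0..<n}"
    using assms by (auto simp: H_graph_def H_A_def H_B_def H_C_def)
  then show "card (pverts (H_graph n k a)) = n"
    by simp
qed (use assms in \<open>auto simp: H_A_def H_B_def H_C_def\<close>)

lemma num_edges_H_graph:
  assumes "k \<le> n" "1 \<le> a" "2 * a < k"
  shows "num_edges (H_graph n k a) = h_edges n k a"
proof -
  let ?A = "H_A n k a" and ?B = "H_B n k a" and ?C = "H_C n k a"
  let ?K = "{e. e \<subseteq> ?A \<union> ?C \<and> card e = 2}"
  let ?X = "(\<lambda>(u, v). {u, v}) ` (?A \<times> ?B)"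
  have AC: "?A \<union> ?C = {0..<k - a}"
    using assms by (auto simp: H_A_def H_C_def)
  have "(\<lambda>(u, v). {u, v}) ` parcs (H_graph n k a) = ?K \<union> ?X"
    by (auto simp: H_graph_def card_2_iff image_iff insert_commute)
  moreover have "finite ?K" "finite ?X"
    by (auto simp: H_A_def H_B_def H_C_def intro: finite_subset[of _ "Pow (?A \<union> ?C)"])
  moreover have "?K \<inter> ?X = {}"
    using AC by (auto simp: H_B_def)
  moreover have "card ?K = (k - a) choose 2"
    using n_subsets[of "?A \<union> ?C" 2] AC by simp
  moreover have "card ?X = a * (n - k + a)"
  proof -
    have "inj_on (\<lambda>(u, v). {u, v}) (?A \<times> ?B)"
      using H_graph_parts(4)[OF assms] by (auto simp: inj_on_def doubleton_eq_iff)
    then show ?thesis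
      using H_graph_parts(1,2)[OF assms] by (simp add: card_image card_cartesian_product)
  qed
  ultimately show ?thesis
    by (simp add: num_edges_def h_edges_def card_Un_disjoint)
qed

end

theory Submission imports Defs begin

text \<open>
  Pass to an edge-maximal graph without a path on \<open>k = 2t + \<epsilon>\<close> vertices. Joining a new apex to all
  vertices turns paths into cycles through the apex, and Kopylov's disintegration then shows that
  the \<open>t\<close>-core is empty or, for \<open>\<epsilon> = 1\<close> only, a complete graph on \<open>t + 1\<close> vertices. This bounds the number
  of edges inside any set of vertices. Let \<open>Q\<close> be a longest path. If a vertex outside \<open>Q\<close> has \<open>t - 1\<close>
  neighbours on \<open>Q\<close>, these take almost every second place of \<open>Q\<close>, and rerouting \<open>Q\<close> shows that
  deleting them leaves an independent set, or a star forest if \<open>\<epsilon> = 1\<close>. Otherwise, apart from small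
  exceptions, the \<open>(t - 1)\<close>-core lies on every longest path. It has at least \<open>t + 3 + 2\<epsilon>\<close> vertices
  because \<open>G\<close> has many edges, and no vertex of it can be exchanged for a vertex outside \<open>Q\<close>. Counting the
  gaps between the neighbours on \<open>Q\<close> of a path outside \<open>Q\<close>, this leaves so few edges outside \<open>Q\<close> that
  \<open>G\<close> cannot exceed the bound.
\<close>

section \<open>Edges, cores and paths\<close>

text \<open>Each vertex of \<open>A\<close> in H(n+1, k+1, t-1) has degree n, so the bound is the
  number of edges left when one of them is deleted. As a function of n it has slope t - 2. What
  decides is therefore whether vertices outside a longest path \<open>Q\<close> contribute t - 1
  edges, as they can in the exceptional graphs, or only t - 2. In the latter case the obvious count,
  t - 2 for every outside vertex and the maximum possible inside \<open>Q\<close>, still misses the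
  bound by t - 3 - \<epsilon>. This deficit is the obstacle: it forces a second and finer round of
  gap counting, in which the vertices of the (t - 1)-core are known to lie on every longest path,
  and which recovers t - 3 edges.

  Saturation costs nothing, since independence and being a star forest pass to spanning subgraphs.
  It is needed to start Kopylov's argument, where nonadjacent vertices have to be joined by a path
  of more than k vertices in the cone.

  Graphs are kept as a bare relation because the same lemmas are applied to the given graph, to its
  saturated extension and to cones.\<close>

locale ugraph =
  fixes V :: "'a set" and E :: "'a \<Rightarrow> 'a \<Rightarrow> bool"
  assumes fin: "finite V"
    and sym: "E x y \<Longrightarrow> E y x"
    and irr: "\<not> E x x"
    and inV: "E x y \<Longrightarrow> x \<in> V"
begin

lemma inV2: "E x y \<Longrightarrow> y \<in> V"
  using inV sym by blast

lemma sym_iff: "E x y \<longleftrightarrow> E y x"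
  using sym by blast

definition path :: "'a list \<Rightarrow> bool" where
  "path xs \<longleftrightarrow> distinct xs \<and> set xs \<subseteq> V \<and> successively E xs"

definition deg :: "'a set \<Rightarrow> 'a \<Rightarrow> nat" where
  "deg S x = card (S \<inter> {y. E x y})"

definition edges :: "'a set \<Rightarrow> 'a set set" where
  "edges S = (\<lambda>(x, y). {x, y}) ` {(x, y). x \<in> S \<and> y \<in> S \<and> E x y}"

text \<open>The union of all sets with minimum degree at least \<open>j\<close>. Deleting vertices
  of smaller degree ends there in whatever order it is done, so no order has to be fixed.\<close>

definition core :: "nat \<Rightarrow> 'a set" where
  "core j = \<Union>{S. S \<subseteq> V \<and> (\<forall>x\<in>S. j \<le> deg S x)}"

lemma deg_mono: "S \<subseteq> T \<Longrightarrow> T \<subseteq> V \<Longrightarrow> deg S x \<le> deg T x"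
  unfolding deg_def by (rule card_mono) (use fin in \<open>auto intro: finite_subset\<close>)

lemma finite_edges: "finite S \<Longrightarrow> finite (edges S)"
  unfolding edges_def
  by (rule finite_imageI, rule finite_subset[of _ "S \<times> S"]) auto

lemma edges_mono: "S \<subseteq> T \<Longrightarrow> edges S \<subseteq> edges T"
  unfolding edges_def by auto

lemma edges_subset: "e \<in> edges S \<Longrightarrow> e \<subseteq> S"
  unfolding edges_def by auto

lemma card_edges_remove:
  assumes "finite S" "x \<in> S"
  shows "card (edges S) = card (edges (S - {x})) + deg S x"
proof -
  have "edges S = edges (S - {x}) \<union> (\<lambda>y. {x, y}) ` (S \<inter> {y. E x y})"
  proof (intro equalityI subsetI)
    fix e assume "e \<in> edges S"
    then obtain a b where ab: "a \<in> S" "b \<in> S" "E a b" "e = {a, b}" unfolding edges_def by auto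
    show "e \<in> edges (S - {x}) \<union> (\<lambda>y. {x, y}) ` (S \<inter> {y. E x y})"
    proof (cases "a = x \<or> b = x")
      case True
      then have "\<exists>y. e = {x, y} \<and> y \<in> S \<and> E x y" using ab sym by (metis insert_commute)
      then show ?thesis by blast
    next
      case False
      then have "(a, b) \<in> {(a, b). a \<in> S - {x} \<and> b \<in> S - {x} \<and> E a b}" using ab by simp
      then have "e \<in> edges (S - {x})" unfolding edges_def using ab(4) by (intro image_eqI[of _ _ "(a, b)"]) auto
      then show ?thesis by blast
    qed
  next
    fix e assume "e \<in> edges (S - {x}) \<union> (\<lambda>y. {x, y}) ` (S \<inter> {y. E x y})"
    then show "e \<in> edges S"
    proof
      assume "e \<in> edges (S - {x})"
      then show ?thesis using edges_mono[of "S - {x}" S] by blast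
    next
      assume "e \<in> (\<lambda>y. {x, y}) ` (S \<inter> {y. E x y})"
      then obtain y where "e = {x, y}" "y \<in> S" "E x y" by blast
      then show ?thesis unfolding edges_def using assms(2) by (intro image_eqI[of _ _ "(x, y)"]) auto
    qed
  qed
  moreover have "edges (S - {x}) \<inter> (\<lambda>y. {x, y}) ` (S \<inter> {y. E x y}) = {}"
    using edges_subset[of _ "S - {x}"] by blast
  moreover have "inj_on (\<lambda>y. {x, y}) (S \<inter> {y. E x y})"
    by (auto simp: inj_on_def doubleton_eq_iff)
  ultimately show ?thesis
    using assms(1) by (simp add: card_Un_disjoint finite_edges deg_def card_image)
qed

lemma edges_empty [simp]: "edges {} = {}"
  by (simp add: edges_def)

lemma deg_le: "finite S \<Longrightarrow> x \<in> S \<Longrightarrow> deg S x \<le> card S - 1"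
proof -
  assume a: "finite S" "x \<in> S"
  have "S \<inter> {y. E x y} \<subseteq> S - {x}" using irr by auto
  then have "deg S x \<le> card (S - {x})" unfolding deg_def using a by (intro card_mono) auto
  then show ?thesis using a by simp
qed

lemma card_edges_le: "finite S \<Longrightarrow> 2 * card (edges S) \<le> card S * (card S - 1)"
proof (induction "card S" arbitrary: S)
  case (Suc n)
  then obtain x where x: "x \<in> S" by fastforce
  have "card (S - {x}) = n" using Suc x by simp
  then have "2 * card (edges (S - {x})) \<le> n * (n - 1)"
    using Suc(1)[of "S - {x}"] Suc.prems by simp
  moreover have "deg S x \<le> n" using deg_le[OF Suc.prems x] Suc(2) by simp
  ultimately have "2 * card (edges S) \<le> n * (n - 1) + 2 * n"
    using card_edges_remove[OF Suc.prems x] by simp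
  also have "\<dots> = Suc n * (Suc n - 1)" by (cases n) auto
  finally show ?case using Suc(2) by simp
qed simp

text \<open>At each stage there is a vertex outside \<open>B\<close> with at most \<open>d\<close>
  neighbours left, so \<open>S\<close> can be dismantled down to \<open>B\<close> at a price of
  \<open>d\<close> edges per vertex.\<close>

lemma card_edges_degenerate:
  assumes "finite S" "B \<subseteq> S"
    and "\<And>S'. B \<subset> S' \<Longrightarrow> S' \<subseteq> S \<Longrightarrow> \<exists>x\<in>S' - B. deg S' x \<le> d"
  shows "card (edges S) \<le> card (edges B) + d * card (S - B)"
  using assms
proof (induction "card (S - B)" arbitrary: S)
  case 0
  then show ?case by auto
next
  case (Suc n)
  then have "B \<subset> S" by (metis Diff_cancel card.empty nat.distinct(1) psubsetI)
  then obtain x where x: "x \<in> S - B" "deg S x \<le> d" using Suc.prems(3)[of S] by auto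
  have "S - {x} - B = (S - B) - {x}" by blast
  then have c: "card (S - {x} - B) = n" using x Suc(2) Suc.prems(1) by (simp add: card_Diff_singleton)
  have "card (edges (S - {x})) \<le> card (edges B) + d * card (S - {x} - B)"
  proof (rule Suc(1))
    show "n = card (S - {x} - B)" "finite (S - {x})" using c Suc.prems(1) by auto
    show "B \<subseteq> S - {x}" using x Suc.prems(2) by blast
    show "\<exists>y\<in>S' - B. deg S' y \<le> d" if "B \<subset> S'" "S' \<subseteq> S - {x}" for S'
      using Suc.prems(3)[of S'] that by blast
  qed
  then show ?case using card_edges_remove[of S x] x Suc.prems(1) c Suc(2)[symmetric] by auto
qed

text \<open>The last \<open>d\<close> vertices of a \<open>d\<close>-degenerate ordering span at most \<open>d * (d - 1) / 2\<close> edges;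
  \<open>\<epsilon> = 1\<close> leaves room for one complete graph on \<open>d + 2\<close> vertices.\<close>

lemma card_edges_degenerate_sharp:
  assumes "finite S" "d \<le> card S" "\<epsilon> \<le> 1"
    and "\<And>S'. S' \<subseteq> S \<Longrightarrow> d + 1 + \<epsilon> < card S' \<Longrightarrow> \<exists>x\<in>S'. deg S' x \<le> d"
  shows "2 * card (edges S) + d * (d + 1) \<le> 2 * d * card S + 2 * \<epsilon>"
  using assms
proof (induction "card S" arbitrary: S)
  case 0
  then show ?case by simp
next
  case (Suc n)
  show ?case
  proof (cases "d + 1 + \<epsilon> < card S")
    case False
    \<comment> \<open>The sizes at which peeling stops. The complete graphs on \<open>d\<close>,
      \<open>d + 1\<close> and, for \<epsilon> = 1, \<open>d + 2\<close> vertices all give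
      equality.\<close>
    then have "card S = d \<or> card S = d + 1 \<or> (card S = d + 2 \<and> \<epsilon> = 1)" using Suc.prems by linarith
    then show ?thesis using card_edges_le[OF Suc.prems(1)]
      by (cases "card S") (auto simp: algebra_simps)
  next
    case True
    then obtain x where x: "x \<in> S" "deg S x \<le> d" using Suc.prems(4)[of S] by auto
    have "2 * card (edges (S - {x})) + d * (d + 1) \<le> 2 * d * card (S - {x}) + 2 * \<epsilon>"
      using Suc x True by (intro Suc(1)) auto
    moreover have "card S = Suc (card (S - {x}))" using x Suc.prems(1) by (metis card_Suc_Diff1)
    ultimately show ?thesis using card_edges_remove[OF Suc.prems(1) x(1)] x(2) by (simp add: algebra_simps)
  qed
qed

lemma core_subset: "core j \<subseteq> V"
  unfolding core_def by auto

lemma core_deg: "x \<in> core j \<Longrightarrow> j \<le> deg (core j) x"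
proof -
  assume "x \<in> core j"
  then obtain S where S: "x \<in> S" "S \<subseteq> V" "\<forall>x\<in>S. j \<le> deg S x" unfolding core_def by auto
  then have "S \<subseteq> core j" unfolding core_def by auto
  then show ?thesis using S deg_mono[of S "core j" x] core_subset by fastforce
qed

lemma core_greatest: "S \<subseteq> V \<Longrightarrow> (\<And>x. x \<in> S \<Longrightarrow> j \<le> deg S x) \<Longrightarrow> S \<subseteq> core j"
  unfolding core_def by auto

lemma ex_low_deg_outside_core:
  assumes "core (Suc d) \<subset> S" "S \<subseteq> V"
  shows "\<exists>x\<in>S - core (Suc d). deg S x \<le> d"
proof (rule ccontr)
  assume "\<not> ?thesis"
  then have "\<And>x. x \<in> S \<Longrightarrow> Suc d \<le> deg S x"
    using core_deg[of _ "Suc d"] deg_mono[of "core (Suc d)" S] assms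
    by (metis Diff_iff le_trans not_less_eq_eq psubset_imp_subset)
  then have "S \<subseteq> core (Suc d)" using core_greatest[OF assms(2)] by blast
  then show False using assms(1) by auto
qed

lemma path_append:
  "path (xs @ ys) \<longleftrightarrow> path xs \<and> path ys \<and> set xs \<inter> set ys = {} \<and>
    (xs = [] \<or> ys = [] \<or> E (last xs) (hd ys))"
  unfolding path_def by (auto simp: successively_append_iff)

lemma path_Nil [simp]: "path []"
  by (simp add: path_def)

lemma path_single [simp]: "path [x] \<longleftrightarrow> x \<in> V"
  by (simp add: path_def)

lemma path_Cons:
  "path (x # xs) \<longleftrightarrow> x \<in> V \<and> path xs \<and> x \<notin> set xs \<and> (xs = [] \<or> E x (hd xs))"
  using path_append[of "[x]" xs] by auto

lemma path_rev [simp]: "path (rev xs) \<longleftrightarrow> path xs"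
  unfolding path_def successively_rev using sym_iff by (metis (mono_tags, lifting) distinct_rev set_rev successively_mono)

lemma path_distinct: "path xs \<Longrightarrow> distinct xs"
  and path_subset: "path xs \<Longrightarrow> set xs \<subseteq> V"
  by (simp_all add: path_def)

lemma path_take: "path xs \<Longrightarrow> path (take n xs)"
  and path_drop: "path xs \<Longrightarrow> path (drop n xs)"
  using path_append[of "take n xs" "drop n xs"] by simp_all

lemma path_nth: "path xs \<Longrightarrow> Suc i < length xs \<Longrightarrow> E (xs ! i) (xs ! Suc i)"
  unfolding path_def by (simp add: successively_conv_nth)

lemma path_length: "path xs \<Longrightarrow> length xs \<le> card V"
  using path_distinct path_subset fin by (metis card_mono distinct_card)

text \<open>A shortest walk of \<open>U\<close> from \<open>S\<close> to \<open>T\<close> does it: a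
  repeated vertex, or an early contact with \<open>S\<close> or \<open>T\<close>, would allow a
  shorter one.\<close>

lemma obtain_link:
  assumes "(s, u) \<in> {(a, b). E a b \<and> a \<in> U \<and> b \<in> U}\<^sup>*" "s \<in> S" "u \<in> T" "S \<inter> T = {}"
  obtains s' u' zs where "s' \<in> S" "u' \<in> T" "path (s' # zs @ [u'])"
    "set (s' # zs @ [u']) \<subseteq> U" "set zs \<inter> (S \<union> T) = {}"
proof -
  let ?R = "\<lambda>a b. E a b \<and> a \<in> U \<and> b \<in> U"
  define W where "W = (\<lambda>ws. ws \<noteq> [] \<and> hd ws \<in> S \<and> last ws \<in> T \<and> successively ?R ws)"
  have "\<exists>ws. ws \<noteq> [] \<and> hd ws = s \<and> last ws = u \<and> successively ?R ws"
    using assms(1)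
  proof (induction rule: rtrancl_induct)
    case base
    then show ?case by (intro exI[of _ "[s]"]) auto
  next
    case (step y z)
    then obtain ws where "ws \<noteq> []" "hd ws = s" "last ws = y" "successively ?R ws" by auto
    with step show ?case by (intro exI[of _ "ws @ [z]"]) (auto simp: successively_append_iff)
  qed
  then have "\<exists>ws. W ws" unfolding W_def using assms by auto
  then obtain ws where ws: "W ws" and min: "\<And>ws'. W ws' \<Longrightarrow> length ws \<le> length ws'"
    using ex_has_least_nat[of W _ length] by blast
  have nin: "a \<notin> S" if "ws = p @ a # q" "p \<noteq> []" for p a q
  proof
    assume "a \<in> S"
    then have "W (a # q)" using ws that unfolding W_def by (auto simp: successively_append_iff)
    then show False using min[of "a # q"] that by auto
  qed
  have nin': "a \<notin> T" if "ws = p @ a # q" "q \<noteq> []" for p a q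
  proof
    assume "a \<in> T"
    moreover have "ws = (p @ [a]) @ q" using that by simp
    then have "successively ?R (p @ [a])"
      using ws successively_append_iff[of ?R "p @ [a]" q] unfolding W_def by blast
    moreover have "hd (p @ [a]) = hd ws" using that by (cases p) auto
    ultimately have "W (p @ [a])" using ws unfolding W_def by auto
    then show False using min[of "p @ [a]"] that by auto
  qed
  have dist: "distinct ws"
  proof (rule ccontr)
    assume "\<not> distinct ws"
    then obtain p a q r where d: "ws = p @ [a] @ q @ [a] @ r" using not_distinct_decomp by blast
    have "successively ?R (p @ [a])" "successively ?R ([a] @ r)"
      using ws successively_append_iff[of ?R "p @ [a]" "q @ [a] @ r"]
        successively_append_iff[of ?R "p @ [a] @ q" "[a] @ r"] unfolding W_def d by auto
    then have "successively ?R (p @ [a] @ r)" unfolding successively_append_iff by auto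
    moreover have "hd (p @ [a] @ r) = hd ws" "last (p @ [a] @ r) = last ws"
      unfolding d by (cases p) auto
    ultimately have "W (p @ [a] @ r)" using ws unfolding W_def by auto
    then show False using min[of "p @ [a] @ r"] d by auto
  qed
  obtain s' vs where 1: "ws = s' # vs" "s' \<in> S" using ws unfolding W_def by (cases ws) auto
  have "vs \<noteq> []" using 1 ws assms(4) unfolding W_def by auto
  then obtain zs u' where 2: "vs = zs @ [u']" by (metis rev_exhaust)
  have 3: "u' \<in> T" using ws 1 2 unfolding W_def by auto
  have step: "\<exists>y. ?R x y \<or> ?R y x" if x: "x \<in> set ws" for x
  proof -
    obtain p q where pq: "ws = p @ x # q" using x by (meson split_list)
    have s: "successively ?R (p @ [x])" "successively ?R (x # q)"
      using ws successively_append_iff[of ?R "p @ [x]" q] successively_append_iff[of ?R p "x # q"]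
      unfolding W_def pq by auto
    show ?thesis
    proof (cases q)
      case Nil
      then have "p \<noteq> []" using pq 1 2 by auto
      then show ?thesis using s(1) unfolding successively_append_iff by auto
    qed (use s(2) in auto)
  qed
  then have sub: "set ws \<subseteq> U" "set ws \<subseteq> V" using inV inV2 by blast+
  have suc: "successively E ws" using ws unfolding W_def
    by (auto intro: successively_mono)
  have "path ws" using dist suc sub unfolding path_def by auto
  moreover have "set zs \<inter> (S \<union> T) = {}"
  proof -
    { fix x assume "x \<in> set zs"
      then obtain p q where "zs = p @ x # q" by (meson split_list)
      then have "x \<notin> S" "x \<notin> T"
        using nin[of "s' # p" x "q @ [u']"] nin'[of "s' # p" x "q @ [u']"] 1 2 by auto }
    then show ?thesis by auto
  qed
  ultimately show ?thesis using that[of s' u' zs] 1 2 3 sub by auto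
qed

text \<open>If the first vertex of a path has its last neighbour on the path at index \<open>i\<close>, then the
  initial segment up to \<open>i\<close> closes up to a cycle, which can be left anywhere.\<close>

lemma lollipop:
  assumes "path xs" "xs \<noteq> []" "z \<in> set xs"
  obtains ys where "path ys" "ys \<noteq> []" "last ys = z" "set ys \<subseteq> set xs" "deg (set xs) (hd xs) < length ys"
proof -
  let ?x = "hd xs"
  define I where "I = {i. i < length xs \<and> E ?x (xs ! i)}"
  have d: "deg (set xs) ?x = card I"
  proof -
    have "set xs \<inter> {y. E ?x y} = (!) xs ` I" unfolding I_def by (auto simp: in_set_conv_nth)
    moreover have "inj_on ((!) xs) I"
      using path_distinct[OF assms(1)] unfolding I_def by (auto simp: inj_on_def nth_eq_iff_index_eq)
    ultimately show ?thesis unfolding deg_def by (simp add: card_image)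
  qed
  have finI: "finite I" unfolding I_def by auto
  have z0: "0 \<notin> I" using irr assms(2) unfolding I_def by (auto simp: hd_conv_nth)
  \<comment> \<open>With the default 0, a head without neighbours on the path falls under the first
    case below.\<close>
  define i where "i = (if I = {} then 0 else Max I)"
  have i: "I \<subseteq> {1..i}"
  proof (cases "I = {}")
    case False
    then show ?thesis using Max_ge[OF finI] z0 unfolding i_def by (force simp: Suc_le_eq intro: gr0I)
  qed simp
  then have ci: "card I \<le> i" using card_mono[OF _ i] by simp
  have il: "i < length xs" using Max_in[OF finI] assms(2) unfolding i_def by (auto simp: I_def)
  obtain j where j: "j < length xs" "z = xs ! j" using assms(3) by (auto simp: in_set_conv_nth)
  show ?thesis
  proof (cases "i \<le> j")
    case True
    let ?ys = "take (Suc j) xs"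
    have "last ?ys = z" using j by (simp add: take_Suc_conv_app_nth)
    then show ?thesis using that[of ?ys] path_take[OF assms(1)] j True ci d assms(2)
      by (auto dest: in_set_takeD)
  next
    case False
    then have Ei: "E ?x (xs ! i)" using Max_in[OF finI] unfolding i_def I_def by (auto split: if_splits)
    \<comment> \<open>Here \<open>z\<close> lies on the cycle formed by the first
      \<open>Suc i\<close> vertices. Cutting that cycle right behind \<open>z\<close> gives a path
      through all of them that ends in \<open>z\<close>.\<close>
    define a b where "a = take (Suc j) xs" and "b = drop (Suc j) (take (Suc i) xs)"
    have ab: "a @ b = take (Suc i) xs" unfolding a_def b_def using False
      by (metis append_take_drop_id le_SucI less_eq_Suc_le linorder_le_cases min.absorb1 not_less_eq_eq take_take)
    have pab: "path (a @ b)" using ab path_take assms(1) by simp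
    have la: "last a = z" "a \<noteq> []" "hd a = ?x" unfolding a_def
      using j assms(2) by (auto simp: take_Suc_conv_app_nth hd_append hd_conv_nth)
    have lb: "b \<noteq> []" unfolding b_def using False il by auto
    then have "last b = last (a @ b)" by simp
    also have "\<dots> = xs ! i" unfolding ab using il by (simp add: take_Suc_conv_app_nth)
    finally have lb2: "last b = xs ! i" .
    have "path (b @ a)" using pab sym[OF Ei] la lb lb2 unfolding path_append by auto
    moreover have "length (b @ a) = Suc i"
      using arg_cong[OF ab, of length] il by simp
    moreover have "set (b @ a) \<subseteq> set xs" using arg_cong[OF ab, of set] set_take_subset[of "Suc i" xs] by auto
    ultimately show ?thesis using that[of "b @ a"] la ci d by auto
  qed
qed

section \<open>Long cycles and Kopylov's disintegration\<close>

text \<open>Two crossing chords from the ends of \<open>P\<close> close up everything except the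
  segment strictly between \<open>j\<close> and \<open>i\<close>.\<close>

lemma split_cycle:
  assumes P: "path P" and ij: "j < i" "i < length P" and E1: "E (hd P) (P ! i)" and E2: "E (last P) (P ! j)"
  defines "C \<equiv> take (Suc j) P @ rev (drop i P)"
  shows "path C" "C \<noteq> []" "E (last C) (hd C)" "set C \<subseteq> set P" "length C = Suc j + (length P - i)"
proof -
  have d: "set (take (Suc j) P) \<inter> set (drop i P) = {}"
    using set_take_disj_set_drop_if_distinct[OF path_distinct[OF P]] ij by auto
  have "last (take (Suc j) P) = P ! j" "last (drop i P) = last P" "hd (drop i P) = P ! i"
    using ij by (auto simp: take_Suc_conv_app_nth hd_drop_conv_nth)
  then show "path C" unfolding C_def path_append
    using path_take[OF P] path_drop[OF P] d sym[OF E2] ij by (auto simp: hd_rev)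
  show "C \<noteq> []" "set C \<subseteq> set P" "length C = Suc j + (length P - i)"
    using ij unfolding C_def by (auto dest: in_set_takeD in_set_dropD)
  have "hd C = hd P" "last C = P ! i" unfolding C_def
    using ij \<open>hd (drop i P) = P ! i\<close> by (cases P; auto simp: last_rev hd_append)+
  then show "E (last C) (hd C)" using sym[OF E1] by simp
qed

lemma deg_path:
  assumes "path P"
  shows "deg (set P) x = card {i. i < length P \<and> E x (P ! i)}"
proof -
  have "set P \<inter> {y. E x y} = (!) P ` {i. i < length P \<and> E x (P ! i)}" by (auto simp: in_set_conv_nth)
  moreover have "inj_on ((!) P) {i. i < length P \<and> E x (P ! i)}"
    using path_distinct[OF assms] by (auto simp: inj_on_def nth_eq_iff_index_eq)
  ultimately show ?thesis unfolding deg_def by (simp add: card_image)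
qed

text \<open>Among the crossing pairs of chords take one at least distance. At distance 1 the cycle
  contains all of \<open>P\<close>. Otherwise the neighbours of the head, and those of the last
  vertex shifted by one, occupy disjoint sets of places, and these places together are no more than
  the vertices of the cycle.\<close>

lemma long_cycle:
  assumes P: "path P" and ij: "j < i" "i < length P" and E1: "E (hd P) (P ! i)" and E2: "E (last P) (P ! j)"
    and nE: "\<not> E (hd P) (last P)"
  obtains C where "path C" "C \<noteq> []" "E (last C) (hd C)" "set C \<subseteq> set P"
    "min (length P) (deg (set P) (hd P) + deg (set P) (last P)) \<le> length C"
proof -
  define X where "X = {i. i < length P \<and> E (hd P) (P ! i)}"
  define Y where "Y = {i. i < length P \<and> E (last P) (P ! i)}"
  define M where "M = (\<lambda>(j, i). j < i \<and> i \<in> X \<and> j \<in> Y)"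
  have "M (j, i)" using assms unfolding M_def X_def Y_def by auto
  then obtain p where p: "M p" "\<And>q. M q \<Longrightarrow> snd p - fst p \<le> snd q - fst q"
    using ex_has_least_nat[of M _ "\<lambda>q. snd q - fst q"] by blast
  obtain b a where ba: "p = (b, a)" by (cases p)
  have m: "b < a" "a \<in> X" "b \<in> Y" using p(1) unfolding ba M_def by auto
  have least: "a - b \<le> i - j" if "j < i" "i \<in> X" "j \<in> Y" for i j
    using p(2)[of "(j, i)"] that unfolding ba M_def by auto
  define C where "C = take (Suc b) P @ rev (drop a P)"
  have C: "path C" "C \<noteq> []" "E (last C) (hd C)" "set C \<subseteq> set P" "length C = Suc b + (length P - a)"
    using split_cycle[OF P, of b a] m unfolding X_def Y_def C_def by auto
  have al: "a < length P" using m unfolding X_def by auto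
  show ?thesis
  proof (cases "a = Suc b")
    case True
    then show ?thesis using that[of C] C al by auto
  next
    case False
    have X: "X \<subseteq> {1..b} \<union> {a..<length P}"
    proof
      fix i assume i: "i \<in> X"
      have "i \<noteq> 0" using i irr unfolding X_def by (cases P) (auto intro: gr0I)
      moreover have "\<not> (b < i \<and> i < a)" using least[of b i] i m by auto
      ultimately show "i \<in> {1..b} \<union> {a..<length P}" using i unfolding X_def by auto
    qed
    have ne: "P \<noteq> []" using al by auto
    have Y: "Suc ` Y \<subseteq> {1..Suc b} \<union> {Suc a..<length P}"
    proof
      fix i assume "i \<in> Suc ` Y"
      then obtain j where j: "j \<in> Y" "i = Suc j" by auto
      have "j \<noteq> length P - 1" using j irr ne unfolding Y_def by (auto simp: last_conv_nth)
      moreover have "\<not> (b < j \<and> j < a)" using least[of j a] j m by auto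
      ultimately show "i \<in> {1..Suc b} \<union> {Suc a..<length P}" using j unfolding Y_def by auto
    qed
    have disj: "X \<inter> Suc ` Y = {}"
    proof -
      have "i \<noteq> Suc j" if "i \<in> X" "j \<in> Y" for i j using least[of j i] that False m(1) by fastforce
      then show ?thesis by blast
    qed
    have fins: "finite X" "finite Y" unfolding X_def Y_def by auto
    have "card X + card Y = card (X \<union> Suc ` Y)"
      using disj fins by (simp add: card_Un_disjoint card_image)
    also have "\<dots> \<le> card ({1..Suc b} \<union> {a..<length P})"
      using X Y by (intro card_mono) auto
    also have "\<dots> = Suc b + (length P - a)"
      using False m(1) by (subst card_Un_disjoint) auto
    finally show ?thesis using that[of C] C deg_path[OF P] unfolding X_def Y_def by auto
  qed
qed

text \<open>\<open>None\<close> is the apex.\<close>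

definition cone_verts :: "'a option set" where
  "cone_verts = insert None (Some ` V)"

definition cone :: "'a option \<Rightarrow> 'a option \<Rightarrow> bool" where
  "cone a b = (case (a, b) of (Some x, Some y) \<Rightarrow> E x y | (None, Some y) \<Rightarrow> y \<in> V
    | (Some x, None) \<Rightarrow> x \<in> V | (None, None) \<Rightarrow> False)"

lemma cone_simps [simp]:
  "cone (Some x) (Some y) = E x y" "cone None (Some y) = (y \<in> V)"
  "cone (Some x) None = (x \<in> V)" "cone None None = False"
  by (simp_all add: cone_def)

lemma cone_verts_simps [simp]: "None \<in> cone_verts" "Some x \<in> cone_verts \<longleftrightarrow> x \<in> V"
  by (auto simp: cone_verts_def)

lemma cone_ugraph: "ugraph cone_verts cone"
proof
  show "finite cone_verts" using fin by (simp add: cone_verts_def)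
  show "cone a b \<Longrightarrow> cone b a" for a b by (cases a; cases b) (auto intro: sym)
  show "\<not> cone a a" for a by (cases a) (auto simp: irr)
  show "cone a b \<Longrightarrow> a \<in> cone_verts" for a b
    using inV by (cases a; cases b) (auto simp: cone_verts_def)
qed

lemma cone_path_map: "path xs \<Longrightarrow> ugraph.path cone_verts cone (map Some xs)"
proof (induction xs)
  case Nil
  interpret c: ugraph cone_verts cone by (rule cone_ugraph)
  show ?case by simp
next
  case (Cons x xs)
  interpret c: ugraph cone_verts cone by (rule cone_ugraph)
  from Cons show ?case unfolding path_Cons by (cases xs) (auto simp: c.path_Cons)
qed

lemma cone_path_without_apex:
  assumes "ugraph.path cone_verts cone ps" "None \<notin> set ps"
  obtains xs where "ps = map Some xs" "path xs"
  using assms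
proof (induction ps arbitrary: thesis)
  case Nil
  then show ?case by simp
next
  case (Cons a ps)
  interpret c: ugraph cone_verts cone by (rule cone_ugraph)
  obtain x where x: "a = Some x" using Cons.prems by (cases a) auto
  have 1: "c.path ps" "None \<notin> set ps" using Cons.prems unfolding c.path_Cons by auto
  obtain xs where xs: "ps = map Some xs" "path xs" using Cons.IH[OF _ 1] by blast
  have "path (x # xs)" using Cons.prems(2) xs unfolding x c.path_Cons path_Cons
    by (auto simp: hd_map)
  then show ?case using Cons.prems(1)[of "x # xs"] x xs by simp
qed

text \<open>Opening a cycle at the apex leaves a path with one vertex less. So if all paths have
  fewer than k vertices, no cycle of the cone has more than k.\<close>

lemma cone_cycle:
  assumes "ugraph.path cone_verts cone C" "C \<noteq> []" "cone (last C) (hd C)"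
  obtains xs where "path xs" "length C \<le> Suc (length xs)"
proof -
  interpret c: ugraph cone_verts cone by (rule cone_ugraph)
  show ?thesis
  proof (cases "None \<in> set C")
    case False
    then show ?thesis using cone_path_without_apex[OF assms(1)] that by (metis le_SucI length_map order_refl)
  next
    case True
    then obtain a b where C: "C = a @ [None] @ b" using split_list by fastforce
    have d: "None \<notin> set (b @ a)" using c.path_distinct[OF assms(1)] unfolding C by auto
    have pa: "c.path a" "c.path b" "set a \<inter> set b = {}" using assms(1) unfolding C c.path_append by auto
    have "b = [] \<or> a = [] \<or> cone (last b) (hd a)"
      using assms(3) unfolding C by (cases a; cases "b = []") auto
    then have "c.path (b @ a)" using pa unfolding c.path_append by auto
    then obtain xs where "b @ a = map Some xs" "path xs" using cone_path_without_apex d by metis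
    moreover from this(1) have "length b + length a = length xs" by (metis length_map length_append)
    ultimately show ?thesis using that[of xs] unfolding C by simp
  qed
qed

end

locale connected_ugraph = ugraph +
  assumes conn: "x \<in> V \<Longrightarrow> y \<in> V \<Longrightarrow> (x, y) \<in> {(a, b). E a b}\<^sup>*"
begin

lemma ex_linking_path:
  assumes "S \<subseteq> V" "T \<subseteq> V" "S \<noteq> {}" "T \<noteq> {}" "S \<inter> T = {}"
  obtains s u zs where "s \<in> S" "u \<in> T" "path (s # zs @ [u])" "set zs \<inter> (S \<union> T) = {}"
proof -
  obtain s u where su: "s \<in> S" "u \<in> T" using assms by blast
  then have "(s, u) \<in> {(a, b). E a b \<and> a \<in> UNIV \<and> b \<in> UNIV}\<^sup>*" using conn assms by auto
  from obtain_link[OF this su assms(5)] that show ?thesis by metis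
qed

text \<open>This serves the case of noncrossing chords in Kopylov's argument. Connectivity links the
  two paths, and \<open>lollipop\<close> reroutes each of them to end at the link while keeping more
  vertices than the degree of its head.\<close>

lemma linked_lollipops:
  assumes "path A" "path B" "A \<noteq> []" "B \<noteq> []" "set A \<inter> set B = {}"
  obtains xs where "path xs" "deg (set A) (hd A) + deg (set B) (hd B) + 2 \<le> length xs"
proof -
  obtain s u zs where l: "s \<in> set A" "u \<in> set B" "path (s # zs @ [u])" "set zs \<inter> (set A \<union> set B) = {}"
    using ex_linking_path[of "set A" "set B"] assms path_subset by auto
  obtain a where a: "path a" "a \<noteq> []" "last a = s" "set a \<subseteq> set A" "deg (set A) (hd A) < length a"
    using lollipop[OF assms(1,3) l(1)] by blast
  obtain b where b: "path b" "b \<noteq> []" "last b = u" "set b \<subseteq> set B" "deg (set B) (hd B) < length b"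
    using lollipop[OF assms(2,4) l(2)] by blast
  have pz: "path zs" using l(3) unfolding path_Cons path_append by auto
  have "path (a @ zs @ rev b)"
  proof (cases "zs = []")
    case True
    then have "E s u" using l(3) unfolding path_Cons by auto
    then show ?thesis using True a b l assms(5) unfolding path_append by (auto simp: hd_rev)
  next
    case False
    then have "E s (hd zs)" "E (last zs) u" using l(3) unfolding path_Cons path_append by auto
    then have "path (zs @ rev b)" using False a b l pz unfolding path_append by (auto simp: hd_rev)
    then show ?thesis unfolding path_append[of a]
      using False a b l assms(5) \<open>E s (hd zs)\<close> by (auto simp: hd_append)
  qed
  then show ?thesis using that[of "a @ zs @ rev b"] a b by simp
qed

text \<open>Kopylov's argument: among all nonadjacent pairs \<open>x \<in> T1\<close>, \<open>y \<in> T2\<close> take one joined by a longest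
  path of the cone. All neighbours of the ends inside \<open>T1\<close> and \<open>T2\<close> lie on that path.\<close>

lemma kopylov:
  assumes nopath: "\<And>xs. path xs \<Longrightarrow> length xs < k"
    and sat: "\<And>x y. x \<in> V \<Longrightarrow> y \<in> V \<Longrightarrow> x \<noteq> y \<Longrightarrow> \<not> E x y \<Longrightarrow>
      \<exists>A B. path A \<and> path B \<and> A \<noteq> [] \<and> B \<noteq> [] \<and> hd A = x \<and> hd B = y \<and> set A \<inter> set B = {}
        \<and> k \<le> length A + length B"
    and T: "T1 \<subseteq> V" "T2 \<subseteq> V" "\<And>x. x \<in> T1 \<Longrightarrow> d1 \<le> deg T1 x" "\<And>x. x \<in> T2 \<Longrightarrow> d2 \<le> deg T2 x"
    and d: "k \<le> d1 + d2 + 1"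
    and xy: "x \<in> T1" "y \<in> T2" "x \<noteq> y"
  shows "E x y"
proof (rule ccontr)
  assume nE: "\<not> E x y"
  interpret c: ugraph cone_verts cone by (rule cone_ugraph)
  define F where "F = (\<lambda>P. c.path P \<and> P \<noteq> [] \<and> (\<exists>x y. x \<in> T1 \<and> y \<in> T2 \<and> x \<noteq> y \<and> \<not> E x y
    \<and> hd P = Some x \<and> last P = Some y) \<and> k < length P)"
  obtain A B where AB: "path A" "path B" "A \<noteq> []" "B \<noteq> []" "hd A = x" "hd B = y" "set A \<inter> set B = {}"
    "k \<le> length A + length B" using sat[of x y] xy T nE by blast
  \<comment> \<open>Saturation provides the first candidate: \<open>A\<close>, the apex and
    \<open>B\<close> backwards have at least \<open>k + 1\<close> vertices.\<close>
  have "c.path (map Some A @ [None] @ rev (map Some B))"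
    unfolding c.path_append c.path_rev using cone_path_map[OF AB(1)] cone_path_map[OF AB(2)] AB
      path_subset[OF AB(1)] path_subset[OF AB(2)] last_in_set[OF AB(3)] hd_in_set[OF AB(4)]
    by (auto simp: hd_rev last_map hd_append)
  then have "F (map Some A @ [None] @ rev (map Some B))"
    unfolding F_def using AB xy nE by (auto simp: hd_append hd_map last_rev)
  moreover have "\<forall>P. F P \<longrightarrow> length P < Suc (card cone_verts)"
    using c.path_length unfolding F_def by (simp add: less_Suc_eq_le)
  ultimately obtain P where P: "F P" and max: "\<And>P'. F P' \<Longrightarrow> length P' \<le> length P"
    using ex_has_greatest_nat[of F _ length "Suc (card cone_verts)"] by blast
  obtain x y where p: "x \<in> T1" "y \<in> T2" "x \<noteq> y" "\<not> E x y" "hd P = Some x" "last P = Some y"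
    and P': "c.path P" "P \<noteq> []" "k < length P" using P unfolding F_def by blast
  have short: "length C \<le> k" if "c.path C" "C \<noteq> []" "cone (last C) (hd C)" for C
    using cone_cycle[OF that] nopath by (metis Suc_leI le_trans)
  have None_in: "None \<in> set P"
  proof (rule ccontr)
    assume "None \<notin> set P"
    then obtain xs where "P = map Some xs" "path xs" using cone_path_without_apex[OF P'(1)] by metis
    then show False using nopath[of xs] P'(3) by auto
  qed
  \<comment> \<open>A neighbour \<open>w\<close> of \<open>x\<close> in \<open>T1\<close> off
    \<open>P\<close> can be put in front of \<open>P\<close>. If \<open>w\<close> is adjacent to
    \<open>y\<close>, this closes a cycle that is too long; otherwise \<open>w\<close> and
    \<open>y\<close> are a nonadjacent pair with a longer path.\<close>
  have Sx: "Some ` (T1 \<inter> {y. E x y}) \<subseteq> set P"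
  proof
    fix a assume "a \<in> Some ` (T1 \<inter> {y. E x y})"
    then obtain w where w: "a = Some w" "w \<in> T1" "E x w" by auto
    show "a \<in> set P"
    proof (rule ccontr)
      assume n: "a \<notin> set P"
      have pw: "c.path (Some w # P)" unfolding c.path_Cons
        using P' n w p T sym[OF w(3)] by auto
      show False
      proof (cases "E w y")
        case True
        then show ?thesis using short[OF pw] P' sym[OF True] p by auto
      next
        case False
        have "w \<noteq> y" using n w p P'(2) by (metis last_in_set)
        then have "F (Some w # P)" unfolding F_def using pw False w p P' by auto
        then show ?thesis using max by fastforce
      qed
    qed
  qed
  have Sy: "Some ` (T2 \<inter> {z. E y z}) \<subseteq> set P"
  proof
    fix a assume "a \<in> Some ` (T2 \<inter> {z. E y z})"
    then obtain w where w: "a = Some w" "w \<in> T2" "E y w" by auto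
    show "a \<in> set P"
    proof (rule ccontr)
      assume n: "a \<notin> set P"
      have pw: "c.path (P @ [Some w])" unfolding c.path_append
        using P' n w p T by auto
      show False
      proof (cases "E x w")
        case True
        then show ?thesis using short[OF pw] P' sym[OF True] p by auto
      next
        case False
        have "w \<noteq> x" using n w p P'(2) by (metis hd_in_set)
        then have "F (P @ [Some w])" unfolding F_def using pw False w p P' by auto
        then show ?thesis using max by fastforce
      qed
    qed
  qed
  have fP: "finite (set P)" by simp
  have degx: "Suc (card (T1 \<inter> {y. E x y})) \<le> c.deg (set P) (Some x)"
  proof -
    have "insert None (Some ` (T1 \<inter> {y. E x y})) \<subseteq> set P \<inter> {y. cone (Some x) y}"
      using Sx None_in p T by auto
    from card_mono[OF _ this] have "card (insert None (Some ` (T1 \<inter> {y. E x y}))) \<le> c.deg (set P) (Some x)"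
      unfolding c.deg_def by simp
    moreover have "finite (T1 \<inter> {y. E x y})" using T fin finite_subset by blast
    ultimately show ?thesis by (simp add: card_image)
  qed
  have degy: "Suc (card (T2 \<inter> {z. E y z})) \<le> c.deg (set P) (Some y)"
  proof -
    have "insert None (Some ` (T2 \<inter> {z. E y z})) \<subseteq> set P \<inter> {z. cone (Some y) z}"
      using Sy None_in p T by auto
    from card_mono[OF _ this] have "card (insert None (Some ` (T2 \<inter> {z. E y z}))) \<le> c.deg (set P) (Some y)"
      unfolding c.deg_def by simp
    moreover have "finite (T2 \<inter> {y'. E y y'})" using T fin finite_subset by blast
    ultimately show ?thesis by (simp add: card_image)
  qed
  \<comment> \<open>The apex is one more neighbour of either end, so the two degrees sum to at least
    \<open>d1 + d2 + 2\<close>.\<close>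
  have big: "k < c.deg (set P) (Some x) + c.deg (set P) (Some y)"
    using degx degy T(3)[OF p(1)] T(4)[OF p(2)] d unfolding deg_def by linarith
  have nb: "\<not> (\<exists>i j. j < i \<and> i < length P \<and> cone (hd P) (P ! i) \<and> cone (last P) (P ! j))"
  proof
    assume "\<exists>i j. j < i \<and> i < length P \<and> cone (hd P) (P ! i) \<and> cone (last P) (P ! j)"
    then obtain i j where ij: "j < i" "i < length P" "cone (hd P) (P ! i)" "cone (last P) (P ! j)" by blast
    obtain C where "c.path C" "C \<noteq> []" "cone (last C) (hd C)"
      "min (length P) (c.deg (set P) (hd P) + c.deg (set P) (last P)) \<le> length C"
      using c.long_cycle[OF P'(1) ij] p by (metis cone_simps(1))
    then show False using short[of C] big p P'(3) by auto
  qed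
  obtain A' B' where PAB: "P = A' @ [None] @ B'" using None_in split_list by fastforce
  have nA: "None \<notin> set A'" "None \<notin> set B'" using c.path_distinct[OF P'(1)] unfolding PAB by auto
  have ne: "A' \<noteq> []" "B' \<noteq> []" using p unfolding PAB by auto
  have pA: "c.path A'" "c.path B'" "set A' \<inter> set B' = {}" using P'(1) unfolding PAB c.path_append by auto
  obtain A where A: "A' = map Some A" "path A" using cone_path_without_apex pA nA by metis
  obtain B where B: "B' = map Some B" "path B" using cone_path_without_apex pA nA by metis
  have hl: "hd A = x" "last B = y" "A \<noteq> []" "B \<noteq> []" using p ne unfolding PAB A B
    by (auto simp: hd_append hd_map last_map)
  \<comment> \<open>Both ends are adjacent to the apex. As no chords cross, the other neighbours of
    \<open>x\<close> precede it and those of \<open>y\<close> follow it, so removing it leaves two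
    disjoint paths that keep all these neighbours.\<close>
  let ?q = "length A"
  have q: "P ! ?q = None" "?q < length P" unfolding PAB A by (auto simp: nth_append)
  have "x \<in> V" "y \<in> V" using p T by auto
  then have cq: "cone (hd P) (P ! ?q)" "cone (last P) (P ! ?q)" using p q by auto
  have subx: "set P \<inter> {z. cone (Some x) z} \<subseteq> insert None (Some ` (set A \<inter> {z. E x z}))"
  proof
    fix a assume a: "a \<in> set P \<inter> {z. cone (Some x) z}"
    then obtain i where i: "i < length P" "a = P ! i" by (auto simp: in_set_conv_nth)
    have "\<not> ?q < i" using nb cq(2) i a p by auto
    then show "a \<in> insert None (Some ` (set A \<inter> {z. E x z}))" using i a q(1)
      unfolding PAB A B by (cases "i = ?q") (auto simp: nth_append)
  qed
  have suby: "set P \<inter> {z. cone (Some y) z} \<subseteq> insert None (Some ` (set (rev B) \<inter> {z. E y z}))"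
  proof
    fix a assume a: "a \<in> set P \<inter> {z. cone (Some y) z}"
    then obtain i where i: "i < length P" "a = P ! i" by (auto simp: in_set_conv_nth)
    have "\<not> i < ?q" using nb cq(1) i a p q(2) by auto
    moreover have "a = Some (B ! (i - Suc ?q)) \<and> i - Suc ?q < length B" if "?q < i"
      using i that unfolding PAB A B by (auto simp: nth_append nth_Cons')
    ultimately show "a \<in> insert None (Some ` (set (rev B) \<inter> {z. E y z}))" using i a q(1)
      by (cases "i = ?q") auto
  qed
  have "card (insert None (Some ` S)) = Suc (card S)" if "finite S" for S :: "'a set"
    using that by (simp add: card_image)
  then have "c.deg (set P) (Some x) \<le> Suc (deg (set A) x)"
    "c.deg (set P) (Some y) \<le> Suc (deg (set (rev B)) y)"
    using card_mono[OF _ subx] card_mono[OF _ suby] unfolding c.deg_def deg_def by simp_all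
  moreover obtain xs where "path xs" "deg (set A) (hd A) + deg (set (rev B)) (hd (rev B)) + 2 \<le> length xs"
    using linked_lollipops[of A "rev B"] A B hl pA by (auto simp: hd_rev)
  ultimately show False using nopath[of xs] big hl by (auto simp: hd_rev)
qed

end

section \<open>The \<open>t\<close>-core of a dense saturated graph\<close>

lemma kopylov_bound_arith:
  fixes t \<epsilon> n r :: nat
  assumes "t + 1 + \<epsilon> \<le> r" "r \<le> 2 * t + \<epsilon> - 2" "\<epsilon> \<le> 1" "3 * t - 1 \<le> n" "3 \<le> t"
  shows "int r * (int r - 1) + 2 * (int (2 * t + \<epsilon> - r - 1)) * int (n - r)
    \<le> 2 * (int t - 2) * int n + 3 * int t + 4 + 6 * int \<epsilon> - int t * int t"
proof -
  \<comment> \<open>At clique size \<open>t + 1 + \<epsilon>\<close> both sides agree. A larger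
    clique forces \<open>4 \<le> t\<close>, and then \<open>3 * t - 1 \<le> n\<close> makes the
    correction term nonpositive.\<close>
  define i where "i = int r - int (t + 1 + \<epsilon>)"
  have i: "0 \<le> i" "i \<le> int t - 3" using assms unfolding i_def by auto
  have r: "int r = int t + 1 + int \<epsilon> + i" unfolding i_def by simp
  have n: "int (n - r) = int n - int r" "int (2 * t + \<epsilon> - r - 1) = int t - 2 - i"
    using assms r by auto
  have e2: "int \<epsilon> * int \<epsilon> = int \<epsilon>" using assms(3) by (cases "\<epsilon> = 0") auto
  have neg: "i * (3 * i + 2 * int t + 7 + 4 * int \<epsilon> - 2 * int n) \<le> 0"
  proof (cases "i = 0")
    case False
    then have "3 * i + 2 * int t + 7 + 4 * int \<epsilon> - 2 * int n \<le> 0" using i assms by linarith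
    then show ?thesis using i(1) by (simp add: mult_nonneg_nonpos)
  qed simp
  have "int r * (int r - 1) + 2 * (int (2 * t + \<epsilon> - r - 1)) * int (n - r)
    = 2 * (int t - 2) * int n + 3 * int t + 4 + 5 * int \<epsilon> + int \<epsilon> * int \<epsilon> - int t * int t
      + i * (3 * i + 2 * int t + 7 + 4 * int \<epsilon> - 2 * int n)"
    unfolding n r by (simp add: algebra_simps)
  then show ?thesis using neg e2 by linarith
qed

locale path_free_graph = connected_ugraph +
  fixes t \<epsilon> :: nat
  assumes t: "2 \<le> t" and eps: "\<epsilon> \<le> 1" and large: "3 * t - 1 \<le> card V"
    and short: "path xs \<Longrightarrow> length xs \<le> 2 * t - 1 + \<epsilon>"

begin

text \<open>\<open>bound2 s\<close> is twice the number \<open>h(s + 1, 2t + \<epsilon> + 1, t - 1) - s\<close>.\<close>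

definition bound2 :: "nat \<Rightarrow> int" where
  "bound2 s = 2 * (int t - 2) * int s + 3 * int t + 4 + 6 * int \<epsilon> - int t * int t"

end

text \<open>A saturated graph above the bound. \<open>sat\<close> is maximality in the form needed:
  the path created by a new edge, cut at that edge.\<close>

locale dense_path_free_graph = path_free_graph +
  assumes dense: "bound2 (card V) < 2 * int (card (edges V))"
    and sat: "x \<in> V \<Longrightarrow> y \<in> V \<Longrightarrow> x \<noteq> y \<Longrightarrow> \<not> E x y \<Longrightarrow>
      \<exists>A B. path A \<and> path B \<and> A \<noteq> [] \<and> B \<noteq> [] \<and> hd A = x \<and> hd B = y \<and> set A \<inter> set B = {}
        \<and> 2 * t + \<epsilon> \<le> length A + length B"
begin

text \<open>Otherwise the \<open>t\<close>-core is nonempty, and by \<open>kopylov\<close> it is a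
  clique on some \<open>r\<close> vertices. A vertex of the
  \<open>(2 * t + \<epsilon> - r)\<close>-core outside it would, by \<open>kopylov\<close> again, be
  adjacent to the whole clique and hence belong to the \<open>t\<close>-core. So all vertices off
  the clique can be peeled off at \<open>2 * t + \<epsilon> - r - 1\<close> edges each, which stays
  within the bound.\<close>

lemma low_deg:
  assumes t3: "3 \<le> t" and S: "S \<subseteq> V" "t + \<epsilon> < card S"
  shows "\<exists>x\<in>S. deg S x \<le> t - 1"
proof (rule ccontr)
  assume "\<not> ?thesis"
  then have "\<And>x. x \<in> S \<Longrightarrow> t \<le> deg S x" using t3 by force
  then have ST: "S \<subseteq> core t" by (rule core_greatest[OF S(1)])
  define T where "T = core t"
  have TV: "T \<subseteq> V" "finite T" using core_subset fin finite_subset unfolding T_def by blast+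
  define r where "r = card T"
  have Td: "t \<le> deg T x" if "x \<in> T" for x using core_deg that unfolding T_def by blast
  have rS: "card S \<le> r" unfolding r_def T_def using ST TV card_mono T_def by blast
  then have ne: "T \<noteq> {}" using S unfolding r_def by auto
  have r1: "t + 1 \<le> r" using Td deg_le[OF TV(2)] ne t3 unfolding r_def
    by (metis Nat.le_diff_conv2 all_not_in_conv card_0_eq TV(2) le_trans not_less_eq_eq One_nat_def bot_nat_0.not_eq_extremum Suc_le_eq)
  have r2: "t + 1 + \<epsilon> \<le> r" using rS S r1 by linarith
  have lt: "path xs \<Longrightarrow> length xs < 2 * t + \<epsilon>" for xs using short[of xs] t by linarith
  have clique: "E x y" if "x \<in> T" "y \<in> T" "x \<noteq> y" for x y
    by (rule kopylov[OF lt sat TV(1) TV(1) Td Td _ that]) (use eps in auto)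
  have clique_path: "path xs" if "distinct xs" "set xs \<subseteq> T" for xs
    using that
  proof (induction xs)
    case (Cons x xs)
    then show ?case unfolding path_Cons using clique[of x "hd xs"] TV(1)
      by (cases xs) auto
  qed simp
  have degT: "deg T x = r - 1" if "x \<in> T" for x
  proof -
    have "T \<inter> {y. E x y} = T - {x}" using clique that irr by blast
    then show ?thesis unfolding deg_def r_def using that TV by simp
  qed
  obtain z where z: "z \<in> V - T"
  proof -
    obtain xs where xs: "set xs = T" "distinct xs" using finite_distinct_list TV by blast
    then have "r < 2 * t + \<epsilon>" using lt[OF clique_path[of xs]] distinct_card[of xs] unfolding r_def by auto
    then have "r < card V" using large t3 eps by linarith
    then show ?thesis using that TV unfolding r_def by (metis Diff_eq_empty_iff all_not_in_conv card_mono not_le)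
  qed
  obtain s u zs where l: "s \<in> T" "path (s # zs @ [u])" "set zs \<inter> (T \<union> {z}) = {}" "u = z"
    using ex_linking_path[of T "{z}"] z TV ne by (metis Diff_iff empty_iff disjoint_insert(2) inf_bot_right insertE insert_not_empty subsetI singletonD)
  define v where "v = hd (zs @ [u])"
  have v: "E s v" "v \<notin> T" "v \<in> V" using l z path_subset[OF l(2)] unfolding v_def path_Cons[of s]
    by (cases zs; auto)+
  \<comment> \<open>A neighbour \<open>v\<close> of the clique prolongs a path through all of
    \<open>T\<close>.\<close>
  have r3: "r \<le> 2 * t + \<epsilon> - 2"
  proof -
    obtain xs where xs: "set xs = T - {s}" "distinct xs" using finite_distinct_list TV by (metis finite_Diff)
    have "path (v # s # xs)" unfolding path_Cons[of v]
      using clique_path[of "s # xs"] xs l(1) v sym[OF v(1)] by auto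
    moreover have "length xs = r - 1" using xs l(1) TV distinct_card[OF xs(2)] unfolding r_def by simp
    ultimately show ?thesis using lt[of "v # s # xs"] r1 by simp
  qed
  have U: "core (2 * t + \<epsilon> - r) = T"
  proof
    show "T \<subseteq> core (2 * t + \<epsilon> - r)"
      by (rule core_greatest[OF TV(1)]) (use degT r2 eps in auto)
    show "core (2 * t + \<epsilon> - r) \<subseteq> T"
    proof
      fix x assume x: "x \<in> core (2 * t + \<epsilon> - r)"
      show "x \<in> T"
      proof (rule ccontr)
        assume xT: "x \<notin> T"
        have adj: "E x y" if "y \<in> T" for y
          by (rule kopylov[OF lt sat core_subset TV(1) core_deg _ _ x that, of "r - 1"])
            (use degT r1 r3 xT that in auto)
        have "insert x T \<subseteq> core t"
        proof (rule core_greatest)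
          show i: "insert x T \<subseteq> V" using TV core_subset x by blast
          fix y assume "y \<in> insert x T"
          moreover have "t \<le> deg (insert x T) x"
          proof -
            have "T \<subseteq> insert x T \<inter> {y. E x y}" using adj by auto
            from card_mono[OF _ this] show ?thesis using TV r1 unfolding deg_def r_def by simp
          qed
          moreover have "t \<le> deg (insert x T) y" if "y \<in> T"
            using Td[OF that] deg_mono[OF subset_insertI i, of y] by linarith
          ultimately show "t \<le> deg (insert x T) y" by auto
        qed
        then show False using xT unfolding T_def by auto
      qed
    qed
  qed
  have "card (edges V) \<le> card (edges T) + (2 * t + \<epsilon> - r - 1) * card (V - T)"
  proof (rule card_edges_degenerate[OF fin TV(1)])
    fix S' assume "T \<subset> S'" "S' \<subseteq> V"
    moreover have "Suc (2 * t + \<epsilon> - r - 1) = 2 * t + \<epsilon> - r" using r3 t3 by linarith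
    ultimately show "\<exists>x\<in>S' - T. deg S' x \<le> 2 * t + \<epsilon> - r - 1"
      using ex_low_deg_outside_core[of "2 * t + \<epsilon> - r - 1" S'] U by simp
  qed
  moreover have "card (V - T) = card V - r" unfolding r_def using TV by (simp add: card_Diff_subset)
  moreover have "2 * card (edges T) \<le> r * (r - 1)" using card_edges_le[OF TV(2)] unfolding r_def .
  ultimately have "2 * card (edges V) \<le> r * (r - 1) + 2 * ((2 * t + \<epsilon> - r - 1) * (card V - r))" by simp
  then have "int (2 * card (edges V)) \<le> int (r * (r - 1) + 2 * ((2 * t + \<epsilon> - r - 1) * (card V - r)))"
    unfolding of_nat_le_iff .
  also have "\<dots> = int r * (int r - 1) + 2 * int (2 * t + \<epsilon> - r - 1) * int (card V - r)"
    using r1 by (simp add: of_nat_diff)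
  also have "\<dots> \<le> bound2 (card V)" unfolding bound2_def
    by (rule kopylov_bound_arith[OF r2 r3 eps large t3])
  finally show False using dense by simp
qed

lemma card_edges_sharp:
  assumes "3 \<le> t" "S \<subseteq> V" "t - 1 \<le> card S"
  shows "2 * card (edges S) + (t - 1) * t \<le> 2 * (t - 1) * card S + 2 * \<epsilon>"
proof -
  have "2 * card (edges S) + (t - 1) * (t - 1 + 1) \<le> 2 * (t - 1) * card S + 2 * \<epsilon>"
  proof (rule card_edges_degenerate_sharp[OF _ assms(3) eps])
    show "finite S" using assms fin finite_subset by blast
    show "\<exists>x\<in>S'. deg S' x \<le> t - 1" if "S' \<subseteq> S" "t - 1 + 1 + \<epsilon> < card S'" for S'
      using low_deg[of S'] that assms by auto
  qed
  then show ?thesis using assms(1) by simp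
qed

end

context ugraph begin

section \<open>Longest paths\<close>

definition longest :: "'a list \<Rightarrow> bool" where
  "longest Q \<longleftrightarrow> path Q \<and> Q \<noteq> [] \<and> (\<forall>xs. path xs \<longrightarrow> length xs \<le> length Q)"

text \<open>Positions on a path are counted from 1; the virtual positions \<open>0\<close> and \<open>length Q + 1\<close>
  stand for the apex of the cone and count as neighbours of every vertex.\<close>

definition pos :: "'a list \<Rightarrow> 'a \<Rightarrow> nat set" where
  "pos Q w = {p. 1 \<le> p \<and> p \<le> length Q \<and> E w (Q ! (p - 1))}"

text \<open>A local form of the star forest condition: one end of every edge inside \<open>S\<close>
  is a leaf. It passes to subgraphs, and where it fails there is an edge that can be prolonged at
  both ends.\<close>

definition star_cond :: "'a set \<Rightarrow> bool" where
  "star_cond S \<longleftrightarrow> (\<forall>x\<in>S. \<forall>y\<in>S. E x y \<longrightarrow> (\<forall>z\<in>S. E x z \<longrightarrow> z = y) \<or> (\<forall>z\<in>S. E y z \<longrightarrow> z = x))"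

lemma longest_path: "longest Q \<Longrightarrow> path Q"
  and longest_ne: "longest Q \<Longrightarrow> Q \<noteq> []"
  and longest_le: "longest Q \<Longrightarrow> path xs \<Longrightarrow> length xs \<le> length Q"
  by (auto simp: longest_def)

lemma longest_rev: "longest Q \<Longrightarrow> longest (rev Q)"
  by (auto simp: longest_def)

lemma longest_eq: "longest Q \<Longrightarrow> path Q' \<Longrightarrow> length Q' = length Q \<Longrightarrow> longest Q'"
  by (auto simp: longest_def)

lemma finite_pos: "finite (pos Q w)"
  by (rule finite_subset[of _ "{..length Q}"]) (auto simp: pos_def)

lemma pos_le: "p \<in> pos Q w \<Longrightarrow> 1 \<le> p \<and> p \<le> length Q"
  by (simp add: pos_def)

lemma pos_E: "p \<in> pos Q w \<Longrightarrow> E w (Q ! (p - 1))"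
  by (simp add: pos_def)

lemma pos_rev: "pos (rev Q) w = (\<lambda>p. Suc (length Q) - p) ` pos Q w"
proof (intro equalityI subsetI)
  fix p assume p: "p \<in> pos (rev Q) w"
  then have "Suc (length Q) - p \<in> pos Q w" "p = Suc (length Q) - (Suc (length Q) - p)"
    by (auto simp: pos_def rev_nth Suc_diff_le)
  then show "p \<in> (\<lambda>p. Suc (length Q) - p) ` pos Q w" by blast
next
  fix p assume "p \<in> (\<lambda>p. Suc (length Q) - p) ` pos Q w"
  then show "p \<in> pos (rev Q) w" by (auto simp: pos_def rev_nth Suc_diff_le)
qed

lemma card_pos:
  assumes "path Q"
  shows "card (pos Q w) = card (set Q \<inter> {y. E w y})"
proof -
  have "set Q \<inter> {y. E w y} = (\<lambda>p. Q ! (p - 1)) ` pos Q w"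
  proof (intro equalityI subsetI)
    fix y assume "y \<in> set Q \<inter> {y. E w y}"
    then obtain i where "i < length Q" "y = Q ! i" "E w y" by (auto simp: in_set_conv_nth)
    then show "y \<in> (\<lambda>p. Q ! (p - 1)) ` pos Q w"
      by (intro image_eqI[of _ _ "Suc i"]) (auto simp: pos_def)
  qed (auto simp: pos_def)
  moreover have "inj_on (\<lambda>p. Q ! (p - 1)) (pos Q w)"
    using path_distinct[OF assms] by (auto simp: inj_on_def pos_def nth_eq_iff_index_eq)
  ultimately show ?thesis by (simp add: card_image)
qed

lemma last_take_pos: "1 \<le> p \<Longrightarrow> p \<le> length Q \<Longrightarrow> last (take p Q) = Q ! (p - 1)"
  by (cases p) (auto simp: take_Suc_conv_app_nth)

lemma hd_drop_pos: "1 \<le> p \<Longrightarrow> p \<le> length Q \<Longrightarrow> hd (drop (p - 1) Q) = Q ! (p - 1)"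
  by (simp add: hd_drop_conv_nth)

text \<open>The places strictly between \<open>p\<close> and \<open>p'\<close> are given to
  \<open>xs\<close>; with a virtual position, \<open>xs\<close> comes to stand at an end of the
  path.\<close>

lemma splice_path:
  assumes "path Q" "xs \<noteq> []" "path xs" "set xs \<inter> set Q = {}"
    and "p = 0 \<or> p \<in> pos Q (hd xs)" "p' = Suc (length Q) \<or> p' \<in> pos Q (last xs)" "p < p'"
  shows "path (take p Q @ xs @ drop (p' - 1) Q)"
proof -
  have "set (take p Q) \<inter> set (drop (p' - 1) Q) = {}"
    using set_take_disj_set_drop_if_distinct[OF path_distinct[OF assms(1)]] assms(7) by auto
  moreover have "p = 0 \<or> E (last (take p Q)) (hd xs)"
    using assms(5) pos_E pos_le last_take_pos sym by metis
  moreover have "p' = Suc (length Q) \<or> E (last xs) (hd (drop (p' - 1) Q))"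
    using assms(6) pos_E pos_le hd_drop_pos by metis
  ultimately show ?thesis unfolding path_append
    using assms path_take path_drop by (auto dest: in_set_takeD in_set_dropD)
qed

lemma splice_gap:
  assumes "longest Q" "xs \<noteq> []" "path xs" "set xs \<inter> set Q = {}"
    and "p = 0 \<or> p \<in> pos Q (hd xs)" "p' = Suc (length Q) \<or> p' \<in> pos Q (last xs)" "p < p'"
  shows "p + length xs < p'"
proof -
  have "length (take p Q @ xs @ drop (p' - 1) Q) \<le> length Q"
    using longest_le[OF assms(1) splice_path[OF longest_path[OF assms(1)] assms(2-7)]] .
  moreover have "p \<le> length Q" "p' \<le> Suc (length Q)" using assms(5-7) pos_le by fastforce+
  ultimately show ?thesis using assms(7) by auto
qed

lemma split3: "i \<le> j \<Longrightarrow> Q = take i Q @ drop i (take j Q) @ drop j Q"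
  by (metis append.assoc append_take_drop_id min.absorb1 take_take)

text \<open>\<open>Q ! p\<close> is the vertex at position \<open>p + 1\<close>. If it were adjacent
  to the one at \<open>q + 1\<close>, then going up to \<open>p\<close>, through \<open>w\<close> to
  \<open>q\<close>, back to \<open>p + 1\<close> and on from \<open>q + 1\<close> would insert
  \<open>w\<close> into \<open>Q\<close>.\<close>

lemma successors_nonadjacent:
  assumes Q: "longest Q" and w: "w \<in> V - set Q"
    and pq: "p \<in> insert 0 (pos Q w)" "q \<in> pos Q w" "p < q" "q < length Q"
  shows "\<not> E (Q ! p) (Q ! q)"
proof
  assume e: "E (Q ! p) (Q ! q)"
  define a b c where "a = take p Q" and "b = drop p (take q Q)" and "c = drop q Q"
  have Qe: "Q = a @ b @ c" unfolding a_def b_def c_def using pq by (intro split3) simp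
  have ne: "b \<noteq> []" "c \<noteq> []" using pq unfolding b_def c_def by auto
  have "hd b = Q ! p" "hd c = Q ! q" using pq unfolding b_def c_def
    by (auto simp: hd_drop_conv_nth)
  moreover have "last b = Q ! (q - 1)"
    using pq last_take_pos[of q Q] unfolding b_def by (auto simp: last_drop)
  moreover have "p = 0 \<or> E (last a) w" using pq pos_E[of p] pos_le[of p] unfolding a_def
    by (auto simp: last_take_pos sym)
  moreover have "p = 0 \<Longrightarrow> a = []" unfolding a_def by simp
  ultimately have "path (a @ [w] @ rev b @ c)"
    using longest_path[OF Q] w e pos_E[OF pq(2)] ne unfolding Qe path_append
    by (auto simp: hd_rev last_rev hd_append)
  then show False using longest_le[OF Q] unfolding Qe by fastforce
qed

end

section \<open>Paths entering a set from outside\<close>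

context connected_ugraph begin

text \<open>A link from \<open>A\<close> to \<open>X\<close>, continued inside \<open>X\<close> and
  cut off so that exactly \<open>m + 1\<close> vertices follow the start. Cutting may lose the
  contact with \<open>X\<close>; the last conclusion remembers it.\<close>

lemma entry_path:
  assumes "(s, u) \<in> {(a, b). E a b \<and> a \<in> U \<and> b \<in> U}\<^sup>*" "s \<in> A" "u \<in> X" "A \<inter> X = {}" "X \<subseteq> U"
    and ext: "\<And>u. u \<in> X \<Longrightarrow> \<exists>ys. path (u # ys) \<and> length ys = m \<and> set ys \<subseteq> X"
  obtains a zs where "a \<in> A" "path (a # zs)" "length zs = Suc m" "set zs \<subseteq> U - A"
    "\<exists>x\<in>X. \<exists>ys. path ys \<and> x \<in> set ys \<and> set zs \<subseteq> set ys \<and> set ys \<inter> A = {}"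
proof -
  obtain a x zs where l: "a \<in> A" "x \<in> X" "path (a # zs @ [x])" "set (a # zs @ [x]) \<subseteq> U"
    "set zs \<inter> (A \<union> X) = {}" using obtain_link[OF assms(1-4)] by metis
  obtain ys where ys: "path (x # ys)" "length ys = m" "set ys \<subseteq> X" using ext[OF l(2)] by blast
  have p: "path ((a # zs @ [x]) @ ys)"
    using l ys assms(4) unfolding path_append[of "a # zs @ [x]"] path_Cons[of x] by auto
  let ?W = "zs @ [x] @ ys"
  have s1: "set (take (m + 1) ?W) \<subseteq> set ?W" by (rule set_take_subset)
  have s2: "set ?W \<subseteq> U - A" using l ys assms(4,5) by auto
  have pW: "path ?W" using p unfolding append_Cons path_Cons[of a] by simp
  show ?thesis
  proof (rule that[of a "take (m + 1) ?W"])
    show "path (a # take (m + 1) ?W)" using path_take[OF p, of "m + 2"] by simp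
    show "length (take (m + 1) ?W) = Suc m" using ys by simp
    show "set (take (m + 1) ?W) \<subseteq> U - A" using s1 s2 by blast
    have "x \<in> set ?W" "set ?W \<inter> A = {}" using s2 by auto
    then show "\<exists>x\<in>X. \<exists>ys. path ys \<and> x \<in> set ys \<and> set (take (m + 1) ?W) \<subseteq> set ys \<and> set ys \<inter> A = {}"
      using l(2) pW s1 by blast
  qed (rule l(1))
qed

text \<open>An edge \<open>xy\<close> that violates the condition has further neighbours
  \<open>x'\<close> of \<open>x\<close> and \<open>y'\<close> of \<open>y\<close>, possibly equal.
  From each of these vertices a path on three vertices runs among them.\<close>

lemma bad_edge_extension:
  assumes "\<not> star_cond S" "S \<subseteq> V"
  obtains X where "X \<subseteq> S" "X \<noteq> {}" "\<And>u. u \<in> X \<Longrightarrow> \<exists>ys. path (u # ys) \<and> length ys = 2 \<and> set ys \<subseteq> X"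
proof -
  obtain x y x' y' where b: "x \<in> S" "y \<in> S" "E x y" "x' \<in> S" "E x x'" "x' \<noteq> y" "y' \<in> S" "E y y'" "y' \<noteq> x"
    using assms(1) unfolding star_cond_def by blast
  have ne: "x \<noteq> y" "x \<noteq> x'" "y \<noteq> y'" using b irr by blast+
  have p: "path [x, y, y']" "path [y, x, x']" "path [x', x, y]" "path [y', y, x]"
    using b ne assms(2) sym_iff unfolding path_Cons by auto
  show ?thesis
  proof (rule that[of "{x, y, x', y'}"])
    fix u assume "u \<in> {x, y, x', y'}"
    moreover have "\<exists>ys. path (x # ys) \<and> length ys = 2 \<and> set ys \<subseteq> {x, y, x', y'}"
      using p by (intro exI[of _ "[y, y']"]) auto
    moreover have "\<exists>ys. path (y # ys) \<and> length ys = 2 \<and> set ys \<subseteq> {x, y, x', y'}"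
      using p by (intro exI[of _ "[x, x']"]) auto
    moreover have "\<exists>ys. path (x' # ys) \<and> length ys = 2 \<and> set ys \<subseteq> {x, y, x', y'}"
      using p by (intro exI[of _ "[x, y]"]) auto
    moreover have "\<exists>ys. path (y' # ys) \<and> length ys = 2 \<and> set ys \<subseteq> {x, y, x', y'}"
      using p by (intro exI[of _ "[y, x]"]) auto
    ultimately show "\<exists>ys. path (u # ys) \<and> length ys = 2 \<and> set ys \<subseteq> {x, y, x', y'}" by blast
  qed (use b in auto)
qed

end

context ugraph begin

section \<open>A vertex with many neighbours on a longest path\<close>

lemma pos_single_gap:
  assumes "longest Q" "w \<in> V - set Q" "p \<in> insert 0 (pos Q w)" "q \<in> insert (Suc (length Q)) (pos Q w)" "p < q"
  shows "Suc p < q"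
  using splice_gap[of Q "[w]" p q] assms by auto

text \<open>\<open>successors_nonadjacent\<close> read backwards. \<open>Q ! (q - 2)\<close> has
  position \<open>q - 1\<close>, and the virtual position \<open>Suc (length Q)\<close> makes the
  last vertex a predecessor too.\<close>

lemma predecessors_nonadjacent:
  assumes Q: "longest Q" and w: "w \<in> V - set Q"
    and pq: "p \<in> pos Q w" "q \<in> insert (Suc (length Q)) (pos Q w)" "p < q" "1 < p"
  shows "\<not> E (Q ! (p - 2)) (Q ! (q - 2))"
proof -
  let ?L = "length Q"
  have b: "p \<le> ?L" "q \<le> Suc ?L" using pq pos_le[of p Q w] pos_le[of q Q w] by auto
  have "Suc ?L - q \<in> insert 0 (pos (rev Q) w)" "Suc ?L - p \<in> pos (rev Q) w"
    unfolding pos_rev using pq by auto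
  from successors_nonadjacent[OF longest_rev[OF Q] _ this] w b pq
  have "\<not> E (rev Q ! (Suc ?L - q)) (rev Q ! (Suc ?L - p))" by auto
  moreover have "rev Q ! (Suc ?L - q) = Q ! (q - 2)" "rev Q ! (Suc ?L - p) = Q ! (p - 2)"
    using b pq by (auto simp: rev_nth numeral_2_eq_2 intro!: arg_cong[where f = "(!) Q"])
  ultimately show ?thesis using sym by auto
qed

text \<open>Start at \<open>z\<close>, run from position \<open>p + 1\<close> to the penultimate
  one, cross \<open>w\<close> and return from \<open>p\<close> to the beginning: only the last
  vertex of \<open>Q\<close> is lost, while \<open>z\<close> and \<open>w\<close> are
  gained.\<close>

lemma successor_no_outside_neighbour:
  assumes Q: "longest Q" and w: "w \<in> V - set Q" and l: "length Q - 1 \<in> pos Q w"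
    and p: "p \<in> insert 0 (pos Q w)" and z: "z \<in> V - set Q"
  shows "\<not> E (Q ! p) z"
proof
  assume e: "E (Q ! p) z"
  let ?L = "length Q"
  have pQ: "path Q" by (rule longest_path[OF Q])
  have L: "2 \<le> ?L" using pos_le[OF l] by simp
  have pL: "p < ?L" using pos_single_gap[OF Q w p, of "Suc ?L"] p pos_le[of p Q w] by fastforce
  show False
  proof (cases "p = 0")
    case True
    then have "path (z # Q)" using e z pQ sym[OF e] longest_ne[OF Q] by (simp add: path_Cons hd_conv_nth)
    then show False using longest_le[OF Q] by fastforce
  next
    case False
    then have pN: "p \<in> pos Q w" using p by simp
    show False
    proof (cases "p = ?L - 1")
      case True
      then have "path (Q @ [z])" using e z pQ longest_ne[OF Q] by (simp add: path_append last_conv_nth)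
      then show False using longest_le[OF Q] by fastforce
    next
      case False
      define a b c where "a = take p Q" and "b = drop p (take (?L - 1) Q)" and "c = drop (?L - 1) Q"
      have Qe: "Q = a @ b @ c" unfolding a_def b_def c_def using pL False by (intro split3) simp
      have "z \<noteq> w"
      proof
        assume "z = w"
        then have "Suc p \<in> pos Q w" using e pL sym by (auto simp: pos_def)
        then show False using pos_single_gap[OF Q w p, of "Suc p"] by auto
      qed
      moreover have "b \<noteq> []" "a \<noteq> []" using pL False \<open>p \<noteq> 0\<close> L unfolding b_def a_def by auto
      moreover have "hd b = Q ! p" using pL False unfolding b_def by (auto simp: hd_drop_conv_nth)
      moreover have "last b = Q ! (?L - 1 - 1)"
        using pL False L last_take_pos[of "?L - 1" Q] unfolding b_def by (auto simp: last_drop)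
      moreover have "E w (last a)" using pN pos_E pos_le[OF pN] unfolding a_def by (simp add: last_take_pos)
      moreover have "E w (Q ! (?L - 1 - 1))" using pos_E[OF l] .
      ultimately have "path ([z] @ b @ [w] @ rev a)"
        using pQ w z sym[OF e] sym unfolding Qe path_append
        by (auto simp: hd_rev hd_append)
      moreover have "length a + length b = ?L - 1" unfolding a_def b_def using pL by simp
      ultimately show False using longest_le[OF Q, of "[z] @ b @ [w] @ rev a"] L by simp
    qed
  qed
qed

text \<open>\<open>z\<close>, \<open>w\<close> and all of \<open>Q\<close> but its last vertex would
  form a longer path.\<close>

lemma outside_no_outside_neighbour:
  assumes Q: "longest Q" and w: "w \<in> V - set Q" and l: "length Q - 1 \<in> pos Q w" and z: "z \<in> V - set Q"
  shows "\<not> E w z"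
proof
  assume e: "E w z"
  have L: "2 \<le> length Q" using pos_le[OF l] by simp
  have "E w (last (take (length Q - 1) Q))" using pos_E[OF l] last_take_pos[of "length Q - 1" Q] L by simp
  moreover have "take (length Q - 1) Q \<noteq> []" using L by auto
  moreover have "z \<noteq> w" using e irr by blast
  ultimately have "path (z # w # rev (take (length Q - 1) Q))"
    using w z e sym[OF e] path_take[OF longest_path[OF Q]] unfolding path_Cons
    by (auto simp: hd_rev dest: in_set_takeD)
  then show False using longest_le[OF Q] L by fastforce
qed

text \<open>The positions \<open>lo, \<dots>, L - 1\<close> together with \<open>w\<close> form a cycle; a path leaving it has at most
  \<open>lo - 1\<close> further vertices.\<close>

lemma cycle_tail:
  assumes Q: "longest Q" and w: "w \<in> V - set Q" and l: "length Q - 1 \<in> pos Q w"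
    and lo: "lo \<in> pos Q w" "\<And>p. p \<in> pos Q w \<Longrightarrow> lo \<le> p" and p: "p \<in> pos Q w"
    and zs: "path (Q ! (p - 1) # zs)" "w \<notin> set zs" "set zs \<inter> set (drop (lo - 1) (take (length Q - 1) Q)) = {}"
  shows "length zs < lo"
proof (cases "zs = []")
  case True
  then show ?thesis using pos_le[OF lo(1)] by simp
next
  case False
  let ?L = "length Q"
  have pQ: "path Q" by (rule longest_path[OF Q])
  have b: "1 \<le> lo" "lo \<le> p" "p < ?L" using lo p pos_le[OF lo(1)] pos_le[OF p]
      pos_single_gap[OF Q w, of p "Suc ?L"] by auto
  have pl: "p \<le> ?L - 1" using b by simp
  define a b' c d where "a = take (lo - 1) Q" and "b' = drop (lo - 1) (take (p - 1) Q)"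
    and "c = drop (p - 1) (take (?L - 1) Q)" and "d = drop (?L - 1) Q"
  have Q4: "Q = a @ b' @ c @ d"
  proof -
    have "Q = take (p - 1) Q @ c @ d" unfolding c_def d_def using b by (intro split3) simp
    moreover have "take (p - 1) Q = a @ b'" unfolding a_def b'_def using b
      by (metis append_take_drop_id diff_le_mono min.absorb1 take_take)
    ultimately show ?thesis by simp
  qed
  have cb: "set b' \<subseteq> set (drop (lo - 1) (take (?L - 1) Q))" "set c \<subseteq> set (drop (lo - 1) (take (?L - 1) Q))"
  proof -
    have "drop (lo - 1) (take (?L - 1) Q) = b' @ c"
    proof -
      have "take (?L - 1) Q = a @ b' @ c" using Q4 unfolding d_def
        by (metis append.assoc append_take_drop_id append_same_eq)
      moreover have "length a = lo - 1" unfolding a_def using b by simp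
      ultimately show ?thesis by simp
    qed
    then show "set b' \<subseteq> set (drop (lo - 1) (take (?L - 1) Q))" "set c \<subseteq> set (drop (lo - 1) (take (?L - 1) Q))" by auto
  qed
  have "c \<noteq> []" using b pl unfolding c_def by auto
  moreover have "hd c = Q ! (p - 1)" using b pl unfolding c_def by (auto simp: hd_drop_conv_nth)
  moreover have "last c = Q ! (?L - 1 - 1)"
    using b pl last_take_pos[of "?L - 1" Q] unfolding c_def by (auto simp: last_drop)
  moreover have "E (Q ! (?L - 1 - 1)) w" using sym[OF pos_E[OF l]] .
  moreover have "b' = [] \<or> E w (hd b')"
  proof (cases "lo < p")
    case True
    then have "hd b' = Q ! (lo - 1)" using b unfolding b'_def by (auto simp: hd_drop_conv_nth)
    then show ?thesis using pos_E[OF lo(1)] by simp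
  qed (use b in \<open>auto simp: b'_def\<close>)
  moreover have "E (Q ! (p - 1)) (hd zs)" "path zs" using zs(1) False unfolding path_Cons by auto
  then have "E (hd zs) (Q ! (p - 1))" "path zs" using sym by blast+
  moreover have "set zs \<inter> set c = {}" "set zs \<inter> set b' = {}" using zs(3) cb by blast+
  moreover have "path c" "path b'" "set b' \<inter> set c = {}" using pQ unfolding Q4 path_append by auto
  moreover have "w \<notin> set c" "w \<notin> set b'" "w \<in> V" using w unfolding Q4 by auto
  ultimately have "path (rev zs @ c @ [w] @ b')"
    unfolding path_append using zs(2) False by (simp add: last_rev Int_commute Int_Un_distrib)
  moreover have "length b' = p - lo" "length c = ?L - p" unfolding b'_def c_def using b by auto
  ultimately show ?thesis using longest_le[OF Q, of "rev zs @ c @ [w] @ b'"] b by simp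
qed

end

context connected_ugraph begin

lemma entry_path_connected:
  assumes "A \<subseteq> V" "A \<noteq> {}" "X \<subseteq> V - A" "X \<noteq> {}"
    and ext: "\<And>u. u \<in> X \<Longrightarrow> \<exists>ys. path (u # ys) \<and> length ys = m \<and> set ys \<subseteq> X"
  obtains a zs where "a \<in> A" "path (a # zs)" "length zs = Suc m" "set zs \<subseteq> V - A"
proof -
  obtain s u where su: "s \<in> A" "u \<in> X" using assms by blast
  have "{(a, b). E a b \<and> a \<in> V \<and> b \<in> V} = {(a, b). E a b}" using inV inV2 by blast
  then have "(s, u) \<in> {(a, b). E a b \<and> a \<in> V \<and> b \<in> V}\<^sup>*" using conn[of s u] su assms by auto
  from entry_path[OF this su _ _ ext] that assms(3) show ?thesis by (metis Diff_disjoint Diff_subset disjoint_iff subset_trans Diff_iff subsetD)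
qed

end

context path_free_graph begin

lemma ex_longest: obtains Q where "longest Q"
proof -
  obtain v where "v \<in> V" using large t by fastforce
  then have "path [v] \<and> [v] \<noteq> []" by simp
  moreover have "\<forall>xs. path xs \<and> xs \<noteq> [] \<longrightarrow> length xs < Suc (card V)" using path_length by (simp add: less_Suc_eq_le)
  ultimately obtain Q where "path Q \<and> Q \<noteq> []" "\<forall>xs. path xs \<and> xs \<noteq> [] \<longrightarrow> length xs \<le> length Q"
    using ex_has_greatest_nat[of "\<lambda>xs. path xs \<and> xs \<noteq> []" "[v]" length "Suc (card V)"] by blast
  then have "longest Q" unfolding longest_def by force
  then show ?thesis using that by blast
qed

text \<open>The neighbour positions together with 0, and their successors, are disjoint and fill at
  least \<open>2 * t\<close> of the at most \<open>2 * t + 1\<close> places from 0 to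
  \<open>length Q\<close>. So at most one place is uncovered, and none if
  \<open>length Q < 2 * t\<close>. Successors span no edge; what remains are the uncovered place and
  the edges off \<open>Q\<close>.\<close>

lemma rich_vertex_of_penultimate:
  assumes Q: "longest Q" and w: "w \<in> V - set Q" and rich: "t - 1 \<le> card (pos Q w)"
    and l: "length Q - 1 \<in> pos Q w"
  defines "A \<equiv> set Q \<inter> {y. E w y}"
  shows "card A \<le> t - 1" "length Q < 2 * t \<Longrightarrow> \<forall>x\<in>V - A. \<forall>y\<in>V - A. \<not> E x y" "star_cond (V - A)"
proof -
  let ?L = "length Q" and ?N = "pos Q w"
  define U where "U = insert 0 ?N"
  have pQ: "path Q" by (rule longest_path[OF Q])
  have L: "?L \<le> 2 * t" using short[OF pQ] eps t by linarith
  have gap: "Suc p < q" if "p \<in> U" "q \<in> insert (Suc ?L) ?N" "p < q" for p q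
    using pos_single_gap[OF Q w] that unfolding U_def by blast
  have N0: "0 \<notin> ?N" using pos_le by fastforce
  have fN: "finite ?N" by (rule finite_pos)
  have UL: "p \<le> ?L - 1" if "p \<in> U" for p
    using gap[OF that, of "Suc ?L"] that pos_le[of p] unfolding U_def by fastforce
  have L2: "2 \<le> ?L" using pos_le[OF l] by simp
  have disj: "U \<inter> Suc ` U = {}" using gap unfolding U_def by fastforce
  have fU: "finite U" using fN unfolding U_def by simp
  have cU: "card U = Suc (card ?N)" using N0 fN unfolding U_def by simp
  have cov_card: "card (U \<union> Suc ` U) = 2 * Suc (card ?N)"
    using card_Un_disjoint[OF _ _ disj] fU cU by (simp add: card_image)
  have cov_sub: "U \<union> Suc ` U \<subseteq> {0..?L}" using UL L2 by fastforce
  have le1: "2 * Suc (card ?N) \<le> Suc ?L" using card_mono[OF _ cov_sub] cov_card by simp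
  then show cA: "card A \<le> t - 1" using card_pos[OF pQ, of w] L unfolding A_def by arith
  define Cv where "Cv = U \<union> Suc ` U"
  have unc: "card ({0..?L} - Cv) \<le> Suc ?L - 2 * t"
    using cov_card cov_sub rich t fU unfolding Cv_def by (subst card_Diff_subset) auto
  have unc1: "e = e'" if "e \<le> ?L" "e \<notin> Cv" "e' \<le> ?L" "e' \<notin> Cv" for e e'
  proof (rule ccontr)
    assume "e \<noteq> e'"
    then have "card {e, e'} = 2" by simp
    moreover have "card {e, e'} \<le> card ({0..?L} - Cv)" using that by (intro card_mono) auto
    ultimately show False using unc L by linarith
  qed
  have unc0: "?L = 2 * t" if "e \<le> ?L" "e \<notin> Cv" for e
  proof -
    have "card {e} \<le> card ({0..?L} - Cv)" using that by (intro card_mono) auto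
    then show ?thesis using unc L by simp
  qed
  have AV: "A \<subseteq> V" using path_subset[OF pQ] unfolding A_def by auto
  have A_pos: "Q ! (p - 1) \<in> A \<longleftrightarrow> p \<in> ?N" if "1 \<le> p" "p \<le> ?L" for p
    using that unfolding A_def pos_def by auto
  have Q_pos: "\<exists>p. 1 \<le> p \<and> p \<le> ?L \<and> z = Q ! (p - 1)" if zQ: "z \<in> set Q" for z
  proof -
    obtain i where "i < ?L" "z = Q ! i" using zQ by (auto simp: in_set_conv_nth)
    then show ?thesis by (intro exI[of _ "Suc i"]) auto
  qed
  have succ_of: "p - 1 \<in> U" if "1 \<le> p" "p \<le> ?L" "p \<notin> ?N" "p \<in> Cv" for p
    using that unfolding U_def Cv_def by auto
  have pred_of: "Suc p \<in> insert (Suc ?L) ?N" if "1 \<le> p" "p \<le> ?L" "p \<notin> ?N"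
    "Suc p \<in> Cv \<or> p = ?L" for p
    using that unfolding U_def Cv_def by auto
  have on_Q: "Suc p = q \<and> q \<notin> Cv"
    if "1 \<le> p" "p < q" "q \<le> ?L" "p \<notin> ?N" "q \<notin> ?N" "E (Q ! (p - 1)) (Q ! (q - 1))" for p q
  proof (rule ccontr)
    assume n: "\<not> (Suc p = q \<and> q \<notin> Cv)"
    show False
    proof (cases "p \<in> Cv \<and> q \<in> Cv")
      case True
      then have "p - 1 \<in> U" "q - 1 \<in> U" using succ_of that by auto
      then show False using successors_nonadjacent[OF Q w, of "p - 1" "q - 1"] that unfolding U_def by auto
    next
      case False
      have "p \<in> Cv \<or> q \<in> Cv" using unc1[of p q] that by auto
      \<comment> \<open>With one of \<open>p\<close>, \<open>q\<close> uncovered, the places behind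
        both are covered. Since \<open>p\<close> and \<open>q\<close> are no neighbours of
        \<open>w\<close>, the next places are (or lie behind the end), so both vertices are
        predecessors.\<close>
      then have "(Suc p \<in> Cv \<or> p = ?L) \<and> (Suc q \<in> Cv \<or> q = ?L)"
      proof
        assume "p \<in> Cv"
        then have "q \<notin> Cv" "Suc p \<noteq> q" using False n by auto
        then show ?thesis using unc1[of q "Suc p"] unc1[of q "Suc q"] that by (metis Suc_leI le_less_trans n_not_Suc_n nless_le)
      next
        assume "q \<in> Cv"
        then have "p \<notin> Cv" using False by auto
        then show ?thesis using unc1[of p "Suc p"] unc1[of p "Suc q"] that
          by (metis Suc_leI Suc_n_not_le_n le_less_trans n_not_Suc_n nless_le less_imp_le)
      qed
      moreover have "1 \<le> q" "p \<le> ?L" using that by auto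
      ultimately have "Suc p \<in> insert (Suc ?L) ?N" "Suc q \<in> insert (Suc ?L) ?N"
        using pred_of[of p] pred_of[of q] that by blast+
      then show False using predecessors_nonadjacent[OF Q w, of "Suc p" "Suc q"] that by auto
    qed
  qed
  have w_iso: "\<not> E w z" if "z \<in> V - A" for z
    using outside_no_outside_neighbour[OF Q w l, of z] that unfolding A_def by auto
  have succ_out: "\<not> E (Q ! (p - 1)) z" if "p - 1 \<in> U" "1 \<le> p" "z \<in> V - set Q" for p z
    using successor_no_outside_neighbour[OF Q w l _ that(3), of "p - 1"] that unfolding U_def by auto
  define lo where "lo = Min ?N"
  have lo: "lo \<in> ?N" "\<And>p. p \<in> ?N \<Longrightarrow> lo \<le> p" using fN l unfolding lo_def by (auto intro: Min_in)
  have lo2: "2 \<le> lo" using gap[of 0 lo] lo pos_le[OF lo(1)] unfolding U_def by auto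
  \<comment> \<open>Position 1 is never a neighbour. If 2 is none either, it is the one uncovered
    place, and 3 must be a neighbour.\<close>
  have lo3: "lo = 2 \<or> lo = 3 \<and> 2 \<notin> Cv"
  proof -
    have "1 \<notin> ?N" using gap[of 0 1] unfolding U_def by auto
    then have "2 \<notin> Cv" if "lo \<noteq> 2"
      using that lo(2)[of 2] lo2 unfolding U_def Cv_def by (auto simp: numeral_2_eq_2)
    moreover have "3 \<in> ?N" if "2 \<notin> Cv"
    proof -
      have "2 \<noteq> ?L" using that l \<open>1 \<notin> ?N\<close> by auto
      then have "3 \<in> Cv" using unc1[of 2 3] that L2 by auto
      then show ?thesis using that unfolding U_def Cv_def by (auto simp: numeral_3_eq_3 numeral_2_eq_2)
    qed
    ultimately show ?thesis using lo lo2 by (metis Suc_1 le_antisym not_less_eq_eq numeral_2_eq_2 numeral_3_eq_3)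
  qed
  \<comment> \<open>\<open>K\<close> collects the vertices of \<open>Q\<close> that a path hanging
    on \<open>A\<close> will turn out unable to use. If \<open>lo = 3\<close>, the first two
    positions lie before the cycle through \<open>w\<close> and have to be left out.\<close>
  define K where "K = (\<lambda>x. \<exists>p. 1 \<le> p \<and> p \<le> ?L \<and> (lo = 2 \<or> lo \<le> p) \<and> x = Q ! (p - 1))"
  have K_nb: "\<exists>q. 1 \<le> q \<and> q \<le> ?L \<and> y = Q ! (q - 1) \<and> lo = 2 \<and>
      (Suc p = q \<and> q \<notin> Cv \<or> Suc q = p \<and> p \<notin> Cv)"
    if p: "1 \<le> p" "p \<le> ?L" "lo = 2 \<or> lo \<le> p" "p \<notin> ?N" and y: "y \<in> V - A" "E (Q ! (p - 1)) y" for p y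
  proof -
    have "y \<in> set Q"
    proof (rule ccontr)
      assume yQ: "y \<notin> set Q"
      have punc: "p \<notin> Cv" using succ_of[OF p(1,2,4)] succ_out[of p y] p(1) y yQ by auto
      have l2: "lo = 2"
      proof (rule ccontr)
        assume "lo \<noteq> 2"
        then have "p = 2" "lo = 3" using lo3 unc1[OF p(2) punc, of 2] L2 by auto
        then show False using p by simp
      qed
      have "Suc p \<in> Cv \<or> p = ?L" using unc1[OF p(2) punc, of "Suc p"] p(2) by fastforce
      then have sp: "Suc p \<in> insert (Suc ?L) ?N" using pred_of[OF p(1,2,4)] by blast
      \<comment> \<open>In \<open>rev Q\<close> the position \<open>lo = 2\<close> is the
        penultimate one, so the statement on successors becomes one on predecessors.\<close>
      have "?L - p \<in> insert 0 (pos (rev Q) w)" using sp pos_le[of "Suc p" Q w] unfolding pos_rev by force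
      moreover have "length (rev Q) - 1 \<in> pos (rev Q) w" using lo(1) l2 unfolding pos_rev by force
      ultimately have "\<not> E (rev Q ! (?L - p)) y"
        using successor_no_outside_neighbour[OF longest_rev[OF Q], of w "?L - p" y] w y yQ by auto
      moreover have "rev Q ! (?L - p) = Q ! (p - 1)" using p(1,2) by (simp add: rev_nth)
      ultimately show False using y by simp
    qed
    then obtain q where q: "1 \<le> q" "q \<le> ?L" "y = Q ! (q - 1)" using Q_pos by blast
    have qN: "q \<notin> ?N" using A_pos[of q] q y by auto
    have "q \<noteq> p" using y irr q p by auto
    then have c: "Suc p = q \<and> q \<notin> Cv \<or> Suc q = p \<and> p \<notin> Cv"
      using on_Q[OF p(1) _ q(2) p(4) qN] on_Q[OF q(1) _ p(2) qN p(4)] y(2) sym[OF y(2)] q(3)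
      by (metis linorder_neqE_nat)
    moreover have "lo = 2"
    proof (rule ccontr)
      assume n: "lo \<noteq> 2"
      then have "2 \<notin> Cv" "lo = 3" using lo3 by auto
      then have "q = 2 \<or> p = 2" using c unc1[of 2 p] unc1[of 2 q] p q L2 by auto
      then show False using c p n lo(1) \<open>lo = 3\<close> by auto
    qed
    ultimately show ?thesis using q by blast
  qed
  have K_closed: "K y \<and> ?L = 2 * t" if "K x" "x \<in> V - A" "y \<in> V - A" "E x y" for x y
  proof -
    obtain p where p: "1 \<le> p" "p \<le> ?L" "lo = 2 \<or> lo \<le> p" "x = Q ! (p - 1)"
      using \<open>K x\<close> unfolding K_def by blast
    then have "p \<notin> ?N" using A_pos[of p] that by auto
    note nb = K_nb[OF p(1-3) this that(3)]
    have "E (Q ! (p - 1)) y" using that p by simp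
    from nb[OF this] obtain q where "1 \<le> q" "q \<le> ?L" "y = Q ! (q - 1)" "lo = 2"
      "Suc p = q \<and> q \<notin> Cv \<or> Suc q = p \<and> p \<notin> Cv" by blast
    then show ?thesis unfolding K_def using unc0[of p] unc0[of q] p by blast
  qed
  have K_unique: "y = y'" if Kx: "K x" and xy: "x \<in> V - A" "y \<in> V - A" "E x y" "y' \<in> V - A" "E x y'" for x y y'
  proof -
    obtain p where p: "1 \<le> p" "p \<le> ?L" "lo = 2 \<or> lo \<le> p" "x = Q ! (p - 1)"
      using Kx unfolding K_def by blast
    then have pN: "p \<notin> ?N" using A_pos[of p] xy(1) by auto
    obtain q where q: "q \<le> ?L" "y = Q ! (q - 1)"
      "Suc p = q \<and> q \<notin> Cv \<or> Suc q = p \<and> p \<notin> Cv"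
      using K_nb[OF p(1-3) pN xy(2)] xy(3,5) p(4) by blast
    obtain q' where q': "q' \<le> ?L" "y' = Q ! (q' - 1)"
      "Suc p = q' \<and> q' \<notin> Cv \<or> Suc q' = p \<and> p \<notin> Cv"
      using K_nb[OF p(1-3) pN xy(4)] xy(3,5) p(4) by blast
    have "q = q'" using q(3) q'(3) unc1[of p q] unc1[of p q'] p q(1) q'(1) by (metis Suc_inject n_not_Suc_n)
    then show ?thesis using q q' by simp
  qed
  \<comment> \<open>Such a path avoids \<open>w\<close> and \<open>K\<close>, hence the cycle, and
    \<open>cycle_tail\<close> allows it at most \<open>lo - 1\<close> vertices. This is 1, or 2 if
    position 2 is uncovered, which requires \<open>length Q = 2 * t\<close>.\<close>
  have no_tail: False if a: "a \<in> A" and zs: "path (a # zs)" "set zs \<subseteq> V - A"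
    and d: "length zs = (if ?L = 2 * t then 3 else 2)" for a zs
  proof -
    have pz: "path zs" using zs unfolding path_Cons by auto
    obtain z1 z2 r where z: "zs = z1 # z2 # r" "?L = 2 * t \<longrightarrow> (\<exists>z3. r = [z3])" "r = [] \<or> ?L = 2 * t"
      using d by (auto simp: length_Suc_conv numeral_2_eq_2 numeral_3_eq_3 split: if_splits)
    have e12: "E z1 z2" "z1 \<in> V - A" "z2 \<in> V - A" using pz zs z by (auto simp: path_Cons)
    have e21: "E z2 z1" using sym[OF e12(1)] .
    have nK2: "\<not> K z2"
    proof
      assume "K z2"
      then have "?L = 2 * t" using K_closed e12 e21 by blast
      then obtain z3 where "r = [z3]" using z by blast
      then have "E z2 z3" "z3 \<in> V - A" "z1 \<noteq> z3" using pz zs z by (auto simp: path_Cons)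
      then show False using K_unique \<open>K z2\<close> e12 e21 by blast
    qed
    have nK: "\<not> K x" if xz: "x \<in> set zs" for x
    proof
      assume "K x"
      then have "x \<noteq> z1" "x \<noteq> z2" using nK2 K_closed e12 e21 by blast+
      then obtain z3 where z3: "r = [z3]" "x = z3" using z xz by auto
      then have "E z2 z3" "z3 \<in> V - A" using pz zs z by (auto simp: path_Cons)
      then have "E z3 z2" "z3 \<in> V - A" using sym by blast+
      then show False using K_closed \<open>K x\<close> nK2 e12 z3 by blast
    qed
    have wz: "w \<notin> set zs"
    proof
      assume "w \<in> set zs"
      then have "w = z1 \<or> w = z2 \<or> (\<exists>z3. r = [z3] \<and> w = z3)" using z by auto
      then show False
      proof (elim disjE exE conjE)
        fix z3 assume "r = [z3]" "w = z3"
        then have "E z2 w" using pz z by (auto simp: path_Cons)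
        then have "E w z2" using sym by blast
        then show False using w_iso e12 by blast
      qed (use w_iso e12 e21 in blast)+
    qed
    have avoid: "set zs \<inter> set (drop (lo - 1) (take (?L - 1) Q)) = {}"
    proof -
      have "K x" if xd: "x \<in> set (drop (lo - 1) (take (?L - 1) Q))" for x
      proof -
        obtain i where i: "i < length (drop (lo - 1) (take (?L - 1) Q))"
          "x = drop (lo - 1) (take (?L - 1) Q) ! i" using xd by (metis in_set_conv_nth)
        then show ?thesis unfolding K_def using lo2 L2 by (intro exI[of _ "lo + i"]) auto
      qed
      then show ?thesis using nK by blast
    qed
    obtain p where "p \<in> ?N" "a = Q ! (p - 1)" using a A_pos Q_pos unfolding A_def by blast
    then have "length zs < lo" using cycle_tail[OF Q w l lo, of p zs] zs wz avoid by auto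
    then show False using d lo3 unc0[of 2] L2 by (auto split: if_splits)
  qed
  have A_ne: "A \<noteq> {}" using A_pos[of lo] lo pos_le[OF lo(1)] by blast
  show indep: "\<forall>x\<in>V - A. \<forall>y\<in>V - A. \<not> E x y" if "?L < 2 * t"
  proof (intro ballI notI)
    fix x y assume xy: "x \<in> V - A" "y \<in> V - A" "E x y"
    have "\<exists>ys. path (u # ys) \<and> length ys = 1 \<and> set ys \<subseteq> {x, y}" if "u \<in> {x, y}" for u
      using that xy sym[OF xy(3)] irr by (intro exI[of _ "[if u = x then y else x]"]) (auto simp: path_Cons)
    from entry_path_connected[OF AV A_ne _ _ this] obtain a zs where "a \<in> A" "path (a # zs)"
      "length zs = Suc 1" "set zs \<subseteq> V - A" using xy by auto
    then show False using no_tail[of a zs] that by simp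
  qed
  show "star_cond (V - A)"
  proof (cases "?L = 2 * t")
    case True
    show ?thesis
    proof (rule ccontr)
      assume "\<not> ?thesis"
      then obtain X where X: "X \<subseteq> V - A" "X \<noteq> {}"
        "\<And>u. u \<in> X \<Longrightarrow> \<exists>ys. path (u # ys) \<and> length ys = 2 \<and> set ys \<subseteq> X"
        using bad_edge_extension[of "V - A"] by (metis Diff_subset)
      obtain a zs where "a \<in> A" "path (a # zs)" "length zs = Suc 2" "set zs \<subseteq> V - A"
        using entry_path_connected[OF AV A_ne X] by blast
      then show False using no_tail[of a zs] True by simp
    qed
  next
    case False
    then show ?thesis using indep L unfolding star_cond_def by auto
  qed
qed

text \<open>Reversing \<open>Q\<close> if necessary, \<open>w\<close> is adjacent to its penultimate
  vertex. Otherwise the neighbour positions and their successors, at least \<open>2 * t - 2\<close>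
  places, would all lie between 3 and \<open>length Q - 1\<close>, where there are at most
  \<open>2 * t - 3\<close>.\<close>

lemma rich_vertex:
  assumes Q: "longest Q" and w: "w \<in> V - set Q" and rich: "t - 1 \<le> card (pos Q w)"
  obtains A where "A \<subseteq> V" "card A \<le> t - 1" "star_cond (V - A)"
    "length Q < 2 * t \<Longrightarrow> \<forall>x\<in>V - A. \<forall>y\<in>V - A. \<not> E x y"
proof -
  let ?L = "length Q" and ?N = "pos Q w"
  have AV: "set Q \<inter> {y. E w y} \<subseteq> V" using path_subset[OF longest_path[OF Q]] by auto
  show ?thesis
  proof (cases "?L - 1 \<in> ?N")
    case True
    show ?thesis using that[OF AV rich_vertex_of_penultimate(1,3,2)[OF Q w rich True]] by blast
  next
    case False
    have L: "?L \<le> 2 * t" using short[OF longest_path[OF Q]] eps t by linarith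
    have "2 \<in> ?N"
    proof (rule ccontr)
      assume n2: "2 \<notin> ?N"
      define U where "U = insert 1 ?N"
      have gap: "Suc p < q" if "p \<in> ?N" "q \<in> ?N" "p < q" for p q
        using pos_single_gap[OF Q w, of p q] that by auto
      have g0: "1 < p \<and> p < ?L" if "p \<in> ?N" for p
        using pos_single_gap[OF Q w, of 0 p] pos_single_gap[OF Q w, of p "Suc ?L"] that pos_le[OF that] by auto
      have g: "3 \<le> p \<and> p \<le> ?L - 2" if p: "p \<in> ?N" for p
      proof -
        have "p \<noteq> 2" "p \<noteq> ?L - 1" using p n2 False by auto
        then show ?thesis using g0[OF p] by linarith
      qed
      have disj: "?N \<inter> Suc ` ?N = {}"
      proof -
        have "q \<noteq> Suc p" if "p \<in> ?N" "q \<in> ?N" for p q using gap[of p q] that by auto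
        then show ?thesis by blast
      qed
      have "card (?N \<union> Suc ` ?N) = 2 * card ?N"
        using card_Un_disjoint[OF _ _ disj] finite_pos by (simp add: card_image)
      moreover have "?N \<union> Suc ` ?N \<subseteq> {3..?L - 1}"
      proof
        fix x assume "x \<in> ?N \<union> Suc ` ?N"
        then obtain p where "p \<in> ?N" "x = p \<or> x = Suc p" by blast
        then show "x \<in> {3..?L - 1}" using g[of p] by auto
      qed
      then have "card (?N \<union> Suc ` ?N) \<le> card {3..?L - 1}" by (rule card_mono[rotated]) simp
      then have "card (?N \<union> Suc ` ?N) \<le> ?L - 3" by simp
      ultimately show False using rich L t by linarith
    qed
    moreover have "2 \<le> ?L" using pos_le[OF \<open>2 \<in> ?N\<close>] by simp
    ultimately have l: "length (rev Q) - 1 \<in> pos (rev Q) w" unfolding pos_rev by force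
    have r': "t - 1 \<le> card (pos (rev Q) w)"
      using rich card_pos[OF longest_path[OF Q], of w]
        card_pos[OF longest_path[OF longest_rev[OF Q]], of w] by simp
    have w': "w \<in> V - set (rev Q)" using w by simp
    note r = rich_vertex_of_penultimate[OF longest_rev[OF Q] w' r' l, unfolded set_rev length_rev]
    show ?thesis by (rule that[OF AV r(1,3,2)])
  qed
qed

end

section \<open>Gap counting\<close>

text \<open>\<open>n\<close> is a sentinel that closes the last gap.\<close>

definition nxt :: "nat set \<Rightarrow> nat \<Rightarrow> nat \<Rightarrow> nat" where
  "nxt U n p = (LEAST q. p < q \<and> q \<in> insert n U)"

lemma nxt:
  assumes "p < n" "U \<subseteq> {..<n}"
  shows "p < nxt U n p" "nxt U n p \<in> insert n U" "nxt U n p \<le> n"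
    and "\<And>q. q \<in> U \<Longrightarrow> p < q \<Longrightarrow> nxt U n p \<le> q"
proof -
  have "p < n \<and> n \<in> insert n U" using assms by simp
  then have "p < nxt U n p \<and> nxt U n p \<in> insert n U" unfolding nxt_def by (rule LeastI)
  then show a: "p < nxt U n p" "nxt U n p \<in> insert n U" by auto
  then show "nxt U n p \<le> n" using assms(2) by auto
  show "\<And>q. q \<in> U \<Longrightarrow> p < q \<Longrightarrow> nxt U n p \<le> q"
    unfolding nxt_def by (rule Least_le) auto
qed

lemma nxt_disjoint:
  assumes "U \<subseteq> {..<n}" "p \<in> U" "q \<in> U" "p < q"
  shows "{p..<nxt U n p} \<inter> {q..<nxt U n q} = {}"
proof -
  have "p < n" using assms(1,2) by auto
  from nxt(4)[OF this assms(1,3,4)] show ?thesis by auto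
qed

text \<open>The intervals from each element of \<open>U\<close> to the next one partition
  \<open>{..<n}\<close>.\<close>

lemma sum_gaps:
  assumes U: "U \<subseteq> {..<n}" "0 \<in> U"
  shows "(\<Sum>p\<in>U. nxt U n p - p) = n"
proof -
  have fU: "finite U" using U finite_subset by blast
  have "(\<Union>p\<in>U. {p..<nxt U n p}) = {..<n}"
  proof (intro equalityI subsetI)
    fix i assume "i \<in> (\<Union>p\<in>U. {p..<nxt U n p})"
    then obtain p where p: "p \<in> U" "i < nxt U n p" by auto
    then have "p < n" using U by auto
    from nxt(3)[OF this U(1)] show "i \<in> {..<n}" using p by simp
  next
    fix i assume i: "i \<in> {..<n}"
    define p where "p = Max {q \<in> U. q \<le> i}"
    have "p \<in> {q \<in> U. q \<le> i}" unfolding p_def using fU U by (intro Max_in) auto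
    then have p: "p \<in> U" "p \<le> i" by auto
    have pn: "p < n" using p U by auto
    have "i < nxt U n p"
    proof (rule ccontr)
      assume c: "\<not> i < nxt U n p"
      then have "nxt U n p \<in> U" using nxt(2)[OF pn U(1)] i by auto
      then have "nxt U n p \<in> {q \<in> U. q \<le> i}" using c by simp
      then have "nxt U n p \<le> Max {q \<in> U. q \<le> i}" using fU by (intro Max_ge) auto
      then have "nxt U n p \<le> p" unfolding p_def .
      then show False using nxt(1)[OF pn U(1)] by simp
    qed
    then show "i \<in> (\<Union>p\<in>U. {p..<nxt U n p})" using p by auto
  qed
  moreover have "card (\<Union>p\<in>U. {p..<nxt U n p}) = (\<Sum>p\<in>U. card {p..<nxt U n p})"
  proof (rule card_UN_disjoint)
    show "\<forall>i\<in>U. \<forall>j\<in>U. i \<noteq> j \<longrightarrow> {i..<nxt U n i} \<inter> {j..<nxt U n j} = {}"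
      using nxt_disjoint[OF U(1)] by (metis Int_commute linorder_neqE_nat)
  qed (use fU in auto)
  ultimately show ?thesis by simp
qed

context ugraph begin

text \<open>Gap counting for a path \<open>xs\<close> outside a longest path \<open>Q\<close>. Between a neighbour of one end and a
  neighbour of the other end there is room for all of \<open>xs\<close>. Here \<open>M\<close> counts such mixed gaps, and
  \<open>a\<close>, \<open>b\<close> count the non-mixed and the mixed gaps of minimal length. The interior of a
  gap of minimal length can be exchanged for vertices outside \<open>Q\<close>.\<close>

lemma gap_count:
  assumes Q: "longest Q" and xs: "path xs" "xs \<noteq> []" "set xs \<inter> set Q = {}"
  defines "N1 \<equiv> pos Q (hd xs)" and "N2 \<equiv> pos Q (last xs)"
  defines "U \<equiv> insert 0 (N1 \<union> N2)"
  shows "\<exists>M a b. a + M \<le> card U \<and> b \<le> M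
    \<and> 3 * card U + (length xs - 1) * M \<le> Suc (length Q) + a + b
    \<and> (N1 = N2 \<longrightarrow> M = card U) \<and> (2 \<le> card U \<longrightarrow> 2 \<le> M)
    \<and> (N1 \<noteq> N2 \<longrightarrow> N1 \<noteq> {} \<longrightarrow> N2 \<noteq> {} \<longrightarrow> 3 \<le> M)
    \<and> (\<forall>D. (\<forall>Q'. longest Q' \<longrightarrow> D \<subseteq> set Q') \<longrightarrow> card D + a + length xs * b \<le> length Q)"
proof -
  let ?L = "length Q" and ?m = "length xs"
  define n where "n = Suc ?L"
  define nx where "nx = nxt U n"
  have pQ: "path Q" by (rule longest_path[OF Q])
  have ne: "xs \<noteq> []" and ne1: "1 \<le> length xs" using xs by (auto simp: Suc_le_eq)
  have N: "N1 \<subseteq> {1..?L}" "N2 \<subseteq> {1..?L}" unfolding N1_def N2_def using pos_le by auto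
  have U: "U \<subseteq> {..<n}" "0 \<in> U" "finite U" using N finite_pos unfolding U_def n_def N1_def N2_def by fastforce+
  have Un: "p < n" if "p \<in> U" for p using that U by auto
  have nx: "p < nx p" "nx p \<in> insert n U" "nx p \<le> n" "\<And>q. q \<in> U \<Longrightarrow> p < q \<Longrightarrow> nx p \<le> q"
    if "p \<in> U" for p using nxt[OF Un[OF that] U(1)] unfolding nx_def by auto
  have nxpos: "nx p \<in> insert n (N1 \<union> N2)" if "p \<in> U" for p
    using nx(1,2)[OF that] unfolding U_def by auto
  have sum: "(\<Sum>p\<in>U. nx p - p) = n" using sum_gaps[OF U(1,2)] unfolding nx_def .
  \<comment> \<open>The virtual positions belong to both ends of \<open>xs\<close>, so the first and
    the last gap are always mixed.\<close>
  define mixed where "mixed = (\<lambda>p. p \<in> insert 0 N1 \<and> nx p \<in> insert n N2 \<or> p \<in> insert 0 N2 \<and> nx p \<in> insert n N1)"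
  have unmixed: "p \<in> N1 \<and> nx p \<in> N1 \<or> p \<in> N2 \<and> nx p \<in> N2" if "p \<in> U" "\<not> mixed p" for p
    using that nxpos[OF that(1)] unfolding mixed_def U_def by blast
  have rxs: "rev xs \<noteq> []" "path (rev xs)" "set (rev xs) \<inter> set Q = {}" "hd (rev xs) = last xs" "last (rev xs) = hd xs"
    using ne xs by (auto simp: hd_rev last_rev)
  have sgl: "path [hd xs]" "path [last xs]" "set [hd xs] \<inter> set Q = {}" "set [last xs] \<inter> set Q = {}"
    using path_subset[OF xs(1)] hd_in_set[OF ne] last_in_set[OF ne] xs(3) by auto
  have swap: "\<exists>ys. ys \<noteq> [] \<and> set ys \<inter> set Q = {} \<and> length ys = (if mixed p then ?m else 1)
      \<and> path (take p Q @ ys @ drop (nx p - 1) Q)" if p: "p \<in> U" for p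
  proof (cases "mixed p")
    case True
    then consider "p \<in> insert 0 N1" "nx p \<in> insert n N2" | "p \<in> insert 0 N2" "nx p \<in> insert n N1"
      unfolding mixed_def by blast
    then show ?thesis
    proof cases
      case 1
      then show ?thesis using splice_path[OF pQ ne xs(1,3), of p "nx p"] nx(1)[OF p] True ne xs(3)
        unfolding N1_def N2_def n_def by (intro exI[of _ xs]) auto
    next
      case 2
      then show ?thesis using splice_path[OF pQ rxs(1-3), of p "nx p"] nx(1)[OF p] True ne xs(3) rxs(4,5)
        unfolding N1_def N2_def n_def by (intro exI[of _ "rev xs"]) auto
    qed
  next
    case False
    from unmixed[OF p False] show ?thesis
    proof
      assume "p \<in> N1 \<and> nx p \<in> N1"
      then show ?thesis using splice_path[OF pQ _ sgl(1,3), of p "nx p"] nx(1)[OF p] False sgl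
        unfolding N1_def by (intro exI[of _ "[hd xs]"]) auto
    next
      assume "p \<in> N2 \<and> nx p \<in> N2"
      then show ?thesis using splice_path[OF pQ _ sgl(2,4), of p "nx p"] nx(1)[OF p] False sgl
        unfolding N2_def by (intro exI[of _ "[last xs]"]) auto
    qed
  qed
  define wd where "wd = (\<lambda>p. if mixed p then ?m else 1)"
  have len: "length (take p Q @ ys @ drop (nx p - 1) Q) = p + length ys + (n - nx p)" if "p \<in> U" for p ys
    using Un[OF that] nx(1,3)[OF that] unfolding n_def by auto
  have gap: "p + wd p < nx p" if p: "p \<in> U" for p
  proof -
    obtain ys where ys: "length ys = wd p" "path (take p Q @ ys @ drop (nx p - 1) Q)"
      using swap[OF p] unfolding wd_def by blast
    from longest_le[OF Q ys(2)] have "p + wd p + (n - nx p) \<le> ?L" using len[OF p] ys by simp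
    then show ?thesis using nx(1,3)[OF p] unfolding n_def by linarith
  qed
  \<comment> \<open>A tight gap has just as many interior places as there are vertices to be put in,
    so the exchange yields another longest path.\<close>
  define tight where "tight = (\<lambda>p. nx p = p + wd p + 1)"
  define Mx where "Mx = {p \<in> U. mixed p}"
  define Ta where "Ta = {p \<in> U. \<not> mixed p \<and> tight p}"
  define Tb where "Tb = {p \<in> U. mixed p \<and> tight p}"
  have fin': "finite Mx" "finite Ta" "finite Tb" using U unfolding Mx_def Ta_def Tb_def by auto
  have sub: "Mx \<subseteq> U" "Ta \<subseteq> U - Mx" "Tb \<subseteq> Mx" unfolding Mx_def Ta_def Tb_def by auto
  have c1: "card Ta + card Mx \<le> card U"
  proof -
    have "card (Ta \<union> Mx) = card Ta + card Mx" using fin' sub by (intro card_Un_disjoint) auto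
    moreover have "card (Ta \<union> Mx) \<le> card U" using sub U by (intro card_mono) auto
    ultimately show ?thesis by simp
  qed
  have c2: "card Tb \<le> card Mx" using fin' sub card_mono by blast
  have c3: "3 * card U + (?m - 1) * card Mx \<le> n + card Ta + card Tb"
  proof -
    \<comment> \<open>A gap advances by at least 2, or by at least \<open>length xs + 1\<close> if
      it is mixed. Tight gaps attain this, and all others exceed it by at least 1.\<close>
    have g: "3 + (?m - 1) * of_bool (p \<in> Mx) \<le> (nx p - p) + of_bool (p \<in> Ta) + of_bool (p \<in> Tb)" if p: "p \<in> U" for p
      using gap[OF p] p ne1 unfolding Mx_def Ta_def Tb_def tight_def wd_def by (auto split: if_splits)
    have "(\<Sum>p\<in>U. 3 + (?m - 1) * of_bool (p \<in> Mx)) \<le> (\<Sum>p\<in>U. (nx p - p) + of_bool (p \<in> Ta) + of_bool (p \<in> Tb))"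
      by (rule sum_mono) (rule g)
    moreover have ob: "(\<Sum>p\<in>U. of_bool (p \<in> S)) = card S" if "S \<subseteq> U" for S
      using that U by (simp add: Int_absorb1)
    have "(\<Sum>p\<in>U. 3 + (?m - 1) * of_bool (p \<in> Mx)) = 3 * card U + (?m - 1) * card Mx"
      using ob[of Mx] sub by (simp add: sum.distrib sum_distrib_left[symmetric] del: sum_of_bool_eq)
    moreover have "(\<Sum>p\<in>U. (nx p - p) + of_bool (p \<in> Ta) + of_bool (p \<in> Tb)) = n + card Ta + card Tb"
      using ob[of Ta] ob[of Tb] sub sum by (simp add: sum.distrib del: sum_of_bool_eq) auto
    ultimately show ?thesis by simp
  qed
  have c4: "card Mx = card U" if "N1 = N2"
  proof -
    have "mixed p" if "p \<in> U" for p
      using nxpos[OF that] that \<open>N1 = N2\<close> unfolding mixed_def U_def by auto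
    then have "Mx = U" unfolding Mx_def by auto
    then show ?thesis by simp
  qed
  have zM: "0 \<in> Mx" using nxpos[OF U(2)] U(2) unfolding Mx_def mixed_def by auto
  define mu where "mu = Max U"
  have mu: "mu \<in> U" "\<And>p. p \<in> U \<Longrightarrow> p \<le> mu" unfolding mu_def using U by (auto intro: Max_in)
  have "nx mu = n"
  proof (rule ccontr)
    assume "nx mu \<noteq> n"
    then have "nx mu \<in> U" using nx(2)[OF mu(1)] by auto
    then show False using mu(2) nx(1)[OF mu(1)] by fastforce
  qed
  then have muM: "mu \<in> Mx" using mu(1) unfolding Mx_def mixed_def U_def by auto
  have c5: "2 \<le> card Mx" if "2 \<le> card U"
  proof -
    have "mu \<noteq> 0"
    proof
      assume "mu = 0"
      then have "U \<subseteq> {0}" using mu(2) by auto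
      then have "card U \<le> card {0 :: nat}" by (intro card_mono) auto
      then show False using that by simp
    qed
    then have "card {0, mu} = 2" by simp
    then show ?thesis using card_mono[OF fin'(1), of "{0, mu}"] zM muM by simp
  qed
  \<comment> \<open>The last element of \<open>A\<close> before \<open>q\<close> is followed by one
    of \<open>B\<close>. This gap is mixed and is neither the first nor the last one.\<close>
  have between: "3 \<le> card Mx" if "p \<in> A" "q \<in> B" "p < q" "A = N1 \<and> B = N2 \<or> A = N2 \<and> B = N1" for p q A B
  proof -
    have fA: "finite A" "A \<subseteq> U" "B \<subseteq> U" "0 \<notin> A" using that(4) N U(3) finite_pos unfolding N1_def N2_def U_def by fastforce+
    define x where "x = Max {z \<in> A. z < q}"
    have "x \<in> {z \<in> A. z < q}" unfolding x_def using fA that by (intro Max_in) auto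
    then have x: "x \<in> A" "x < q" by auto
    have xU: "x \<in> U" "q \<in> U" using x fA that by auto
    have le: "nx x \<le> q" using nx(4)[OF xU(1,2)] x by simp
    have "nx x \<in> B"
    proof (cases "nx x = q")
      case False
      then have l: "nx x < q" using le by simp
      then have "nx x \<noteq> n" using Un[OF xU(2)] by simp
      then have m: "nx x \<in> N1 \<union> N2" using nxpos[OF xU(1)] by auto
      have "nx x \<notin> A"
      proof
        assume "nx x \<in> A"
        then have "nx x \<in> {z \<in> A. z < q}" using l by simp
        then have "nx x \<le> Max {z \<in> A. z < q}" using fA by (intro Max_ge) auto
        then have "nx x \<le> x" unfolding x_def .
        then show False using nx(1)[OF xU(1)] by simp
      qed
      then show ?thesis using m that(4) by auto
    qed (use that in simp)
    then have "x \<in> Mx" using x xU that(4) unfolding Mx_def mixed_def by auto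
    moreover have "x \<noteq> 0" using x fA by metis
    moreover have "q \<le> mu" by (rule mu(2)[OF xU(2)])
    ultimately have "{0, x, mu} \<subseteq> Mx" "card {0, x, mu} = 3" using zM muM x(2) by simp_all
    then show ?thesis using card_mono[OF fin'(1), of "{0, x, mu}"] by linarith
  qed
  have c6: "3 \<le> card Mx" if "N1 \<noteq> N2" "N1 \<noteq> {}" "N2 \<noteq> {}"
  proof -
    have "\<exists>p\<in>N1. \<exists>q\<in>N2. p \<noteq> q"
    proof (rule ccontr)
      assume "\<not> ?thesis"
      then have "\<forall>p\<in>N1. \<forall>q\<in>N2. p = q" by simp
      then show False using that by (metis equals0I subsetI subset_antisym)
    qed
    then obtain p q where pq: "p \<in> N1" "q \<in> N2" "p \<noteq> q" by blast
    show ?thesis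
    proof (cases "p < q")
      case True
      then show ?thesis using between[OF pq(1,2)] by blast
    next
      case False
      then show ?thesis using between[OF pq(2,1)] pq(3) by auto
    qed
  qed
  \<comment> \<open>The interior of each tight gap is missed by some longest path and hence by
    \<open>D\<close>; these interiors are disjoint.\<close>
  have c7: "card D + card Ta + ?m * card Tb \<le> ?L" if D: "\<And>Q'. longest Q' \<Longrightarrow> D \<subseteq> set Q'" for D
  proof -
    define T where "T = Ta \<union> Tb"
    have TU: "T \<subseteq> U" "finite T" using sub fin' unfolding T_def by auto
    define J where "J = (\<Union>p\<in>T. {p<..<nx p})"
    have cJ: "card J = (\<Sum>p\<in>T. card {p<..<nx p})" unfolding J_def
    proof (rule card_UN_disjoint)
      show "\<forall>i\<in>T. \<forall>j\<in>T. i \<noteq> j \<longrightarrow> {i<..<nx i} \<inter> {j<..<nx j} = {}"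
      proof (intro ballI impI)
        fix i j assume ij: "i \<in> T" "j \<in> T" "i \<noteq> j"
        then have "{i..<nx i} \<inter> {j..<nx j} = {}"
          using nxt_disjoint[OF U(1), of i j] nxt_disjoint[OF U(1), of j i] TU unfolding nx_def
          by (metis Int_commute linorder_neqE_nat subsetD)
        then show "{i<..<nx i} \<inter> {j<..<nx j} = {}" by fastforce
      qed
    qed (use TU in auto)
    have "(\<Sum>p\<in>T. card {p<..<nx p}) = (\<Sum>p\<in>Ta. card {p<..<nx p}) + (\<Sum>p\<in>Tb. card {p<..<nx p})"
      unfolding T_def using fin' by (intro sum.union_disjoint) (auto simp: Ta_def Tb_def)
    also have "(\<Sum>p\<in>Ta. card {p<..<nx p}) = (\<Sum>p\<in>Ta. 1)"
      by (rule sum.cong) (auto simp: Ta_def tight_def wd_def)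
    also have "(\<Sum>p\<in>Tb. card {p<..<nx p}) = (\<Sum>p\<in>Tb. ?m)"
      by (rule sum.cong) (auto simp: Tb_def tight_def wd_def)
    finally have cJ2: "card J = card Ta + ?m * card Tb" using cJ by simp
    have JL: "J \<subseteq> {1..?L}" unfolding J_def using TU nx(3) unfolding n_def by fastforce
    have noD: "Q ! (i - 1) \<notin> D" if i: "i \<in> J" for i
    proof -
      obtain p where p: "p \<in> T" "p < i" "i < nx p" using i unfolding J_def by auto
      have pU: "p \<in> U" using p TU by auto
      have ti: "nx p = p + wd p + 1" using p unfolding T_def Ta_def Tb_def tight_def by auto
      obtain ys where ys: "set ys \<inter> set Q = {}" "length ys = wd p" "path (take p Q @ ys @ drop (nx p - 1) Q)"
        using swap[OF pU] unfolding wd_def by blast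
      have "length (take p Q @ ys @ drop (nx p - 1) Q) = ?L"
        using len[OF pU, of ys] ys ti nx(3)[OF pU] unfolding n_def by linarith
      then have DQ: "D \<subseteq> set (take p Q @ ys @ drop (nx p - 1) Q)" using D longest_eq[OF Q ys(3)] by blast
      have iL: "i - 1 < ?L" "p \<le> i - 1" "i - 1 < nx p - 1" using p nx(3)[OF pU] unfolding n_def by auto
      have "Q ! (i - 1) \<notin> set (take p Q)"
      proof
        assume "Q ! (i - 1) \<in> set (take p Q)"
        then obtain j where "j < p" "j < ?L" "Q ! (i - 1) = Q ! j" by (auto simp: in_set_conv_nth)
        then show False using nth_eq_iff_index_eq[OF path_distinct[OF pQ] iL(1), of j] iL by simp
      qed
      moreover have "Q ! (i - 1) \<notin> set (drop (nx p - 1) Q)"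
      proof
        assume "Q ! (i - 1) \<in> set (drop (nx p - 1) Q)"
        then obtain j where "j < ?L - (nx p - 1)" "Q ! (i - 1) = Q ! (nx p - 1 + j)" by (auto simp: in_set_conv_nth)
        then show False using nth_eq_iff_index_eq[OF path_distinct[OF pQ] iL(1), of "nx p - 1 + j"] iL by simp
      qed
      moreover have "Q ! (i - 1) \<in> set Q" using iL by simp
      ultimately show ?thesis using DQ ys(1) by auto
    qed
    have "D \<subseteq> (\<lambda>i. Q ! (i - 1)) ` ({1..?L} - J)"
    proof
      fix x assume x: "x \<in> D"
      then have "x \<in> set Q" using D[OF Q] by auto
      then obtain i where "i < ?L" "x = Q ! i" by (auto simp: in_set_conv_nth)
      then show "x \<in> (\<lambda>i. Q ! (i - 1)) ` ({1..?L} - J)" using noD[of "Suc i"] x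
        by (intro image_eqI[of _ _ "Suc i"]) auto
    qed
    then have "card D \<le> card ((\<lambda>i. Q ! (i - 1)) ` ({1..?L} - J))" by (rule card_mono[rotated]) auto
    also have "\<dots> \<le> card ({1..?L} - J)" by (rule card_image_le) auto
    also have "\<dots> = ?L - card J" using JL by (subst card_Diff_subset) (auto intro: finite_subset)
    finally show ?thesis using cJ2 card_mono[OF _ JL] by simp
  qed
  have c3': "3 * card U + (?m - 1) * card Mx \<le> Suc ?L + card Ta + card Tb" using c3 unfolding n_def .
  show ?thesis
    by (rule exI[of _ "card Mx"], rule exI[of _ "card Ta"], rule exI[of _ "card Tb"])
      (use c1 c2 c3' c4 c5 c6 c7 in blast)
qed

end

section \<open>Arithmetic of the gap count\<close>

lemma equal_ends_arith:
  fixes t m u n :: nat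
  assumes "2 \<le> m" "2 \<le> u" "(m + 1) * u \<le> n" "n \<le> 2 * t + 1" "t + 1 \<le> u + m"
  shows "u = 2 \<and> m + 1 = t \<or> u = 3 \<and> m = 2 \<and> t = 4 \<and> n = 9"
proof -
  obtain m' where m': "m = m' + 2" using assms(1) by (metis add.commute le_Suc_ex)
  obtain u' where u': "u = u' + 2" using assms(2) by (metis add.commute le_Suc_ex)
  \<comment> \<open>Besides \<open>u = 2\<close> only one sporadic solution survives: a pair
    attached at two vertices of a path on 8 vertices, the exceptional configuration treated
    later.\<close>
  have "(m' + 1) * u' \<le> 1" using assms unfolding m' u' by (simp add: algebra_simps)
  then have "u' = 0 \<or> (u' = 1 \<and> m' = 0)"
    by (cases u'; cases m') auto
  then show ?thesis using assms unfolding m' u' by auto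
qed

text \<open>The degrees are one smaller here. The loss is made up by a core of \<open>s\<close>
  vertices that the tight gaps must leave alone: the assumptions on \<open>s\<close> give
  \<open>m * b + 4 \<le> t\<close>.\<close>

lemma equal_ends_tight_arith:
  fixes t m u b s L :: nat
  assumes "2 \<le> m" "2 \<le> u" "(m + 2) * u \<le> L + 1 + b" "L \<le> 2 * t" "t \<le> u + m"
    "s + m * b \<le> L" "2 * L + 5 \<le> s + 3 * t" "t + 3 \<le> s"
  shows "u = 2 \<and> m + 2 = t"
proof -
  obtain m' where m': "m = m' + 2" using assms(1) by (metis add.commute le_Suc_ex)
  obtain u' where u': "u = u' + 2" using assms(2) by (metis add.commute le_Suc_ex)
  have bt: "m * b + 4 \<le> t"
  proof -
    have "s + m * b + s + m * b \<le> 2 * L" using assms(6) by simp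
    then show ?thesis using assms by linarith
  qed
  show ?thesis
  proof (cases u')
    case 0
    have "b = 0"
    proof (rule ccontr)
      assume "b \<noteq> 0"
      then have "m \<le> m * b" by simp
      then show False using bt assms(5) 0 u' by linarith
    qed
    then show ?thesis using assms unfolding u' 0 by auto
  next
    case (Suc x)
    have "m * (x + 1) \<le> b + 1" using assms(3-5) unfolding u' Suc by (simp add: algebra_simps)
    then have "m * (m * (x + 1)) \<le> m * (b + 1)" by (rule mult_le_mono2)
    also have "\<dots> \<le> t - 4 + m" using bt by simp
    finally have "m * (m * (x + 1)) + 1 \<le> x + 2 * m" using assms(5) bt unfolding u' Suc by linarith
    then have "(m' + 2) * ((m' + 2) * (x + 1)) + 1 \<le> x + 2 * (m' + 2)" unfolding m' .
    then have False by (simp add: algebra_simps)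
    then show ?thesis ..
  qed
qed

text \<open>Two mixed gaps are too many if \<open>t \<le> m + 1\<close>. With three or more, only
  \<open>m = 2\<close>, \<open>M = 3\<close>, \<open>b = 3\<close> remains, where the tight gaps
  leave no room for the core.\<close>

lemma unequal_ends_tight_arith:
  fixes t m u b a s L M :: nat
  assumes "2 \<le> m" "2 \<le> u" "3 * u + (m - 1) * M \<le> L + 1 + a + b" "a + M \<le> u" "b \<le> M" "L \<le> 2 * t"
    "t + 1 \<le> u + m" "s + a + m * b \<le> L" "2 * L + 5 \<le> s + 3 * t" "t + 3 \<le> s" "2 \<le> M"
    "t \<le> m + 1 \<or> 3 \<le> M"
  shows False
proof -
  have mM: "(m - 1) * M + M = m * M" using assms(1) by (cases m) auto
  have 1: "2 * u + m * M \<le> L + 1 + b" using assms(3,4) mM by linarith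
  have bt: "m * b + 4 \<le> t" using assms(6,8,9,10) by linarith
  show False
  proof (cases "3 \<le> M")
    case False
    then have M: "M = 2" "t \<le> m + 1" using assms(11,12) by auto
    have "b = 0"
    proof (rule ccontr)
      assume "b \<noteq> 0"
      then have "m \<le> m * b" by simp
      then show False using bt M by linarith
    qed
    then show False using 1[unfolded M(1)] M(2) assms(2,6) by linarith
  next
    case True
    obtain m' where m': "m = m' + 2" using assms(1) by (metis add.commute le_Suc_ex)
    obtain M' where M': "M = M' + 3" using True by (metis add.commute le_Suc_ex)
    have "(m' + 1) * (M' + 1) \<le> 1" using 1 assms(5,6,7) unfolding m' M' by (simp add: algebra_simps)
    then have z: "m' = 0" "M' = 0" by auto
    then have "b = 3" using 1 assms(5,6,7) unfolding m' M' by simp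
    then show False using z assms unfolding m' M' by simp
  qed
qed

section \<open>Paths hanging on a longest path\<close>

context ugraph begin

text \<open>Otherwise \<open>ys\<close> could replace the part of \<open>Q\<close> on one side of
  position \<open>c\<close>.\<close>

lemma arms:
  assumes "longest Q" "path ys" "ys \<noteq> []" "set ys \<inter> set Q = {}" "c \<in> pos Q (hd ys)"
  shows "length ys < c" "c + length ys \<le> length Q"
proof -
  show "length ys < c"
    using splice_gap[of Q "rev ys" 0 c] assms pos_le[of c] by (fastforce simp: last_rev)
  show "c + length ys \<le> length Q"
    using splice_gap[of Q ys c "Suc (length Q)"] assms pos_le[OF assms(5)] by auto
qed

definition joined :: "'a set \<Rightarrow> ('a \<times> 'a) set" where
  "joined U = ({(a, b). E a b \<and> a \<in> U \<and> b \<in> U})\<^sup>*"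

lemma joined_sym: "(a, b) \<in> joined U \<Longrightarrow> (b, a) \<in> joined U"
proof -
  assume a: "(a, b) \<in> joined U"
  have "Relation.sym {(a, b). E a b \<and> a \<in> U \<and> b \<in> U}" unfolding Relation.sym_def using sym by blast
  then have "Relation.sym (joined U)" unfolding joined_def by (rule sym_rtrancl)
  then show ?thesis using a by (meson symD)
qed

lemma joined_trans: "(a, b) \<in> joined U \<Longrightarrow> (b, c) \<in> joined U \<Longrightarrow> (a, c) \<in> joined U"
  unfolding joined_def by (rule rtrancl_trans)

lemma path_joined:
  assumes "path xs" "set xs \<subseteq> U" "a \<in> set xs" "b \<in> set xs"
  shows "(a, b) \<in> joined U"
proof -
  have "\<forall>a\<in>set xs. (hd xs, a) \<in> joined U" using assms(1,2)
  proof (induction xs)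
    case (Cons x xs)
    show ?case
    proof (cases "xs = []")
      case True
      then show ?thesis unfolding joined_def by simp
    next
      case False
      have "(x, hd xs) \<in> joined U" unfolding joined_def using Cons.prems False
        by (intro r_into_rtrancl) (auto simp: path_Cons)
      moreover have "\<forall>a\<in>set xs. (hd xs, a) \<in> joined U" using Cons by (simp add: path_Cons)
      ultimately have "\<forall>a\<in>set xs. (x, a) \<in> joined U" using joined_trans by blast
      then show ?thesis by (simp add: joined_def)
    qed
  qed simp
  then show ?thesis using assms joined_sym joined_trans by blast
qed

end

context connected_ugraph begin

text \<open>A link from \<open>Q\<close> to \<open>xs\<close> is continued by a lollipop inside
  \<open>xs\<close>, which keeps the hanging path long.\<close>

lemma attached_path:
  assumes Q: "path Q" "Q \<noteq> []" and xs: "path xs" "xs \<noteq> []" "set xs \<inter> set Q = {}"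
  obtains ys c where "path ys" "ys \<noteq> []" "set ys \<inter> set Q = {}" "deg (set xs) (hd xs) < length ys" "c \<in> pos Q (hd ys)"
proof -
  obtain a u zs where l: "a \<in> set Q" "u \<in> set xs" "path (a # zs @ [u])" "set zs \<inter> (set Q \<union> set xs) = {}"
    using ex_linking_path[of "set Q" "set xs"] Q xs path_subset by (metis inf_commute set_empty)
  obtain b where b: "path b" "b \<noteq> []" "last b = u" "set b \<subseteq> set xs" "deg (set xs) (hd xs) < length b"
    using lollipop[OF xs(1,2) l(2)] by blast
  have "path zs" "zs \<noteq> [] \<Longrightarrow> E (last zs) u" using l(3) unfolding path_Cons path_append by auto
  then have p: "path (zs @ rev b)" using b l(4) unfolding path_append by (auto simp: hd_rev)
  have "E a (hd (zs @ rev b))" using l(3) b unfolding path_Cons by (auto simp: hd_append hd_rev)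
  moreover obtain i where "i < length Q" "a = Q ! i" using l(1) by (auto simp: in_set_conv_nth)
  ultimately have "Suc i \<in> pos Q (hd (zs @ rev b))" unfolding pos_def using sym by auto
  then show ?thesis using that[of "zs @ rev b" "Suc i"] p b l(4) xs(3) by auto
qed

end

section \<open>Few neighbours on every longest path\<close>

locale poor_path_free_graph = dense_path_free_graph +
  assumes t3: "3 \<le> t" and poor: "longest Q \<Longrightarrow> w \<in> V - set Q \<Longrightarrow> card (pos Q w) \<le> t - 2"
begin

lemma longest_length: "longest Q \<Longrightarrow> length Q \<le> 2 * t - 1 + \<epsilon>"
  using short longest_path by blast

lemma deg_outside:
  assumes "longest Q" "S \<subseteq> V - set Q" "w \<in> S"
  shows "deg (set Q \<union> S) w = card (pos Q w) + deg S w"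
proof -
  have "(set Q \<union> S) \<inter> {y. E w y} = (set Q \<inter> {y. E w y}) \<union> (S \<inter> {y. E w y})" by auto
  moreover have "card ((set Q \<inter> {y. E w y}) \<union> (S \<inter> {y. E w y})) = card (set Q \<inter> {y. E w y}) + card (S \<inter> {y. E w y})"
    using assms fin by (intro card_Un_disjoint) (auto intro: finite_subset)
  ultimately show ?thesis using card_pos[OF longest_path[OF assms(1)]] unfolding deg_def by simp
qed

text \<open>The vertex \<open>cv\<close> at position 3 separates \<open>w1\<close> and
  \<open>w2\<close> from the rest of \<open>Q\<close>; \<open>e\<close> is the vertex after it. A
  bad part outside \<open>{cv, e}\<close> can be reached from \<open>e\<close>, which gives three
  vertices followed by \<open>e\<close>, \<open>cv\<close>, \<open>w1\<close>, \<open>w2\<close>, or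
  else from \<open>cv\<close> without touching the rear of \<open>Q\<close>, which gives three
  vertices followed by \<open>Q\<close> from position 3 on. Both paths are longer than
  \<open>Q\<close>.\<close>

lemma star_cond_of_pendant_path_t3:
  assumes t: "t = 3" and Q: "longest Q" and w: "path [w1, w2]" "{w1, w2} \<subseteq> V - set Q" and c: "3 \<in> pos Q w1"
  shows "\<exists>A\<subseteq>V. card A \<le> 2 \<and> star_cond (V - A)"
proof -
  let ?L = "length Q"
  have pQ: "path Q" by (rule longest_path[OF Q])
  have L: "5 \<le> ?L" "?L \<le> 6"
    using arms(2)[OF Q w(1), of 3] w(2) c longest_length[OF Q] t eps by auto
  define cv e where "cv = Q ! 2" and "e = Q ! 3"
  have cQ: "cv \<in> set Q" "e \<in> set Q" "cv \<noteq> e" unfolding cv_def e_def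
    using L path_distinct[OF pQ] by (auto simp: nth_eq_iff_index_eq)
  have Ew: "E cv w1" "E w1 w2" using pos_E[OF c] w(1) sym unfolding cv_def path_Cons by auto
  have Ece: "E cv e" using path_nth[OF pQ, of 2] L unfolding cv_def e_def by (simp add: eval_nat_numeral)
  have QV: "set Q \<subseteq> V" by (rule path_subset[OF pQ])
  define U where "U = V - {cv}"
  \<comment> \<open>As \<open>w1\<close> has only one neighbour on \<open>Q\<close>, a connection
    avoiding \<open>cv\<close> has at least two vertices off \<open>Q\<close>. There is no room for
    these, neither before position 3 nor among the at most three places behind it.\<close>
  have sep: "(q, w') \<notin> joined U" if q: "q \<in> set Q - {cv}" and w': "w' \<in> {w1, w2}" for q w'
  proof
    assume "(q, w') \<in> joined U"
    from obtain_link[OF this[unfolded joined_def], of "set Q - {cv}" "{w1, w2}"] q w' w(2)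
    obtain q' w'' ys where l: "q' \<in> set Q - {cv}" "w'' \<in> {w1, w2}" "path (q' # ys @ [w''])"
      "set (q' # ys @ [w'']) \<subseteq> U" "set ys \<inter> ((set Q - {cv}) \<union> {w1, w2}) = {}" by (auto simp: insert_Diff_if)
    obtain i where i: "i < ?L" "q' = Q ! i" using l(1) by (auto simp: in_set_conv_nth)
    define p where "p = Suc i"
    define xs where "xs = ys @ (if w'' = w1 then [w1] else [w2, w1])"
    have py: "path (ys @ [w''])" "E q' (hd (ys @ [w'']))" using l(3) unfolding path_Cons by auto
    have xs: "path xs" "xs \<noteq> []" "last xs = w1" "hd xs = hd (ys @ [w''])" "length ys < length xs"
      "w'' \<noteq> w1 \<Longrightarrow> 2 \<le> length xs"
    proof -
      have "path (ys @ [w2, w1])" if "w'' \<noteq> w1"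
      proof -
        have "w'' = w2" using that l(2) by auto
        then show ?thesis using py(1) l(5) sym[OF Ew(2)] w unfolding path_append by (auto simp: path_Cons)
      qed
      then show "path xs" using py unfolding xs_def by auto
    qed (use l(2) in \<open>auto simp: xs_def hd_append\<close>)
    have xQ: "set xs \<inter> set Q = {}"
    proof -
      have "set ys \<inter> set Q = {}" using l(4,5) unfolding U_def by auto
      then show ?thesis using w(2) unfolding xs_def by auto
    qed
    have pp: "p \<in> pos Q (hd xs)" "1 \<le> p" "p \<le> ?L"
      using py(2) i sym unfolding pos_def p_def xs(4) by auto
    have p3: "p \<noteq> 3" using i l(1) unfolding p_def cv_def by (auto simp: eval_nat_numeral)
    have m: "2 \<le> length xs"
    proof (rule ccontr)
      assume "\<not> 2 \<le> length xs"
      then have "xs = [w1]" using xs by (cases xs) (auto simp: Suc_le_eq)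
      then have "{3, p} \<subseteq> pos Q w1" using c pp by auto
      then have "card {3, p} \<le> card (pos Q w1)" using finite_pos by (intro card_mono) auto
      moreover have "card (pos Q w1) \<le> 1" using poor[OF Q, of w1] w(2) t by auto
      ultimately show False using p3 by simp
    qed
    show False
    proof (cases "p < 3")
      case True
      then show False using splice_gap[OF Q xs(2,1) xQ, of p 3] pp c m xs(3) by auto
    next
      case False
      then have "3 + length xs < p"
        using splice_gap[OF Q _ _ _, of "rev xs" 3 p] pp c xs xQ p3 by (auto simp: hd_rev last_rev)
      then show False using splice_gap[OF Q xs(2,1) xQ, of p "Suc ?L"] pp m L by auto
    qed
  qed
  have "star_cond (V - {cv, e})"
  proof (rule ccontr)
    assume "\<not> ?thesis"
    then obtain X where X: "X \<subseteq> V - {cv, e}" "X \<noteq> {}"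
      "\<And>u. u \<in> X \<Longrightarrow> \<exists>ys. path (u # ys) \<and> length ys = 2 \<and> set ys \<subseteq> X"
      using bad_edge_extension[of "V - {cv, e}"] by (metis Diff_subset)
    have XU: "X \<subseteq> U" using X unfolding U_def by auto
    show False
    proof (cases "\<exists>u\<in>X. (e, u) \<in> joined U")
      case True
      then obtain u where u: "u \<in> X" "(e, u) \<in> joined U" by blast
      have "{e} \<inter> X = {}" using X(1) by blast
      note en = entry_path[OF u(2)[unfolded joined_def] singletonI u(1) this XU X(3)]
      obtain a zs where z: "a \<in> {e}" "path (a # zs)" "length zs = Suc 2" "set zs \<subseteq> U - {e}"
        by (rule en) assumption+
      have eU: "set (e # zs) \<subseteq> U" using z cQ QV unfolding U_def by auto
      have wz: "w1 \<notin> set zs" "w2 \<notin> set zs"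
        using sep[of e w1] sep[of e w2] path_joined[of "e # zs" U e] z(1,2) eU cQ by auto
      have pz: "path zs" "E e (hd zs)" "e \<notin> set zs" using z unfolding path_Cons by auto
      have "path (rev zs @ [e, cv, w1, w2])"
        unfolding path_append using pz z(3) wz sym[OF pz(2)] sym[OF Ece] Ew w eU cQ QV
        by (auto simp: path_Cons last_rev U_def)
      from longest_le[OF Q this] show False using L z(3) by simp
    next
      case False
      obtain u where u: "u \<in> X" using X by blast
      have "(cv, u) \<in> {(a, b). E a b \<and> a \<in> V \<and> b \<in> V}\<^sup>*"
      proof -
        have "{(a, b). E a b \<and> a \<in> V \<and> b \<in> V} = {(a, b). E a b}" using inV inV2 by blast
        then show ?thesis using conn[of cv u] u XU cQ QV unfolding U_def by auto
      qed
      moreover have "{cv} \<inter> X = {}" "X \<subseteq> V" using XU unfolding U_def by auto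
      ultimately have pre: "(cv, u) \<in> {(a, b). E a b \<and> a \<in> V \<and> b \<in> V}\<^sup>*" "{cv} \<inter> X = {}" "X \<subseteq> V" by auto
      note en = entry_path[OF pre(1) singletonI u pre(2,3) X(3)]
      obtain a zs where z: "a \<in> {cv}" "path (a # zs)" "length zs = Suc 2" "set zs \<subseteq> V - {cv}"
        "\<exists>x\<in>X. \<exists>ys. path ys \<and> x \<in> set ys \<and> set zs \<subseteq> set ys \<and> set ys \<inter> {cv} = {}"
        by (rule en) assumption+
      then obtain x ys where x: "x \<in> X" "path ys" "x \<in> set ys" "set zs \<subseteq> set ys" "cv \<notin> set ys" by auto
      have ysU: "set ys \<subseteq> U" using x path_subset unfolding U_def by auto
      have "set zs \<inter> set (drop 3 Q) = {}"
      proof (rule ccontr)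
        assume "\<not> ?thesis"
        then obtain y where y: "y \<in> set zs" "y \<in> set (drop 3 Q)" by blast
        have e3: "e \<in> set (drop 3 Q)"
        proof -
          have "drop 3 Q = e # drop 4 Q" using Cons_nth_drop_Suc[of 3 Q] L unfolding e_def by simp
          then show ?thesis by simp
        qed
        have "set (drop 3 Q) \<subseteq> U"
        proof
          fix v assume v: "v \<in> set (drop 3 Q)"
          then obtain j where "3 + j < ?L" "v = Q ! (3 + j)"
            by (metis add.commute in_set_conv_nth length_drop less_diff_conv nth_drop v L(1) less_imp_le_nat nat_le_linear not_less diff_is_0_eq less_nat_zero_code)
          then show "v \<in> U" using path_distinct[OF pQ] QV unfolding U_def cv_def by (auto simp: nth_eq_iff_index_eq)
        qed
        then have "(e, y) \<in> joined U" using path_joined[OF path_drop[OF pQ] _ e3 y(2)] by blast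
        moreover have "(y, x) \<in> joined U" using path_joined[OF x(2) ysU _ x(3)] x(4) y(1) by blast
        ultimately show False using False x(1) joined_trans by blast
      qed
      moreover have d: "drop 2 Q = cv # drop 3 Q"
        using Cons_nth_drop_Suc[of 2 Q] L unfolding cv_def by simp
      moreover have "path zs" "E cv (hd zs)" "cv \<notin> set zs" using z unfolding path_Cons by auto
      moreover have "E (hd zs) cv" using sym calculation by blast
      moreover have "zs \<noteq> []" using z(3) by auto
      ultimately have "path (rev zs @ drop 2 Q)"
        unfolding path_append using path_drop[OF pQ, of 2] by (simp add: last_rev)
      from longest_le[OF Q this] show False using L z(3) by simp
    qed
  qed
  moreover have "card {cv, e} \<le> 2" using cQ by simp
  ultimately show ?thesis using cQ QV by (intro exI[of _ "{cv, e}"]) auto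
qed

lemma card_edges_outside_bound:
  assumes Q: "longest Q"
    and low: "\<And>S. S \<subseteq> V - set Q \<Longrightarrow> S \<noteq> {} \<Longrightarrow> \<exists>x\<in>S. deg (set Q \<union> S) x \<le> d"
  shows "card (edges V) \<le> card (edges (set Q)) + d * (card V - length Q)"
proof -
  have QV: "set Q \<subseteq> V" by (rule path_subset[OF longest_path[OF Q]])
  have "card (edges V) \<le> card (edges (set Q)) + d * card (V - set Q)"
  proof (rule card_edges_degenerate[OF fin QV])
    fix S' assume S': "set Q \<subset> S'" "S' \<subseteq> V"
    then have "S' - set Q \<subseteq> V - set Q" "S' - set Q \<noteq> {}" by auto
    from low[OF this] S' show "\<exists>x\<in>S' - set Q. deg S' x \<le> d" by (auto simp: Un_absorb1)
  qed
  moreover have "card (V - set Q) = card V - length Q"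
    using QV fin distinct_card[OF path_distinct[OF longest_path[OF Q]]] by (simp add: card_Diff_subset)
  ultimately show ?thesis by simp
qed

lemma longest_length_ge: "longest Q \<Longrightarrow> 2 \<le> length Q"
proof -
  assume Q: "longest Q"
  have "edges V \<noteq> {}"
  proof
    assume "edges V = {}"
    then have "bound2 (card V) < 0" using dense by simp
    moreover have "0 \<le> bound2 (card V)"
    proof -
      have n: "3 * int t - 1 \<le> int (card V)" using large t by linarith
      have "(2 * (int t - 2)) * (3 * int t - 1) \<le> (2 * (int t - 2)) * int (card V)"
        by (rule mult_left_mono[OF n]) (use t in simp)
      moreover have "(5 * int t - 11) * int t \<ge> 0" using t3 by simp
      ultimately show ?thesis unfolding bound2_def by (simp add: algebra_simps)
    qed
    ultimately show False by simp
  qed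
  then obtain x y where "E x y" unfolding edges_def by auto
  then have "path [x, y]" using inV inV2 irr by (auto simp: path_Cons)
  from longest_le[OF Q this] show ?thesis by simp
qed

text \<open>If no edge lies outside \<open>Q\<close>, each outside vertex adds at most one edge and
  the bound holds. Otherwise a path on at least two vertices hangs on \<open>Q\<close>, and since
  \<open>Q\<close> has at most six vertices, it hangs at the third one from some end.\<close>

lemma star_cond_t3:
  assumes t: "t = 3"
  shows "\<exists>A\<subseteq>V. card A \<le> 2 \<and> star_cond (V - A)"
proof -
  obtain Q where Q: "longest Q" by (rule ex_longest)
  let ?L = "length Q"
  have pQ: "path Q" by (rule longest_path[OF Q])
  show ?thesis
  proof (cases "\<exists>x\<in>V - set Q. \<exists>y\<in>V - set Q. E x y")
    case False
    have L: "2 \<le> ?L" "?L \<le> 5 + \<epsilon>" using longest_length_ge[OF Q] longest_length[OF Q] t by auto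
    have "card (edges V) \<le> card (edges (set Q)) + 1 * (card V - ?L)"
    proof (rule card_edges_outside_bound[OF Q])
      fix S assume S: "S \<subseteq> V - set Q" "S \<noteq> {}"
      then obtain x where x: "x \<in> S" by blast
      have "S \<inter> {y. E x y} = {}" using False S x by blast
      then have "deg (set Q \<union> S) x \<le> 1" using deg_outside[OF Q S(1) x] poor[OF Q, of x] x S t
        unfolding deg_def by auto
      then show "\<exists>x\<in>S. deg (set Q \<union> S) x \<le> 1" using x by blast
    qed
    moreover have "2 * card (edges (set Q)) + 6 \<le> 4 * ?L + 2 * \<epsilon>"
      using card_edges_sharp[of "set Q"] path_subset[OF pQ] distinct_card[OF path_distinct[OF pQ]] t L by simp
    moreover have "?L \<le> card V" by (rule path_length[OF pQ])
    ultimately have "2 * int (card (edges V)) \<le> 2 * int ?L + 2 * int (card V) + 2 * int \<epsilon> - 6" by linarith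
    moreover have "bound2 (card V) = 2 * int (card V) + 4 + 6 * int \<epsilon>" unfolding bound2_def by (simp add: t)
    ultimately show ?thesis using dense L by linarith
  next
    case True
    then obtain x y where xy: "x \<in> V - set Q" "y \<in> V - set Q" "E x y" by blast
    have pxy: "path [x, y]" using xy irr by (auto simp: path_Cons)
    have "deg (set [x, y]) (hd [x, y]) = 1"
    proof -
      have "{x, y} \<inter> {z. E x z} = {y}" using xy irr by auto
      then show ?thesis unfolding deg_def by simp
    qed
    then obtain ys c where ys: "path ys" "ys \<noteq> []" "set ys \<inter> set Q = {}" "1 < length ys" "c \<in> pos Q (hd ys)"
      using attached_path[OF pQ longest_ne[OF Q] pxy] xy by auto
    obtain w1 w2 zs where yz: "ys = w1 # w2 # zs" using ys(4) by (cases ys; cases "tl ys") auto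
    have w: "path [w1, w2]" "{w1, w2} \<subseteq> V - set Q" using ys path_subset[OF ys(1)] path_take[OF ys(1), of 2] unfolding yz by auto
    have c: "c \<in> pos Q w1" using ys(5) yz by simp
    have "3 \<le> c" "c + 2 \<le> ?L" "?L \<le> 6"
      using arms[OF Q w(1), of c] w(2) c longest_length[OF Q] t eps by auto
    then have "c = 3 \<or> Suc ?L - c = 3" by auto
    then show ?thesis
    proof
      assume "c = 3"
      then show ?thesis using star_cond_of_pendant_path_t3[OF t Q w] c by simp
    next
      assume "Suc ?L - c = 3"
      then have "3 \<in> pos (rev Q) w1" using c unfolding pos_rev by force
      then show ?thesis using star_cond_of_pendant_path_t3[OF t longest_rev[OF Q] w(1)] w(2) by simp
    qed
  qed
qed

end

section \<open>Longest paths outside \<open>Q\<close> and the components they span\<close>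

context ugraph begin

definition longest_in :: "'a set \<Rightarrow> 'a list \<Rightarrow> bool" where
  "longest_in S xs \<longleftrightarrow> path xs \<and> xs \<noteq> [] \<and> set xs \<subseteq> S \<and> (\<forall>ys. path ys \<longrightarrow> set ys \<subseteq> S \<longrightarrow> length ys \<le> length xs)"

lemma ex_longest_in:
  assumes "S \<subseteq> V" "S \<noteq> {}"
  obtains xs where "longest_in S xs"
proof -
  obtain v where v: "v \<in> S" using assms by blast
  define W where "W = (\<lambda>xs. path xs \<and> xs \<noteq> [] \<and> set xs \<subseteq> S)"
  have "W [v]" using v assms unfolding W_def by auto
  moreover have "\<forall>xs. W xs \<longrightarrow> length xs < Suc (card V)" using path_length unfolding W_def by (simp add: less_Suc_eq_le)
  ultimately obtain xs where "W xs" "\<forall>ys. W ys \<longrightarrow> length ys \<le> length xs"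
    using ex_has_greatest_nat[of W "[v]" length "Suc (card V)"] by blast
  then have "longest_in S xs" unfolding longest_in_def W_def by force
  then show ?thesis by (rule that)
qed

lemma longest_in_rev: "longest_in S xs \<Longrightarrow> longest_in S (rev xs)"
  unfolding longest_in_def by auto

lemma longest_in_hd:
  assumes "longest_in S xs"
  shows "S \<inter> {y. E (hd xs) y} \<subseteq> set xs" "deg S (hd xs) = deg (set xs) (hd xs)"
    "deg (set xs) (hd xs) \<le> length xs - 1"
proof -
  show *: "S \<inter> {y. E (hd xs) y} \<subseteq> set xs"
  proof (rule ccontr)
    assume "\<not> ?thesis"
    then obtain y where y: "y \<in> S" "E (hd xs) y" "y \<notin> set xs" by blast
    then have "path (y # xs)" using assms inV2 sym[OF y(2)] unfolding longest_in_def path_Cons by auto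
    then show False using assms y unfolding longest_in_def by (metis Suc_n_not_le_n insert_subset length_Cons list.simps(15))
  qed
  have "S \<inter> {y. E (hd xs) y} = set xs \<inter> {y. E (hd xs) y}" using * assms unfolding longest_in_def by blast
  then show "deg S (hd xs) = deg (set xs) (hd xs)" unfolding deg_def by simp
  have "hd xs \<in> set xs" "distinct xs" using assms path_distinct unfolding longest_in_def by auto
  then show "deg (set xs) (hd xs) \<le> length xs - 1" using deg_le[of "set xs" "hd xs"] distinct_card by fastforce
qed

lemma card_edges_remove_set:
  assumes "finite T" "K \<subseteq> T" "\<And>x. x \<in> K \<Longrightarrow> deg (T - K) x \<le> 1"
  shows "2 * card (edges T) \<le> 2 * card (edges (T - K)) + 2 * card K + card K * (card K - 1)"
  using assms
proof (induction "card K" arbitrary: K T)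
  case 0
  then have "K = {}" using finite_subset by fastforce
  then show ?case by simp
next
  case (Suc n)
  have fK: "finite K" using Suc.prems finite_subset by blast
  obtain x where x: "x \<in> K" using Suc(2) by fastforce
  have e: "T - {x} - (K - {x}) = T - K" using x by blast
  have ck: "card (K - {x}) = n" using x Suc(2) fK by simp
  have IH: "2 * card (edges (T - {x})) \<le> 2 * card (edges (T - K)) + 2 * n + n * (n - 1)"
    using Suc(1)[of "K - {x}" "T - {x}"] e ck Suc.prems by auto
  have "T \<inter> {y. E x y} = ((T - K) \<inter> {y. E x y}) \<union> (K \<inter> {y. E x y})" using Suc.prems(2) by blast
  then have "deg T x \<le> deg (T - K) x + deg K x" unfolding deg_def by (simp add: card_Un_le)
  also have "\<dots> \<le> 1 + n" using Suc.prems(3)[OF x] deg_le[OF fK x] Suc(2) by simp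
  finally have "2 * card (edges T) \<le> 2 * card (edges (T - {x})) + 2 + 2 * n"
    using card_edges_remove[OF Suc.prems(1), of x] x Suc.prems(2) by auto
  also have "\<dots> \<le> 2 * card (edges (T - K)) + 2 * Suc n + (n * (n - 1) + 2 * n)" using IH by simp
  also have "n * (n - 1) + 2 * n = Suc n * (Suc n - 1)" by (cases n) auto
  finally show ?case using Suc(2) by simp
qed

text \<open>If the ends of every longest path inside \<open>S\<close> are attached to \<open>Q\<close> in one vertex only and see their
  whole path, then by rotation such a path spans a clique that is a component of \<open>S\<close>.\<close>

lemma closed_clique:
  assumes xs: "longest_in S xs"
    and H: "\<And>ys. longest_in S ys \<Longrightarrow> length ys = length xs \<Longrightarrow>
      \<exists>c. pos Q (hd ys) = {c} \<and> pos Q (last ys) = {c} \<and> length ys - 1 \<le> deg (set ys) (hd ys)"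
  shows "\<exists>c. \<forall>x\<in>set xs. pos Q x = {c} \<and> S \<inter> {y. E x y} \<subseteq> set xs"
proof -
  obtain c where c: "pos Q (hd xs) = {c}" "pos Q (last xs) = {c}" "length xs - 1 \<le> deg (set xs) (hd xs)"
    using H[OF xs] by blast
  have p: "path xs" "xs \<noteq> []" "set xs \<subseteq> S" using xs unfolding longest_in_def by auto
  have adj: "E (hd xs) y" if "y \<in> set xs" "y \<noteq> hd xs" for y
  proof -
    have "set xs \<inter> {y. E (hd xs) y} \<subseteq> set xs - {hd xs}" using irr by auto
    moreover have "card (set xs - {hd xs}) \<le> card (set xs \<inter> {y. E (hd xs) y})"
      using c(3) p distinct_card[OF path_distinct[OF p(1)]] unfolding deg_def by simp
    ultimately have "set xs \<inter> {y. E (hd xs) y} = set xs - {hd xs}" by (intro card_subset_eq) (auto intro: le_antisym card_mono)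
    then show ?thesis using that by blast
  qed
  have "pos Q x = {c} \<and> S \<inter> {y. E x y} \<subseteq> set xs" if x: "x \<in> set xs" for x
  proof (cases "x = last xs")
    case True
    then show ?thesis using c longest_in_hd(1)[OF longest_in_rev[OF xs]] p by (simp add: hd_rev)
  next
    case False
    obtain a b where ab: "xs = a @ x # b" using x by (meson split_list)
    have b: "b \<noteq> []" using False ab by auto
    define ys where "ys = rev (a @ [x]) @ b"
    have "hd b \<noteq> hd xs"
      using path_distinct[OF p(1)] b unfolding ab by (cases a; cases b) auto
    then have "E (hd xs) (hd b)" using adj[of "hd b"] b unfolding ab by auto
    moreover have "last (rev (a @ [x])) = hd xs" unfolding ab by (cases a) auto
    moreover have "path (rev (a @ [x]))" "path b" "set (a @ [x]) \<inter> set b = {}"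
      using p(1) path_append[of "a @ [x]" b] unfolding ab path_rev by auto
    ultimately have "path ys" unfolding ys_def path_append[of "rev (a @ [x])"] using b by auto
    moreover have s: "set ys = set xs" "length ys = length xs" "hd ys = x" "last ys = last xs" "ys \<noteq> []"
      unfolding ys_def ab using b by auto
    ultimately have ly: "longest_in S ys" using xs unfolding longest_in_def by simp
    from H[OF ly s(2)] c(2) s have "pos Q x = {c}" by auto
    then show ?thesis using longest_in_hd(1)[OF ly] s by simp
  qed
  then show ?thesis by blast
qed

text \<open>The edge allows two detours: \<open>xs\<close>, then back from \<open>c\<close> to
  \<open>i\<close>, over to \<open>j\<close> and on; or \<open>xs\<close>, then forward from
  \<open>c\<close> to \<open>j\<close>, over to \<open>i\<close> and back to the start. Together
  they have \<open>length Q + 2 * length xs + 3\<close> vertices, so one of them is longer than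
  \<open>Q\<close>.\<close>

lemma no_edges_across:
  assumes Q: "longest Q" and xs: "path xs" "xs \<noteq> []" "set xs \<inter> set Q = {}" and c: "c \<in> pos Q (hd xs)"
    and L: "length Q < 2 * length xs + 3" and ij: "1 \<le> i" "i < c" "c < j" "j \<le> length Q"
  shows "\<not> E (Q ! (i - 1)) (Q ! (j - 1))"
proof
  assume e: "E (Q ! (i - 1)) (Q ! (j - 1))"
  let ?L = "length Q" and ?m = "length xs"
  have pQ: "path Q" by (rule longest_path[OF Q])
  define a b d f where "a = take i Q" and "b = drop (i - 1) (take c Q)"
    and "d = drop (c - 1) (take j Q)" and "f = drop (j - 1) Q"
  have ne: "a \<noteq> []" "b \<noteq> []" "d \<noteq> []" "f \<noteq> []" unfolding a_def b_def d_def f_def using ij by auto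
  have ends: "last a = Q ! (i - 1)" "hd b = Q ! (i - 1)" "last b = Q ! (c - 1)" "hd d = Q ! (c - 1)"
    "last d = Q ! (j - 1)" "hd f = Q ! (j - 1)"
    unfolding a_def b_def d_def f_def using ij last_take_pos[of i Q] last_take_pos[of c Q] last_take_pos[of j Q]
    by (auto simp: hd_drop_conv_nth last_drop)
  have paths: "path a" "path b" "path d" "path f" unfolding a_def b_def d_def f_def
    using path_take path_drop pQ by auto
  have sQ: "set a \<subseteq> set Q" "set b \<subseteq> set Q" "set d \<subseteq> set Q" "set f \<subseteq> set Q"
    unfolding a_def b_def d_def f_def by (meson order_trans set_take_subset set_drop_subset)+
  have "set (take c Q) \<inter> set (drop (j - 1) Q) = {}" "set (take i Q) \<inter> set (drop (c - 1) Q) = {}"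
    using set_take_disj_set_drop_if_distinct[OF path_distinct[OF pQ]] ij by auto
  moreover have "set b \<subseteq> set (take c Q)" "set d \<subseteq> set (drop (c - 1) Q)"
    unfolding b_def d_def by (rule set_drop_subset) (simp add: drop_take set_take_subset)
  ultimately have disj: "set b \<inter> set f = {}" "set d \<inter> set a = {}" unfolding f_def a_def by auto
  have h: "last (rev xs) = hd xs" using xs(2) by (simp add: last_rev)
  have Ec: "E (hd xs) (Q ! (c - 1))" by (rule pos_E[OF c])
  have "path (rev xs @ rev b @ f)"
    unfolding path_append using xs paths ne ends disj sQ h Ec e by (auto simp: hd_rev last_rev hd_append)
  from longest_le[OF Q this] have 1: "?m + (c - (i - 1)) + (?L - (j - 1)) \<le> ?L"
    unfolding b_def f_def using ij by simp
  have "path (rev xs @ d @ rev a)"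
    unfolding path_append using xs paths ne ends disj sQ h Ec sym[OF e] by (auto simp: hd_rev last_rev hd_append)
  from longest_le[OF Q this] have 2: "?m + (j - (c - 1)) + i \<le> ?L"
    unfolding d_def a_def using ij by simp
  show False using 1 2 ij L by linarith
qed

text \<open>Every edge lies in one of two blocks, the positions up to \<open>c\<close> and those
  from \<open>c\<close> on, which share the vertex at \<open>c\<close>.\<close>

lemma card_edges_separated:
  assumes Q: "path Q" and c: "1 \<le> c" "c \<le> length Q"
    and sep: "\<And>i j. 1 \<le> i \<Longrightarrow> i < c \<Longrightarrow> c < j \<Longrightarrow> j \<le> length Q \<Longrightarrow> \<not> E (Q ! (i - 1)) (Q ! (j - 1))"
  shows "2 * card (edges (set Q)) \<le> c * (c - 1) + (Suc (length Q) - c) * (length Q - c)"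
proof -
  let ?X = "set (take c Q)" and ?Y = "set (drop (c - 1) Q)"
  have inX: "Q ! (i - 1) \<in> ?X" if "1 \<le> i" "i \<le> c" for i
    using that c by (metis One_nat_def Suc_le_lessD Suc_pred diff_le_mono in_set_conv_nth length_take less_le_trans min.absorb2 nth_take zero_less_one)
  have inY: "Q ! (i - 1) \<in> ?Y" if "c \<le> i" "i \<le> length Q" for i
  proof -
    have "drop (c - 1) Q ! (i - c) = Q ! (i - 1)" "i - c < length (drop (c - 1) Q)" using that c by auto
    then show ?thesis by (metis nth_mem)
  qed
  have "edges (set Q) \<subseteq> edges ?X \<union> edges ?Y"
  proof
    fix ed assume "ed \<in> edges (set Q)"
    then obtain x y where xy: "x \<in> set Q" "y \<in> set Q" "E x y" "ed = {x, y}" unfolding edges_def by auto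
    obtain i where i: "i < length Q" "x = Q ! i" using xy(1) by (auto simp: in_set_conv_nth)
    obtain j where j: "j < length Q" "y = Q ! j" using xy(2) by (auto simp: in_set_conv_nth)
    have "\<not> (Suc i < c \<and> c < Suc j)" "\<not> (Suc j < c \<and> c < Suc i)"
      using sep[of "Suc i" "Suc j"] sep[of "Suc j" "Suc i"] i j xy(3) sym[OF xy(3)] by auto
    then have "Suc i \<le> c \<and> Suc j \<le> c \<or> c \<le> Suc i \<and> c \<le> Suc j" by linarith
    then have "x \<in> ?X \<and> y \<in> ?X \<or> x \<in> ?Y \<and> y \<in> ?Y"
      using inX[of "Suc i"] inX[of "Suc j"] inY[of "Suc i"] inY[of "Suc j"] i j by auto
    moreover have "ed \<in> edges Z" if "x \<in> Z" "y \<in> Z" for Z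
      unfolding edges_def using that xy by (intro image_eqI[of _ _ "(x, y)"]) auto
    ultimately show "ed \<in> edges ?X \<union> edges ?Y" by blast
  qed
  then have "card (edges (set Q)) \<le> card (edges ?X \<union> edges ?Y)" by (intro card_mono) (auto simp: finite_edges)
  also have "\<dots> \<le> card (edges ?X) + card (edges ?Y)" by (rule card_Un_le)
  finally have "2 * card (edges (set Q)) \<le> 2 * card (edges ?X) + 2 * card (edges ?Y)" by simp
  also have "\<dots> \<le> card ?X * (card ?X - 1) + card ?Y * (card ?Y - 1)"
    using card_edges_le[of ?X] card_edges_le[of ?Y] by simp
  also have "card ?X = c" using distinct_card[OF distinct_take[OF path_distinct[OF Q]], of c] c by simp
  also have "card ?Y = Suc (length Q) - c" using distinct_card[OF distinct_drop[OF path_distinct[OF Q]], of "c - 1"] c by simp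
  finally show ?thesis by (simp add: Suc_diff_le)
qed

lemma closed_pair_not_on_path:
  assumes "path [z1, z2, z3]" "{z1, z2, z3} \<subseteq> S" "u \<in> S" "v \<in> S"
    and "\<And>z. z \<in> S \<Longrightarrow> E u z \<Longrightarrow> z = v" "\<And>z. z \<in> S \<Longrightarrow> E v z \<Longrightarrow> z = u"
  shows "u \<notin> {z1, z2, z3}"
proof
  have e: "E z1 z2" "E z2 z1" "E z2 z3" "E z3 z2" "z1 \<noteq> z3" "z1 \<in> S" "z2 \<in> S" "z3 \<in> S"
    using assms(1,2) sym by (auto simp: path_Cons)
  assume "u \<in> {z1, z2, z3}"
  then consider "u = z1" | "u = z2" | "u = z3" by blast
  then show False using e assms(5,6) by cases metis+
qed

end

section \<open>The exceptional configuration: a pair attached twice\<close>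

context connected_ugraph begin

text \<open>Here \<open>Q\<close> is a path on 8 vertices and the pairs between its third and sixth vertex can be permuted
  with the pair outside \<open>Q\<close>.\<close>

lemma star_cond_of_double_attachment:
  assumes Q: "longest Q" and L: "length Q = 8" and w: "path [w1, w2]" "{w1, w2} \<inter> set Q = {}"
    and p: "pos Q w1 = {3, 6}" "pos Q w2 = {3, 6}"
  shows "\<exists>A\<subseteq>V. card A \<le> 2 \<and> star_cond (V - A)"
proof -
  obtain q1 q2 q3 q4 q5 q6 q7 q8 where q: "Q = [q1, q2, q3, q4, q5, q6, q7, q8]"
    using L by (auto simp: length_Suc_conv eval_nat_numeral)
  have pQ: "path Q" by (rule longest_path[OF Q])
  have dist: "distinct [q1, q2, q3, q4, q5, q6, q7, q8, w1, w2]"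
    using path_distinct[OF pQ] path_distinct[OF w(1)] w(2) unfolding q by auto
  have inV': "q1 \<in> V" "q2 \<in> V" "q3 \<in> V" "q4 \<in> V" "q5 \<in> V" "q6 \<in> V" "q7 \<in> V" "q8 \<in> V" "w1 \<in> V" "w2 \<in> V"
    using path_subset[OF pQ] path_subset[OF w(1)] unfolding q by auto
  have eq: "E q1 q2" "E q2 q3" "E q3 q4" "E q4 q5" "E q5 q6" "E q6 q7" "E q7 q8"
    using pQ unfolding q by (auto simp: path_Cons)
  have "3 \<in> pos Q w1" "6 \<in> pos Q w1" "3 \<in> pos Q w2" "6 \<in> pos Q w2" using p by auto
  from this[THEN pos_E] have ew: "E w1 q3" "E w1 q6" "E w2 q3" "E w2 q6" unfolding q by (simp_all add: eval_nat_numeral)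
  have ew12: "E w1 w2" using w(1) by (auto simp: path_Cons)
  note es = eq ew ew12
  note es' = es es[THEN sym]
  have max: "\<not> path xs" if "length xs = 9" for xs using longest_le[OF Q, of xs] that L by auto
  have only: "z \<in> {q3, q6}" if e: "E w z" and zQ: "z \<in> set Q" and ww: "w = w1 \<or> w = w2" for w z
  proof -
    obtain i where i: "i < 8" "z = Q ! i" using zQ L by (auto simp: in_set_conv_nth)
    then have "Suc i \<in> pos Q w" using e L unfolding pos_def by auto
    then have "i = 2 \<or> i = 5" using p ww by auto
    then show ?thesis using i unfolding q by auto
  qed
  define S where "S = V - {q3, q6}"
  \<comment> \<open>The edges \<open>w1 w2\<close> and \<open>q4 q5\<close> are shown to be isolated
    in \<open>S\<close>: any further edge at them gives a path on nine vertices, written out in each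
    case.\<close>
  have w1: "z = w2" if "z \<in> S" "E w1 z" for z
  proof (rule ccontr)
    assume n: "z \<noteq> w2"
    have "z \<notin> set Q" using only[of w1 z] that unfolding S_def by auto
    then have "path [z, w1, w2, q3, q4, q5, q6, q7, q8]"
      using that n dist inV' es' irr sym[OF that(2)] unfolding S_def q by (auto simp: path_Cons)
    then show False using max by simp
  qed
  have w2: "z = w1" if "z \<in> S" "E w2 z" for z
  proof (rule ccontr)
    assume n: "z \<noteq> w1"
    have "z \<notin> set Q" using only[of w2 z] that unfolding S_def by auto
    then have "path [z, w2, w1, q3, q4, q5, q6, q7, q8]"
      using that n dist inV' es' irr sym[OF that(2)] unfolding S_def q by (auto simp: path_Cons)
    then show False using max by simp
  qed
  have zw: "z \<noteq> w1 \<and> z \<noteq> w2" if "E u z" "u \<in> {q4, q5}" for u z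
    using w1[of u] w2[of u] that dist sym[OF that(1)] inV' unfolding S_def by auto
  have q4: "z = q5" if z: "z \<in> S" "E q4 z" for z
  proof (rule ccontr)
    assume n: "z \<noteq> q5"
    have zn: "z \<noteq> w1" "z \<noteq> w2" "z \<noteq> q3" "z \<noteq> q6" "z \<noteq> q4" "z \<in> V" using zw[OF z(2)] z irr unfolding S_def by auto
    note ez = z(2) sym[OF z(2)]
    have "z \<notin> set Q"
    proof
      assume "z \<in> set Q"
      then consider "z = q1" | "z = q2" | "z = q7" | "z = q8" using zn n unfolding q by auto
      then show False
      proof cases
        case 1
        then have "path [q5, q4, q1, q2, q3, w1, w2, q6, q7]" using dist inV' es' ez by (auto simp: path_Cons)
        then show False using max by simp
      next
        case 2
        then have "path [q8, q7, q6, q5, q4, q2, q3, w1, w2]" using dist inV' es' ez by (auto simp: path_Cons)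
        then show False using max by simp
      next
        case 3
        then have "path [q8, q7, q4, q5, q6, w1, w2, q3, q2]" using dist inV' es' ez by (auto simp: path_Cons)
        then show False using max by simp
      next
        case 4
        then have "path [q7, q8, q4, q5, q6, w1, w2, q3, q2]" using dist inV' es' ez by (auto simp: path_Cons)
        then show False using max by simp
      qed
    qed
    then have "path [z, q4, q5, q6, w1, w2, q3, q2, q1]"
      using dist inV' es' ez zn unfolding q by (auto simp: path_Cons)
    then show False using max by simp
  qed
  have q5: "z = q4" if z: "z \<in> S" "E q5 z" for z
  proof (rule ccontr)
    assume n: "z \<noteq> q4"
    have zn: "z \<noteq> w1" "z \<noteq> w2" "z \<noteq> q3" "z \<noteq> q6" "z \<noteq> q5" "z \<in> V" using zw[OF z(2)] z irr unfolding S_def by auto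
    note ez = z(2) sym[OF z(2)]
    have "z \<notin> set Q"
    proof
      assume "z \<in> set Q"
      then consider "z = q1" | "z = q2" | "z = q7" | "z = q8" using zn n unfolding q by auto
      then show False
      proof cases
        case 1
        then have "path [q2, q1, q5, q4, q3, w1, w2, q6, q7]" using dist inV' es' ez by (auto simp: path_Cons)
        then show False using max by simp
      next
        case 2
        then have "path [q1, q2, q5, q4, q3, w1, w2, q6, q7]" using dist inV' es' ez by (auto simp: path_Cons)
        then show False using max by simp
      next
        case 3
        then have "path [q1, q2, q3, q4, q5, q7, q6, w1, w2]" using dist inV' es' ez by (auto simp: path_Cons)
        then show False using max by simp
      next
        case 4
        then have "path [q4, q5, q8, q7, q6, w1, w2, q3, q2]" using dist inV' es' ez by (auto simp: path_Cons)
        then show False using max by simp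
      qed
    qed
    then have "path [z, q5, q4, q3, w1, w2, q6, q7, q8]"
      using dist inV' es' ez zn unfolding q by (auto simp: path_Cons)
    then show False using max by simp
  qed
  have inS: "w1 \<in> S" "w2 \<in> S" "q4 \<in> S" "q5 \<in> S" using dist inV' unfolding S_def by auto
  have "star_cond S"
  proof (rule ccontr)
    assume "\<not> star_cond S"
    then obtain X where X: "X \<subseteq> S" "X \<noteq> {}"
      "\<And>u. u \<in> X \<Longrightarrow> \<exists>ys. path (u # ys) \<and> length ys = 2 \<and> set ys \<subseteq> X"
      using bad_edge_extension[of S] unfolding S_def by (metis Diff_subset)
    obtain a zs where z: "a \<in> {q3, q6}" "path (a # zs)" "length zs = Suc 2" "set zs \<subseteq> V - {q3, q6}"
      by (rule entry_path_connected[OF _ _ X(1)[unfolded S_def] X(2,3)]) (use inV' in auto)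
    obtain z1 z2 z3 where zs: "zs = [z1, z2, z3]" using z(3) by (auto simp: length_Suc_conv eval_nat_numeral)
    have pz: "path [z1, z2, z3]" "{z1, z2, z3} \<subseteq> S" using z unfolding zs S_def by (auto simp: path_Cons)
    have out: "w1 \<notin> {z1, z2, z3}" "w2 \<notin> {z1, z2, z3}" "q4 \<notin> {z1, z2, z3}" "q5 \<notin> {z1, z2, z3}"
      using closed_pair_not_on_path[OF pz inS(1,2) w1 w2] closed_pair_not_on_path[OF pz inS(2,1) w2 w1]
        closed_pair_not_on_path[OF pz inS(3,4) q4 q5] closed_pair_not_on_path[OF pz inS(4,3) q5 q4] by auto
    have ez: "E z3 z2" "E z2 z1" "E z1 a" "z1 \<noteq> z2" "z1 \<noteq> z3" "z2 \<noteq> z3"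
      using z(2) sym unfolding zs by (auto simp: path_Cons)
    \<comment> \<open>Nine vertices again: the bad path comes in at \<open>q3\<close> or
      \<open>q6\<close>, passes through \<open>w1\<close> and \<open>w2\<close> to the other of the
      two, and goes out over \<open>q4\<close> and \<open>q5\<close>.\<close>
    have "path [z3, z2, z1, q3, w1, w2, q6, q5, q4]" if "a = q3"
      using that ez out pz(2) dist inV' es' unfolding S_def by (auto simp: path_Cons)
    moreover have "path [z3, z2, z1, q6, w1, w2, q3, q4, q5]" if "a = q6"
      using that ez out pz(2) dist inV' es' unfolding S_def by (auto simp: path_Cons)
    ultimately show False using max z(1) by fastforce
  qed
  moreover have "card {q3, q6} \<le> 2" using dist by simp
  ultimately show ?thesis using inV' unfolding S_def by (intro exI[of _ "{q3, q6}"]) auto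
qed

end

section \<open>The remaining case, refuted by counting\<close>

locale starless_graph = poor_path_free_graph +
  assumes t4: "4 \<le> t" and nostar: "\<epsilon> = 1 \<Longrightarrow> A \<subseteq> V \<Longrightarrow> card A \<le> t - 1 \<Longrightarrow> \<not> star_cond (V - A)"
begin

lemma longest_in_deg:
  assumes Q: "longest Q" and S: "S \<subseteq> V - set Q" and xs: "longest_in S xs"
    and d: "\<And>x. x \<in> S \<Longrightarrow> d \<le> deg (set Q \<union> S) x"
  shows "d \<le> card (pos Q (hd xs)) + deg (set xs) (hd xs)" "d + 1 \<le> card (pos Q (hd xs)) + length xs"
    "d + 1 \<le> card (pos Q (last xs)) + length xs"
proof -
  have *: "d \<le> card (pos Q (hd ys)) + deg (set ys) (hd ys) \<and> d + 1 \<le> card (pos Q (hd ys)) + length ys"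
    if ys: "longest_in S ys" for ys
  proof -
    have "hd ys \<in> S" "ys \<noteq> []" using ys unfolding longest_in_def by auto
    then have "d \<le> card (pos Q (hd ys)) + deg S (hd ys)" "0 < length ys" using d deg_outside[OF Q S] by force+
    then show ?thesis using longest_in_hd(2,3)[OF ys] by linarith
  qed
  have "hd (rev xs) = last xs" using xs unfolding longest_in_def by (simp add: hd_rev)
  then show "d \<le> card (pos Q (hd xs)) + deg (set xs) (hd xs)" "d + 1 \<le> card (pos Q (hd xs)) + length xs"
    "d + 1 \<le> card (pos Q (last xs)) + length xs"
    using *[OF xs] *[OF longest_in_rev[OF xs]] by auto
qed

lemma pos_insert0: "card (insert 0 (pos Q w)) = Suc (card (pos Q w))"
  using finite_pos pos_le by (subst card_insert_disjoint) fastforce+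

lemma union_pos_card:
  assumes "pos Q v \<noteq> pos Q w" "r \<le> card (pos Q v)" "r \<le> card (pos Q w)"
  shows "r + 2 \<le> card (insert 0 (pos Q v \<union> pos Q w))"
proof -
  have "r + 1 \<le> card (pos Q v \<union> pos Q w)"
  proof (rule ccontr)
    assume "\<not> ?thesis"
    then have c: "card (pos Q v \<union> pos Q w) \<le> card (pos Q v)" "card (pos Q v \<union> pos Q w) \<le> card (pos Q w)"
      using assms by auto
    have "pos Q v = pos Q v \<union> pos Q w"
      by (rule card_subset_eq) (use c finite_pos card_mono[of "pos Q v \<union> pos Q w" "pos Q v"] in auto)
    moreover have "pos Q w = pos Q v \<union> pos Q w"
      by (rule card_subset_eq) (use c finite_pos card_mono[of "pos Q v \<union> pos Q w" "pos Q w"] in auto)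
    ultimately show False using assms(1) by simp
  qed
  moreover have "0 \<notin> pos Q v \<union> pos Q w" using pos_le by fastforce
  ultimately show ?thesis using finite_pos by simp
qed

text \<open>Ends with different neighbourhoods make the gaps too large for \<open>Q\<close>. Equal
  neighbourhoods leave one common neighbour and \<open>t - 1\<close> vertices, up to the exceptional
  configuration. Without any neighbour there would be a path on at least \<open>t\<close> vertices
  hanging on \<open>Q\<close>, for which \<open>arms\<close> leaves no position.\<close>

lemma outside_min_degree_t1:
  assumes Q: "longest Q" and S: "S \<subseteq> V - set Q" and d: "\<And>x. x \<in> S \<Longrightarrow> t - 1 \<le> deg (set Q \<union> S) x"
    and xs: "longest_in S xs"
  shows "\<exists>c. pos Q (hd xs) = {c} \<and> pos Q (last xs) = {c} \<and> length xs + 1 = t \<and> length xs - 1 \<le> deg (set xs) (hd xs)"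
proof -
  let ?L = "length Q" and ?m = "length xs" and ?N1 = "pos Q (hd xs)" and ?N2 = "pos Q (last xs)"
  have p: "path xs" "xs \<noteq> []" "set xs \<inter> set Q = {}" using xs S unfolding longest_in_def by auto
  have L: "?L \<le> 2 * t" using longest_length[OF Q] eps t by linarith
  note dg = longest_in_deg[OF Q S xs d]
  have d1: "t \<le> card ?N1 + ?m" "t \<le> card ?N2 + ?m" using dg(2,3) t by linarith+
  have "hd xs \<in> V - set Q" using p S xs unfolding longest_in_def by (meson hd_in_set subsetD)
  then have m: "2 \<le> ?m" using poor[OF Q, of "hd xs"] d1 t3 by linarith
  let ?U = "insert 0 (?N1 \<union> ?N2)"
  obtain M a b where g: "a + M \<le> card ?U" "b \<le> M" "3 * card ?U + (?m - 1) * M \<le> Suc ?L + a + b"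
    "?N1 = ?N2 \<longrightarrow> M = card ?U" "2 \<le> card ?U \<longrightarrow> 2 \<le> M"
    "?N1 \<noteq> ?N2 \<longrightarrow> ?N1 \<noteq> {} \<longrightarrow> ?N2 \<noteq> {} \<longrightarrow> 3 \<le> M"
    "\<forall>D'. (\<forall>Q'. longest Q' \<longrightarrow> D' \<subseteq> set Q') \<longrightarrow> card D' + a + ?m * b \<le> ?L"
    using gap_count[OF Q p] by (elim exE conjE) (rule that)
  have mM: "(?m - 1) * M + M = ?m * M" using m by (cases ?m) auto
  have g': "2 * card ?U + (?m - 1) * M \<le> Suc ?L" using g(1-3) by linarith
  have eq: "?N1 = ?N2"
  proof (rule ccontr)
    assume ne: "?N1 \<noteq> ?N2"
    have u: "t - ?m + 2 \<le> card ?U" by (rule union_pos_card[OF ne]) (use d1 in linarith)+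
    then have "2 \<le> M" using g(5) by linarith
    then have "(?m - 1) * 2 \<le> (?m - 1) * M" by (rule mult_le_mono2)
    then show False using g' u L m by linarith
  qed
  define u where "u = card ?U"
  have u: "u = Suc (card ?N1)" using pos_insert0 eq unfolding u_def by simp
  have gm: "(?m + 1) * u \<le> Suc ?L"
  proof -
    have "M = u" using g(4) eq unfolding u_def by simp
    then show ?thesis using g' m unfolding u_def by (cases ?m) auto
  qed
  show ?thesis
  proof (cases "?N1 = {}")
    case True
    then have "t - 1 \<le> deg (set xs) (hd xs)" using dg(1) by simp
    moreover obtain ys c where "path ys" "ys \<noteq> []" "set ys \<inter> set Q = {}" "deg (set xs) (hd xs) < length ys" "c \<in> pos Q (hd ys)"
      using attached_path[OF longest_path[OF Q] longest_ne[OF Q] p] by blast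
    ultimately show ?thesis using arms[OF Q, of ys c] L t by linarith
  next
    case False
    then have "2 \<le> u" using u finite_pos by (simp add: card_gt_0_iff Suc_le_eq)
    from equal_ends_arith[OF m this gm _ _, of t] have
      c: "u = 2 \<and> ?m + 1 = t \<or> u = 3 \<and> ?m = 2 \<and> t = 4 \<and> Suc ?L = 9" using L d1 u by auto
    then show ?thesis
    proof
      assume c: "u = 2 \<and> ?m + 1 = t"
      then have "card ?N1 = 1" using u by simp
      then obtain c where "?N1 = {c}" by (meson card_1_singletonE)
      then show ?thesis using eq c dg(1) by auto
    next
      assume c: "u = 3 \<and> ?m = 2 \<and> t = 4 \<and> Suc ?L = 9"
      then obtain w1 w2 where w: "xs = [w1, w2]" by (auto simp: length_Suc_conv eval_nat_numeral)
      have "card ?N1 = 2" using c u by simp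
      then obtain c1 c2 where cc: "?N1 = {c1, c2}" "c1 < c2"
        by (metis card_2_iff doubleton_eq_iff linorder_neqE_nat)
      have N: "pos Q w1 = {c1, c2}" "pos Q w2 = {c1, c2}" using cc eq w by auto
      have "3 \<le> c1" "c1 + 3 \<le> c2" "c2 + 2 \<le> ?L"
        using splice_gap[OF Q p(2,1,3), of 0 c1] splice_gap[OF Q p(2,1,3), of c1 c2]
          splice_gap[OF Q p(2,1,3), of c2 "Suc ?L"] N w cc pos_le[of c1 Q w1] pos_le[of c2 Q w1] by auto
      then have "c1 = 3" "c2 = 6" using c by auto
      then obtain A where "A \<subseteq> V" "card A \<le> 2" "star_cond (V - A)"
        using star_cond_of_double_attachment[OF Q _ _ _, of w1 w2] N p c unfolding w by auto
      \<comment> \<open>The exception has \<open>t = 4\<close> and \<open>length Q = 2 * t\<close>,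
        which requires \<epsilon> = 1. This is why \<open>nostar\<close> speaks of that value
        only.\<close>
      moreover have "\<epsilon> = 1" using c longest_length[OF Q] eps by auto
      ultimately show ?thesis using nostar[of A] c by auto
    qed
  qed
qed

lemma card_edges_extend_by_clique:
  assumes Q: "longest Q" and S: "S \<subseteq> V - set Q" and K: "K \<subseteq> S"
    and c: "\<And>x. x \<in> K \<Longrightarrow> pos Q x = {c} \<and> S \<inter> {y. E x y} \<subseteq> K"
  shows "2 * card (edges (set Q \<union> S)) \<le> 2 * card (edges (set Q \<union> (S - K))) + 2 * card K + card K * (card K - 1)"
proof -
  have e: "set Q \<union> S - K = set Q \<union> (S - K)" using S K by blast
  have "2 * card (edges (set Q \<union> S)) \<le> 2 * card (edges (set Q \<union> S - K)) + 2 * card K + card K * (card K - 1)"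
  proof (rule card_edges_remove_set)
    show "finite (set Q \<union> S)" using S fin finite_subset by auto
    fix x assume x: "x \<in> K"
    have "(set Q \<union> S - K) \<inter> {y. E x y} \<subseteq> set Q \<inter> {y. E x y}" using c[OF x] by blast
    then have "deg (set Q \<union> S - K) x \<le> card (set Q \<inter> {y. E x y})" unfolding deg_def by (intro card_mono) auto
    also have "\<dots> = 1" using card_pos[OF longest_path[OF Q], of x] c[OF x] by simp
    finally show "deg (set Q \<union> S - K) x \<le> 1" .
  qed (use K in blast)
  then show ?thesis unfolding e .
qed

text \<open>Peel off a vertex of degree at most \<open>t - 2\<close>, or, if there is none, a
  component of \<open>S\<close> on \<open>t - 1\<close> vertices that sees only one vertex of
  \<open>Q\<close>. The latter costs at most \<open>t * (t - 1) / 2\<close> edges, which is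
  affordable because of \<open>4 \<le> t\<close>.\<close>

lemma outer_edges:
  assumes Q: "longest Q" and S: "S \<subseteq> V - set Q"
  shows "card (edges (set Q \<union> S)) \<le> card (edges (set Q)) + (t - 2) * card S"
  using S
proof (induction "card S" arbitrary: S rule: less_induct)
  case less
  have fS: "finite S" using less.prems fin finite_subset by auto
  have fQS: "finite (set Q \<union> S)" using fS by simp
  show ?case
  proof (cases "S = {}")
    case False
    show ?thesis
    proof (cases "\<exists>x\<in>S. deg (set Q \<union> S) x \<le> t - 2")
      case True
      then obtain x where x: "x \<in> S" "deg (set Q \<union> S) x \<le> t - 2" by blast
      have e: "set Q \<union> S - {x} = set Q \<union> (S - {x})" using x less.prems by blast
      have cS: "card S = Suc (card (S - {x}))" using x fS by (metis card_Suc_Diff1)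
      have "card (edges (set Q \<union> (S - {x}))) \<le> card (edges (set Q)) + (t - 2) * card (S - {x})"
        by (rule less.hyps) (use cS less.prems in \<open>linarith, blast\<close>)
      moreover have "card (edges (set Q \<union> S)) = card (edges (set Q \<union> (S - {x}))) + deg (set Q \<union> S) x"
        using card_edges_remove[OF fQS, of x] x(1) unfolding e by blast
      moreover have "(t - 2) * card S = (t - 2) + (t - 2) * card (S - {x})"
        unfolding cS by (rule mult_Suc_right)
      ultimately show ?thesis using x(2) by linarith
    next
      case n: False
      have d: "t - 1 \<le> deg (set Q \<union> S) x" if "x \<in> S" for x
      proof -
        have "\<not> deg (set Q \<union> S) x \<le> t - 2" using n that by blast
        then show ?thesis by linarith
      qed
      obtain xs where xs: "longest_in S xs" using ex_longest_in[of S] less.prems False by blast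
      obtain c where c: "\<forall>x\<in>set xs. pos Q x = {c} \<and> S \<inter> {y. E x y} \<subseteq> set xs"
        using closed_clique[OF xs, of Q] outside_min_degree_t1[OF Q less.prems d] by blast
      have xp: "set xs \<subseteq> S" "distinct xs" "xs \<noteq> []" using xs path_distinct unfolding longest_in_def by auto
      have cK: "card (set xs) + 1 = t" using outside_min_degree_t1[OF Q less.prems d xs] distinct_card[OF xp(2)] by auto
      have cS: "card S = card (S - set xs) + card (set xs)"
        using xp fS by (metis List.finite_set card_Diff_subset card_mono le_add_diff_inverse2)
      have IH: "card (edges (set Q \<union> (S - set xs))) \<le> card (edges (set Q)) + (t - 2) * card (S - set xs)"
        by (rule less.hyps) (use cS cK t less.prems in \<open>linarith, blast\<close>)
      have arith: "2 * a' \<le> 2 * (e' + s' + r')"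
        if "2 * a' \<le> 2 * b' + p' + q'" "p' + q' \<le> 2 * r'" "b' \<le> e' + s'" for a' b' e' p' q' r' s' :: nat
        using that by simp
      have "2 * card (edges (set Q \<union> S)) \<le> 2 * card (edges (set Q \<union> (S - set xs))) + 2 * card (set xs) + card (set xs) * (card (set xs) - 1)"
        by (rule card_edges_extend_by_clique[OF Q less.prems xp(1)]) (use c in auto)
      moreover have "2 * card (set xs) + card (set xs) * (card (set xs) - 1) \<le> 2 * ((t - 2) * card (set xs))"
      proof -
        obtain j where "t = j + 4" using t4 by (metis add.commute le_Suc_ex)
        then show ?thesis using cK by (auto simp: algebra_simps)
      qed
      ultimately have "2 * card (edges (set Q \<union> S)) \<le> 2 * (card (edges (set Q)) + (t - 2) * card (S - set xs) + (t - 2) * card (set xs))"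
        using IH by (rule arith)
      then show ?thesis unfolding cS by (simp add: algebra_simps)
    qed
  qed simp
qed

text \<open>Otherwise a path on \<open>t - 1\<close> vertices hangs on \<open>Q\<close>, necessarily
  near its middle. Then no edge passes across that position, so \<open>Q\<close> spans no more than
  two cliques sharing a vertex, and with \<open>outer_edges\<close> this is too little for a dense
  graph.\<close>

lemma low_deg_outside:
  assumes Q: "longest Q" and S: "S \<subseteq> V - set Q" "S \<noteq> {}"
  shows "\<exists>x\<in>S. deg (set Q \<union> S) x \<le> t - 2"
proof (rule ccontr)
  assume n: "\<not> ?thesis"
  let ?L = "length Q"
  have d: "t - 1 \<le> deg (set Q \<union> S) x" if "x \<in> S" for x
  proof -
    have "\<not> deg (set Q \<union> S) x \<le> t - 2" using n that by blast
    then show ?thesis by linarith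
  qed
  obtain xs where xs: "longest_in S xs" using ex_longest_in[of S] S by blast
  obtain c where c: "pos Q (hd xs) = {c}" "length xs + 1 = t" using outside_min_degree_t1[OF Q S(1) d xs] by blast
  have p: "path xs" "xs \<noteq> []" "set xs \<inter> set Q = {}" using xs S unfolding longest_in_def by auto
  have pQ: "path Q" by (rule longest_path[OF Q])
  have L: "?L \<le> 2 * t - 1 + \<epsilon>" by (rule longest_length[OF Q])
  have ar: "t \<le> c" "c + t \<le> Suc ?L" using arms[OF Q p(1-3), of c] c by auto
  have "2 * card (edges (set Q)) \<le> c * (c - 1) + (Suc ?L - c) * (?L - c)"
  proof (rule card_edges_separated[OF pQ])
    show "1 \<le> c" "c \<le> ?L" using ar t by linarith+
    show "\<not> E (Q ! (i - 1)) (Q ! (j - 1))" if "1 \<le> i" "i < c" "c < j" "j \<le> ?L" for i j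
      using no_edges_across[OF Q p, of c i j] that c L eps by auto
  qed
  then have eQ: "2 * int (card (edges (set Q))) \<le> int (c * (c - 1) + (Suc ?L - c) * (?L - c))" by linarith
  have LV: "?L \<le> card V" by (rule path_length[OF pQ])
  have "card (edges (set Q \<union> (V - set Q))) \<le> card (edges (set Q)) + (t - 2) * card (V - set Q)"
    by (rule outer_edges[OF Q]) simp
  moreover have "set Q \<union> (V - set Q) = V" using path_subset[OF pQ] by blast
  moreover have "card (V - set Q) = card V - ?L"
    using path_subset[OF pQ] fin distinct_card[OF path_distinct[OF pQ]] by (simp add: card_Diff_subset)
  ultimately have "card (edges V) \<le> card (edges (set Q)) + (t - 2) * (card V - ?L)" by (simp only:)
  then have "int (card (edges V)) \<le> int (card (edges (set Q)) + (t - 2) * (card V - ?L))" by (simp only: of_nat_le_iff)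
  also have "\<dots> = int (card (edges (set Q))) + (int t - 2) * (int (card V) - int ?L)"
    using t LV by (simp add: of_nat_diff)
  finally have eV: "2 * int (card (edges V)) \<le> int (c * (c - 1) + (Suc ?L - c) * (?L - c)) + 2 * ((int t - 2) * (int (card V) - int ?L))"
    using eQ by linarith
  have t1: "int (t - 1) = int t - 1" using t by simp
  have "c = t \<and> ?L + 1 = 2 * t \<or> c = t \<and> ?L = 2 * t \<and> \<epsilon> = 1 \<or> c = t + 1 \<and> ?L = 2 * t \<and> \<epsilon> = 1"
    using ar L eps t by linarith
  then have "int (c * (c - 1) + (Suc ?L - c) * (?L - c)) + 2 * ((int t - 2) * (int (card V) - int ?L)) \<le> bound2 (card V)"
  proof (elim disjE)
    assume a: "c = t \<and> ?L + 1 = 2 * t"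
    then have e: "c = t" "Suc ?L - t = t" "?L - t = t - 1" "int ?L = 2 * int t - 1" by auto
    have X: "int (t * (t - 1) + t * (t - 1)) = 2 * int t * (int t - 1)" unfolding of_nat_add of_nat_mult t1 by (simp add: algebra_simps)
    have "0 \<le> (int t - 2) * (int t - 3)" using t4 by simp
    then show ?thesis unfolding e X bound2_def by (simp add: algebra_simps)
  next
    assume a: "c = t \<and> ?L = 2 * t \<and> \<epsilon> = 1"
    then have e: "c = t" "Suc ?L - t = t + 1" "?L - t = t" "int ?L = 2 * int t" "int \<epsilon> = 1" by auto
    have X: "int (t * (t - 1) + (t + 1) * t) = 2 * int t * int t" unfolding of_nat_add of_nat_mult t1 by (simp add: algebra_simps)
    have "0 \<le> (int t - 2) * (int t - 3)" using t4 by simp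
    then show ?thesis unfolding e X bound2_def by (simp add: algebra_simps)
  next
    assume a: "c = t + 1 \<and> ?L = 2 * t \<and> \<epsilon> = 1"
    then have e: "c = t + 1" "Suc ?L - (t + 1) = t" "?L - (t + 1) = t - 1" "t + 1 - 1 = t" "int ?L = 2 * int t" "int \<epsilon> = 1" by auto
    have X: "int ((t + 1) * t + t * (t - 1)) = 2 * int t * int t" unfolding of_nat_add of_nat_mult t1 by (simp add: algebra_simps)
    have "0 \<le> (int t - 2) * (int t - 3)" using t4 by simp
    then show ?thesis unfolding e X bound2_def by (simp add: algebra_simps)
  qed
  then show False using eV dense by linarith
qed

section \<open>The \<open>(t - 1)\<close>-core and the second round of gap counting\<close>

abbreviation "D \<equiv> core (t - 1)"

text \<open>The part of the core off \<open>Q\<close> would contradict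
  \<open>low_deg_outside\<close>.\<close>

lemma core_in_longest: "longest Q \<Longrightarrow> D \<subseteq> set Q"
proof (rule ccontr)
  assume Q: "longest Q" and n: "\<not> D \<subseteq> set Q"
  let ?S = "D - set Q"
  have S: "?S \<subseteq> V - set Q" "?S \<noteq> {}" using n core_subset by auto
  obtain x where x: "x \<in> ?S" "deg (set Q \<union> ?S) x \<le> t - 2" using low_deg_outside[OF Q S] by blast
  have "set Q \<union> ?S \<subseteq> V" using path_subset[OF longest_path[OF Q]] core_subset by blast
  then have "deg D x \<le> deg (set Q \<union> ?S) x" by (intro deg_mono) blast+
  then have "deg D x \<le> t - 2" using x(2) by linarith
  moreover have "t - 1 \<le> deg D x" using core_deg x(1) by blast
  ultimately show False using t by linarith
qed

text \<open>Compared with the slope \<open>t - 2\<close> of the bound, a core vertex gains at most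
  one edge by \<open>card_edges_sharp\<close>, and all other vertices gain none. To exceed the
  bound, more than \<open>t + 2 + 2 * \<epsilon>\<close> core vertices are needed.\<close>

lemma core_large: "t + 3 + 2 * \<epsilon> \<le> card D"
proof -
  have fD: "finite D" using core_subset fin finite_subset by blast
  have "card (edges V) \<le> card (edges D) + (t - 2) * card (V - D)"
  proof (rule card_edges_degenerate[OF fin core_subset])
    fix S' assume "D \<subset> S'" "S' \<subseteq> V"
    moreover have "Suc (t - 2) = t - 1" using t by simp
    ultimately show "\<exists>x\<in>S' - D. deg S' x \<le> t - 2"
      using ex_low_deg_outside_core[of "t - 2" S'] by simp
  qed
  then have "int (card (edges V)) \<le> int (card (edges D) + (t - 2) * card (V - D))" by (simp only: of_nat_le_iff)
  also have "\<dots> = int (card (edges D)) + (int t - 2) * (int (card V) - int (card D))"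
    using t fD core_subset card_mono[OF fin core_subset] by (simp add: of_nat_diff card_Diff_subset)
  finally have eV: "2 * int (card (edges V)) \<le> 2 * int (card (edges D)) + 2 * ((int t - 2) * (int (card V) - int (card D)))" by linarith
  show ?thesis
  proof (cases "D = {}")
    case True
    have "2 * card (edges V) + (t - 2) * (t - 2 + 1) \<le> 2 * (t - 2) * card V + 2 * 0"
    proof (rule card_edges_degenerate_sharp[OF fin])
      show "t - 2 \<le> card V" using large t by linarith
      fix S' assume S': "S' \<subseteq> V" "t - 2 + 1 + 0 < card S'"
      then have "S' \<noteq> {}" by auto
      moreover have "Suc (t - 2) = t - 1" using t by linarith
      ultimately have "core (Suc (t - 2)) \<subset> S'" using True by auto
      then show "\<exists>x\<in>S'. deg S' x \<le> t - 2" using ex_low_deg_outside_core[of "t - 2" S'] S' by blast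
    qed simp
    then have "int (2 * card (edges V) + (t - 2) * (t - 2 + 1)) \<le> int (2 * (t - 2) * card V + 2 * 0)" by (simp only: of_nat_le_iff)
    moreover have t2: "int (t - 2) = int t - 2" using t by simp
    ultimately have "2 * int (card (edges V)) + (int t - 2) * (int t - 1) \<le> 2 * (int t - 2) * int (card V)"
      unfolding of_nat_add of_nat_mult t2 by (simp add: algebra_simps)
    then have False using dense unfolding bound2_def by (simp add: algebra_simps)
    then show ?thesis ..
  next
    case False
    then obtain x where x: "x \<in> D" by blast
    have "t - 1 \<le> card D - 1" using core_deg[OF x] deg_le[OF fD x] by linarith
    then have cD: "t - 1 \<le> card D" by linarith
    from card_edges_sharp[OF t3 core_subset this]
    have "int (2 * card (edges D) + (t - 1) * t) \<le> int (2 * (t - 1) * card D + 2 * \<epsilon>)" by (simp only: of_nat_le_iff)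
    then have "2 * int (card (edges D)) + (int t - 1) * int t \<le> 2 * (int t - 1) * int (card D) + 2 * int \<epsilon>"
      using t by (simp add: of_nat_diff)
    then have "int t + 2 + 2 * int \<epsilon> < int (card D)" using eV dense unfolding bound2_def by (simp add: algebra_simps)
    then show ?thesis by linarith
  qed
qed

lemma core_arith:
  assumes "longest Q"
  shows "length Q \<le> 2 * t" "2 * length Q + 5 \<le> card D + 3 * t" "t + 3 \<le> card D"
  using longest_length[OF assms] core_large eps t by linarith+

text \<open>The argument of \<open>outside_min_degree_t1\<close> with one neighbour less. What is
  missing comes from the last clause of \<open>gap_count\<close>, applied to the core.\<close>

lemma outside_min_degree_t2:
  assumes Q: "longest Q" and S: "S \<subseteq> V - set Q" and d: "\<And>x. x \<in> S \<Longrightarrow> t - 2 \<le> deg (set Q \<union> S) x"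
    and xs: "longest_in S xs"
  shows "\<exists>c. pos Q (hd xs) = {c} \<and> pos Q (last xs) = {c} \<and> length xs + 2 = t \<and> length xs - 1 \<le> deg (set xs) (hd xs)"
proof -
  let ?L = "length Q" and ?m = "length xs" and ?N1 = "pos Q (hd xs)" and ?N2 = "pos Q (last xs)"
  have p: "path xs" "xs \<noteq> []" "set xs \<inter> set Q = {}" using xs S unfolding longest_in_def by auto
  have pQ: "path Q" by (rule longest_path[OF Q])
  note ca = core_arith[OF Q]
  note dg = longest_in_deg[OF Q S xs d]
  have d1: "t \<le> card ?N1 + ?m + 1" "t \<le> card ?N2 + ?m + 1" using dg(2,3) t by linarith+
  let ?U = "insert 0 (?N1 \<union> ?N2)"
  obtain M a b where g: "a + M \<le> card ?U" "b \<le> M" "3 * card ?U + (?m - 1) * M \<le> Suc ?L + a + b"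
    "?N1 = ?N2 \<longrightarrow> M = card ?U" "2 \<le> card ?U \<longrightarrow> 2 \<le> M"
    "?N1 \<noteq> ?N2 \<longrightarrow> ?N1 \<noteq> {} \<longrightarrow> ?N2 \<noteq> {} \<longrightarrow> 3 \<le> M"
    "\<forall>D'. (\<forall>Q'. longest Q' \<longrightarrow> D' \<subseteq> set Q') \<longrightarrow> card D' + a + ?m * b \<le> ?L"
    using gap_count[OF Q p] by (elim exE conjE) (rule that)
  have g7: "card D + a + ?m * b \<le> ?L" using g(7) core_in_longest by blast
  \<comment> \<open>A single vertex would have at least \<open>t - 2\<close> neighbours and hence
    \<open>t - 1\<close> gaps, all mixed. The gap inequality and the exchange inequality add up to
    \<open>3 * (t - 1) + card D \<le> 2 * length Q + 1\<close>, but by \<open>core_arith\<close> the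
    left side is at least \<open>2 * length Q + 2\<close>.\<close>
  have m: "2 \<le> ?m"
  proof (rule ccontr)
    assume "\<not> 2 \<le> ?m"
    then obtain w where w: "xs = [w]" using p(2) by (cases xs; cases "tl xs") auto
    then have "card ?U = Suc (card ?N1)" "M = card ?U" using pos_insert0 g(4) by auto
    then show False using g(1,3) g7 d1 ca unfolding w by simp
  qed
  have eq: "?N1 = ?N2"
  proof (rule ccontr)
    assume ne: "?N1 \<noteq> ?N2"
    have u: "t - (?m + 1) + 2 \<le> card ?U" by (rule union_pos_card[OF ne]) (use d1 in linarith)+
    have "t \<le> ?m + 1 \<or> 3 \<le> M"
    proof (cases "?N1 = {} \<or> ?N2 = {}")
      case True
      then show ?thesis using d1 by auto
    next
      case False
      then show ?thesis using g(6) ne by blast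
    qed
    moreover have "t + 1 \<le> card ?U + ?m" "2 \<le> card ?U" "2 \<le> M"
      "3 * card ?U + (?m - 1) * M \<le> ?L + 1 + a + b" using u g(3,5) by linarith+
    ultimately show False using unequal_ends_tight_arith[OF m _ _ g(1,2) ca(1) _ g7 ca(2,3)] by blast
  qed
  define u where "u = card ?U"
  have u: "u = Suc (card ?N1)" using pos_insert0 eq unfolding u_def by simp
  show ?thesis
  proof (cases "?N1 = {}")
    case True
    then have "t - 2 \<le> deg (set xs) (hd xs)" using dg(1) by simp
    moreover obtain ys c where y: "path ys" "ys \<noteq> []" "set ys \<inter> set Q = {}" "deg (set xs) (hd xs) < length ys" "c \<in> pos Q (hd ys)"
      using attached_path[OF pQ longest_ne[OF Q] p] by blast
    moreover note ar = arms[OF Q y(1,2,3,5)]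
    ultimately have ly: "length ys + 1 = t" "t \<le> c" "c + t \<le> Suc ?L" using ca(1) t by linarith+
    \<comment> \<open>The hanging path has \<open>t - 1\<close> vertices and can replace an equally
      long end of \<open>Q\<close>. The core lies on both paths, hence among the at most
      \<open>t + 1\<close> remaining vertices of \<open>Q\<close>.\<close>
    have "c = t \<or> Suc ?L = c + t" using ly ca(1) by linarith
    then have "card D \<le> t + 1"
    proof
      assume c: "c = t"
      have "path (take 0 Q @ rev ys @ drop (c - 1) Q)"
        by (rule splice_path[OF pQ]) (use y ly t in \<open>auto simp: last_rev\<close>)
      then have "longest (rev ys @ drop (c - 1) Q)"
        using longest_eq[OF Q, of "rev ys @ drop (c - 1) Q"] ly c by simp
      then have "D \<subseteq> set (rev ys @ drop (c - 1) Q)" "D \<subseteq> set Q" using core_in_longest Q by blast+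
      then have "D \<subseteq> set (drop (c - 1) Q)" using y(3) by auto
      then have "card D \<le> card (set (drop (c - 1) Q))" by (intro card_mono) auto
      also have "\<dots> \<le> length (drop (c - 1) Q)" by (rule card_length)
      finally show ?thesis using c ca(1) by simp
    next
      assume c: "Suc ?L = c + t"
      have "path (take c Q @ ys @ drop (Suc ?L - 1) Q)"
        by (rule splice_path[OF pQ]) (use y ly t in auto)
      then have "longest (take c Q @ ys)" using longest_eq[OF Q, of "take c Q @ ys"] ly c t by simp
      then have "D \<subseteq> set (take c Q @ ys)" "D \<subseteq> set Q" using core_in_longest Q by blast+
      then have "D \<subseteq> set (take c Q)" using y(3) by auto
      then have "card D \<le> card (set (take c Q))" by (intro card_mono) auto
      also have "\<dots> \<le> length (take c Q)" by (rule card_length)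
      finally show ?thesis using c ca(1) by simp
    qed
    then show ?thesis using ca(3) by simp
  next
    case False
    then have u2: "2 \<le> u" using u finite_pos by (simp add: card_gt_0_iff Suc_le_eq)
    have Mu: "M = u" using g(4) eq unfolding u_def by simp
    then have "a = 0" using g(1) unfolding u_def by simp
    then have "(?m + 2) * u \<le> ?L + 1 + b" using g(3) Mu m unfolding u_def[symmetric] by (cases ?m) auto
    moreover have "card D + ?m * b \<le> ?L" using g7 \<open>a = 0\<close> by simp
    ultimately have r: "u = 2 \<and> ?m + 2 = t"
      using equal_ends_tight_arith[OF m u2 _ ca(1) _ _ ca(2,3)] d1 u by simp
    then have "card ?N1 = 1" using u by simp
    then obtain c where "?N1 = {c}" by (meson card_1_singletonE)
    then show ?thesis using eq r dg(1) by auto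
  qed
qed

text \<open>A vertex of degree at most \<open>t - 3\<close> saves one edge. If there is none, a
  component on \<open>t - 2\<close> vertices that sees one vertex of \<open>Q\<close> saves
  \<open>t - 3\<close> at once, and \<open>outer_edges\<close> suffices for the rest.\<close>

lemma outer_edges_sharp:
  assumes Q: "longest Q" and S: "S \<subseteq> V - set Q"
  shows "2 * card (edges (set Q \<union> S)) + 2 * min (card S) (t - 3) \<le> 2 * card (edges (set Q)) + 2 * ((t - 2) * card S)"
  using S
proof (induction "card S" arbitrary: S rule: less_induct)
  case less
  have fS: "finite S" using less.prems fin finite_subset by auto
  have fQS: "finite (set Q \<union> S)" using fS by simp
  show ?case
  proof (cases "S = {}")
    case False
    show ?thesis
    proof (cases "\<exists>x\<in>S. deg (set Q \<union> S) x \<le> t - 3")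
      case True
      then obtain x where x: "x \<in> S" "deg (set Q \<union> S) x \<le> t - 3" by blast
      have e: "set Q \<union> S - {x} = set Q \<union> (S - {x})" using x less.prems by blast
      have cS: "card S = Suc (card (S - {x}))" using x fS by (metis card_Suc_Diff1)
      have "2 * card (edges (set Q \<union> (S - {x}))) + 2 * min (card (S - {x})) (t - 3)
          \<le> 2 * card (edges (set Q)) + 2 * ((t - 2) * card (S - {x}))"
        by (rule less.hyps) (use cS less.prems in \<open>linarith, blast\<close>)
      moreover have "card (edges (set Q \<union> S)) = card (edges (set Q \<union> (S - {x}))) + deg (set Q \<union> S) x"
        using card_edges_remove[OF fQS, of x] x(1) unfolding e by blast
      moreover have "(t - 2) * card S = (t - 2) + (t - 2) * card (S - {x})"
        unfolding cS by (rule mult_Suc_right)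
      moreover have "t - 2 = t - 3 + 1" using t4 by linarith
      moreover have "min (card S) (t - 3) \<le> min (card (S - {x})) (t - 3) + 1" using cS by linarith
      ultimately show ?thesis using x(2) by linarith
    next
      case n: False
      have d: "t - 2 \<le> deg (set Q \<union> S) x" if "x \<in> S" for x
      proof -
        have "\<not> deg (set Q \<union> S) x \<le> t - 3" using n that by blast
        then show ?thesis by linarith
      qed
      obtain xs where xs: "longest_in S xs" using ex_longest_in[of S] less.prems False by blast
      obtain c where c: "\<forall>x\<in>set xs. pos Q x = {c} \<and> S \<inter> {y. E x y} \<subseteq> set xs"
        using closed_clique[OF xs, of Q] outside_min_degree_t2[OF Q less.prems d] by blast
      have xp: "set xs \<subseteq> S" "distinct xs" "xs \<noteq> []" using xs path_distinct unfolding longest_in_def by auto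
      have cK: "card (set xs) + 2 = t" using outside_min_degree_t2[OF Q less.prems d xs] distinct_card[OF xp(2)] by auto
      have cS: "card S = card (S - set xs) + card (set xs)"
        using xp fS by (metis List.finite_set card_Diff_subset card_mono le_add_diff_inverse2)
      have IH: "card (edges (set Q \<union> (S - set xs))) \<le> card (edges (set Q)) + (t - 2) * card (S - set xs)"
        using outer_edges[OF Q, of "S - set xs"] less.prems by blast
      have arith2: "2 * a' + 2 * v \<le> 2 * e' + 2 * (s' + r')"
        if "2 * a' \<le> 2 * b' + p' + q'" "p' + q' + 2 * w \<le> 2 * r'" "v \<le> w" "b' \<le> e' + s'" for a' b' e' p' q' r' s' v w :: nat
        using that by simp
      have "2 * card (edges (set Q \<union> S)) \<le> 2 * card (edges (set Q \<union> (S - set xs))) + 2 * card (set xs) + card (set xs) * (card (set xs) - 1)"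
        by (rule card_edges_extend_by_clique[OF Q less.prems xp(1)]) (use c in auto)
      moreover have "2 * card (set xs) + card (set xs) * (card (set xs) - 1) + 2 * (t - 3) \<le> 2 * ((t - 2) * card (set xs))"
      proof -
        obtain j where j: "t = j + 4" using t4 by (metis add.commute le_Suc_ex)
        then have "card (set xs) = j + 2" using cK by simp
        then show ?thesis unfolding j by (simp add: algebra_simps)
      qed
      moreover have "min (card S) (t - 3) \<le> t - 3" by simp
      ultimately have "2 * card (edges (set Q \<union> S)) + 2 * min (card S) (t - 3)
          \<le> 2 * card (edges (set Q)) + 2 * ((t - 2) * card (S - set xs) + (t - 2) * card (set xs))"
        using IH by (rule arith2)
      then show ?thesis unfolding cS by (simp add: algebra_simps)
    qed
  qed simp
qed

text \<open>The sharp bound inside \<open>Q\<close>, the saving of \<open>t - 3\<close> outside and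
  \<open>length Q \<le> 2 * t - 1 + \<epsilon>\<close> add up to
  \<open>bound2 (card V) - 2 * int \<epsilon>\<close> as a bound on twice the number of edges; for
  \<epsilon> = 0 nothing is to spare.\<close>

lemma starless_False: False
proof -
  obtain Q where Q: "longest Q" by (rule ex_longest)
  let ?L = "length Q"
  have pQ: "path Q" by (rule longest_path[OF Q])
  have L: "?L \<le> 2 * t - 1 + \<epsilon>" by (rule longest_length[OF Q])
  have cQ: "card (set Q) = ?L" using distinct_card[OF path_distinct[OF pQ]] .
  have LV: "?L \<le> card V" by (rule path_length[OF pQ])
  have cR: "card (V - set Q) = card V - ?L" using path_subset[OF pQ] cQ by (simp add: card_Diff_subset)
  have "t - 1 \<le> ?L" using core_arith[OF Q] card_mono[OF _ core_in_longest[OF Q]] cQ by simp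
  then have "2 * card (edges (set Q)) + (t - 1) * t \<le> 2 * (t - 1) * ?L + 2 * \<epsilon>"
    using card_edges_sharp[OF t3 path_subset[OF pQ]] cQ by simp
  then have "int (2 * card (edges (set Q)) + (t - 1) * t) \<le> int (2 * (t - 1) * ?L + 2 * \<epsilon>)" by (simp only: of_nat_le_iff)
  then have 1: "2 * int (card (edges (set Q))) + (int t - 1) * int t \<le> 2 * (int t - 1) * int ?L + 2 * int \<epsilon>"
    using t by (simp add: of_nat_diff)
  have "set Q \<union> (V - set Q) = V" using path_subset[OF pQ] by blast
  moreover have "min (card (V - set Q)) (t - 3) = t - 3" using cR large L eps t by auto
  ultimately have "2 * card (edges V) + 2 * (t - 3) \<le> 2 * card (edges (set Q)) + 2 * ((t - 2) * (card V - ?L))"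
    using outer_edges_sharp[OF Q, of "V - set Q"] cR by simp
  then have "int (2 * card (edges V) + 2 * (t - 3)) \<le> int (2 * card (edges (set Q)) + 2 * ((t - 2) * (card V - ?L)))"
    by (simp only: of_nat_le_iff)
  then have 2: "2 * int (card (edges V)) + 2 * (int t - 3) \<le> 2 * int (card (edges (set Q))) + 2 * ((int t - 2) * (int (card V) - int ?L))"
    using t t3 LV by (simp add: of_nat_diff)
  have 3: "int ?L \<le> 2 * int t - 1 + int \<epsilon>" using L t by linarith
  show False using 1 2 3 dense unfolding bound2_def by (simp add: algebra_simps)
qed

end

section \<open>Structure of dense saturated graphs\<close>

theorem (in dense_path_free_graph) star_structure:
  obtains A where "A \<subseteq> V" "card A \<le> t - 1" "star_cond (V - A)"
    "\<epsilon> = 0 \<Longrightarrow> t \<noteq> 3 \<Longrightarrow> \<forall>x\<in>V - A. \<forall>y\<in>V - A. \<not> E x y"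
proof (cases "\<exists>Q w. longest Q \<and> w \<in> V - set Q \<and> t - 1 \<le> card (pos Q w)")
  case True
  then obtain Q w where Q: "longest Q" "w \<in> V - set Q" "t - 1 \<le> card (pos Q w)" by blast
  obtain A where A: "A \<subseteq> V" "card A \<le> t - 1" "star_cond (V - A)"
    "length Q < 2 * t \<Longrightarrow> \<forall>x\<in>V - A. \<forall>y\<in>V - A. \<not> E x y" using rich_vertex[OF Q] by blast
  have "\<epsilon> = 0 \<Longrightarrow> length Q < 2 * t" using short[OF longest_path[OF Q(1)]] t by linarith
  then show ?thesis using that[OF A(1-3)] A(4) by blast
next
  case False
  \<comment> \<open>For \<open>t = 2\<close> a single neighbour on \<open>Q\<close> is already
    \<open>t - 1\<close>, and connectivity provides a vertex outside \<open>Q\<close> that has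
    one.\<close>
  have "3 \<le> t"
  proof (rule ccontr)
    assume "\<not> 3 \<le> t"
    then have t2: "t = 2" using t by simp
    obtain Q where Q: "longest Q" by (rule ex_longest)
    have "length Q < card V" using short[OF longest_path[OF Q]] large t2 eps by simp
    then have "\<not> V \<subseteq> set Q" using card_mono[of "set Q" V] card_length[of Q] by auto
    then obtain z where z: "z \<in> V" "z \<notin> set Q" by blast
    obtain ys c where y: "path ys" "ys \<noteq> []" "set ys \<inter> set Q = {}" "c \<in> pos Q (hd ys)"
    proof -
      have "path [z]" "[z] \<noteq> []" "set [z] \<inter> set Q = {}" using z by auto
      from attached_path[OF longest_path[OF Q] longest_ne[OF Q] this] show ?thesis using that by blast
    qed
    have "hd ys \<in> V - set Q" using y path_subset[OF y(1)] hd_in_set[OF y(2)] by blast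
    moreover have "0 < card (pos Q (hd ys))" using y(4) finite_pos card_gt_0_iff by blast
    ultimately show False using False Q t2 by (metis One_nat_def Suc_1 Suc_leI diff_Suc_1)
  qed
  moreover have "card (pos Q w) \<le> t - 2" if "longest Q" "w \<in> V - set Q" for Q w
  proof -
    have "\<not> t - 1 \<le> card (pos Q w)" using False that by blast
    then show ?thesis by linarith
  qed
  ultimately interpret poor_path_free_graph V E t \<epsilon> by unfold_locales
  show ?thesis
  proof (cases "t = 3")
    case True
    then show ?thesis using star_cond_t3 that by auto
  next
    case n3: False
    show ?thesis
    proof (cases "\<epsilon> = 1 \<and> (\<exists>A\<subseteq>V. card A \<le> t - 1 \<and> star_cond (V - A))")
      case True
      then show ?thesis using that by auto
    next
      case False
      then interpret starless_graph V E t \<epsilon> using n3 t3 by unfold_locales auto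
      show ?thesis using starless_False ..
    qed
  qed
qed

context ugraph begin

section \<open>Saturated extensions, star forests and isomorphisms\<close>

text \<open>A path that is none in the old graph uses the new edge, and only once because its
  vertices are distinct. Cut it there and reverse the first piece.\<close>

lemma split_at_new_edge:
  assumes xy: "x \<noteq> y" and new: "ugraph V E'" "\<And>a b. E' a b \<longleftrightarrow> E a b \<or> {a, b} = {x, y}"
    and P: "ugraph.path V E' P" and nP: "\<not> path P"
  obtains A B where "path A" "path B" "A \<noteq> []" "B \<noteq> []" "hd A = x" "hd B = y" "set A \<inter> set B = {}"
    "length A + length B = length P"
proof -
  interpret n: ugraph V E' by (rule new(1))
  have d: "distinct P" "set P \<subseteq> V" and s: "\<And>i. Suc i < length P \<Longrightarrow> E' (P ! i) (P ! Suc i)"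
    using P unfolding n.path_def by (auto simp: successively_conv_nth)
  obtain i where i: "Suc i < length P" "\<not> E (P ! i) (P ! Suc i)"
    using nP d unfolding path_def by (auto simp: successively_conv_nth)
  then have uv: "{P ! i, P ! Suc i} = {x, y}" using s new(2) by blast
  \<comment> \<open>\<open>R\<close> is a piece of \<open>P\<close> with offset \<open>o'\<close>
    that does not contain step \<open>i\<close>, the only one that uses the new edge.\<close>
  have pth: "path R" if R: "distinct R" "set R \<subseteq> V" "\<And>j. Suc j < length R \<Longrightarrow> R ! j = P ! (o' + j)
      \<and> R ! Suc j = P ! Suc (o' + j) \<and> Suc (o' + j) < length P \<and> o' + j \<noteq> i" for R o'
  proof -
    have "successively E R" unfolding successively_conv_nth
    proof (intro allI impI)
      fix j assume j: "Suc j < length R"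
      have R': "R ! j = P ! (o' + j)" "R ! Suc j = P ! Suc (o' + j)" "Suc (o' + j) < length P"
        "o' + j \<noteq> i" using R(3)[OF j] by auto
      have "{P ! (o' + j), P ! Suc (o' + j)} \<noteq> {P ! i, P ! Suc i}"
      proof
        assume e: "{P ! (o' + j), P ! Suc (o' + j)} = {P ! i, P ! Suc i}"
        then have "P ! (o' + j) = P ! i \<or> P ! (o' + j) = P ! Suc i \<and> P ! Suc (o' + j) = P ! i"
          by (auto simp: doubleton_eq_iff)
        then have "o' + j = i \<or> o' + j = Suc i \<and> Suc (o' + j) = i"
          using d(1) R'(3) i(1) by (auto simp: nth_eq_iff_index_eq)
        then show False using R'(4) by linarith
      qed
      then show "E (R ! j) (R ! Suc j)" using s[OF R'(3)] new(2) uv R' by auto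
    qed
    then show ?thesis unfolding path_def using R by blast
  qed
  have "path (take (Suc i) P)"
    by (rule pth[of _ 0]) (use d i(1) in \<open>auto dest: in_set_takeD\<close>)
  moreover have "path (drop (Suc i) P)"
    by (rule pth[of _ "Suc i"]) (use d i(1) in \<open>auto dest: in_set_dropD\<close>)
  ultimately have pth: "path (take (Suc i) P)" "path (drop (Suc i) P)" .
  define a b where "a = rev (take (Suc i) P)" and "b = drop (Suc i) P"
  have ab: "path a" "path b" unfolding a_def b_def using pth by simp_all
  have ab': "a \<noteq> []" "b \<noteq> []" "hd a = P ! i" "hd b = P ! Suc i" "length a + length b = length P"
    unfolding a_def b_def using i(1) by (auto simp: take_Suc_conv_app_nth hd_drop_conv_nth)
  have "set a \<inter> set b = {}" unfolding a_def b_def using set_take_disj_set_drop_if_distinct[OF d(1)] by auto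
  moreover have "P ! i = x \<and> P ! Suc i = y \<or> P ! i = y \<and> P ! Suc i = x" using uv by (auto simp: doubleton_eq_iff)
  ultimately show ?thesis using that[of a b] that[of b a] ab ab' by auto
qed

end

lemma ex_saturated_extension:
  assumes G: "ugraph V E" and nopath: "\<And>xs. ugraph.path V E xs \<Longrightarrow> length xs < k"
  obtains E' where "ugraph V E'" "\<And>x y. E x y \<Longrightarrow> E' x y" "\<And>xs. ugraph.path V E' xs \<Longrightarrow> length xs < k"
    "\<And>x y. x \<in> V \<Longrightarrow> y \<in> V \<Longrightarrow> x \<noteq> y \<Longrightarrow> \<not> E' x y \<Longrightarrow>
      \<exists>A B. ugraph.path V E' A \<and> ugraph.path V E' B \<and> A \<noteq> [] \<and> B \<noteq> [] \<and> hd A = x \<and> hd B = y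
        \<and> set A \<inter> set B = {} \<and> k \<le> length A + length B"
proof -
  interpret G: ugraph V E by (rule G)
  define W where "W = (\<lambda>F. ugraph V (\<lambda>x y. (x, y) \<in> F) \<and> {(x, y). E x y} \<subseteq> F
    \<and> (\<forall>xs. ugraph.path V (\<lambda>x y. (x, y) \<in> F) xs \<longrightarrow> length xs < k))"
  have sub: "F \<subseteq> V \<times> V" if "W F" for F
  proof -
    have F: "ugraph V (\<lambda>x y. (x, y) \<in> F)" using that unfolding W_def by blast
    show ?thesis using ugraph.inV[OF F] ugraph.inV2[OF F] by auto
  qed
  have fin: "finite (V \<times> V)" using G.fin by simp
  have "W {(x, y). E x y}" unfolding W_def using G nopath by simp
  moreover have "\<forall>F. W F \<longrightarrow> card F < Suc (card (V \<times> V))"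
    using sub card_mono[OF fin] by (simp add: less_Suc_eq_le)
  ultimately obtain F where F: "W F" and max: "\<forall>F'. W F' \<longrightarrow> card F' \<le> card F"
    using ex_has_greatest_nat[of W _ card "Suc (card (V \<times> V))"] by blast
  define E' where "E' = (\<lambda>x y. (x, y) \<in> F)"
  have E': "ugraph V E'" "\<And>x y. E x y \<Longrightarrow> E' x y" "\<And>xs. ugraph.path V E' xs \<Longrightarrow> length xs < k"
    using F unfolding W_def E'_def by auto
  interpret n: ugraph V E' by (rule E'(1))
  have "\<exists>A B. n.path A \<and> n.path B \<and> A \<noteq> [] \<and> B \<noteq> [] \<and> hd A = x \<and> hd B = y
        \<and> set A \<inter> set B = {} \<and> k \<le> length A + length B"
    if xy: "x \<in> V" "y \<in> V" "x \<noteq> y" "\<not> E' x y" for x y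
  proof -
    define F' where "F' = insert (x, y) (insert (y, x) F)"
    define E'' where "E'' = (\<lambda>a b. (a, b) \<in> F')"
    have E'': "E'' a b \<longleftrightarrow> E' a b \<or> {a, b} = {x, y}" for a b
      unfolding E''_def F'_def E'_def by (auto simp: doubleton_eq_iff)
    have u: "ugraph V E''"
    proof
      show "finite V" by (rule G.fin)
      show "E'' b a" if "E'' a b" for a b using that n.sym unfolding E'' by (auto simp: insert_commute)
      show "\<not> E'' a a" for a using n.irr xy(3) unfolding E'' by (auto simp: doubleton_eq_iff)
      show "a \<in> V" if "E'' a b" for a b using that n.inV xy unfolding E'' by (auto simp: doubleton_eq_iff)
    qed
    have "finite F" using sub[OF F] fin finite_subset by blast
    then have "card F < card F'" using xy(4) unfolding F'_def E'_def by (intro psubset_card_mono) auto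
    then have "\<not> W F'" using max by (meson not_less)
    moreover have "{(x, y). E x y} \<subseteq> F'" using F unfolding W_def F'_def by auto
    ultimately obtain P where P: "ugraph.path V E'' P" "\<not> length P < k"
      using u unfolding W_def E''_def by blast
    then have "\<not> n.path P" using E'(3) by blast
    from n.split_at_new_edge[OF xy(3) u E'' P(1) this] P(2) show ?thesis by (metis not_less)
  qed
  then show ?thesis using that[OF E'] by blast
qed

text \<open>The stars are centred at the vertices all of whose neighbours are leaves; of a component that is
  a single edge one end is selected.\<close>

lemma star_forestI:
  fixes F :: "('a, 'a \<times> 'a) pre_digraph"
  assumes proj: "tail F = fst" "head F = snd" and fin: "finite (verts F)" and sub: "arcs F \<subseteq> verts F \<times> verts F"
    and sym: "\<And>x y. (x, y) \<in> arcs F \<Longrightarrow> (y, x) \<in> arcs F" and irr: "\<And>x. (x, x) \<notin> arcs F"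
    and leaf: "\<And>x y. (x, y) \<in> arcs F \<Longrightarrow> (\<forall>z. (x, z) \<in> arcs F \<longrightarrow> z = y) \<or> (\<forall>z. (y, z) \<in> arcs F \<longrightarrow> z = x)"
  shows "star_forest F"
proof -
  define N where "N = (\<lambda>x. {y. (x, y) \<in> arcs F})"
  have Nsym: "y \<in> N x \<longleftrightarrow> x \<in> N y" for x y unfolding N_def using sym by blast
  have NV: "N x \<subseteq> verts F" for x unfolding N_def using sub by auto
  have Nirr: "x \<notin> N x" for x unfolding N_def using irr by simp
  have lf: "N x = {y} \<or> N y = {x}" if "y \<in> N x" for x y
  proof -
    have "(x, y) \<in> arcs F" "(y, x) \<in> arcs F" using that sym unfolding N_def by auto
    then show ?thesis using leaf[of x y] unfolding N_def by blast
  qed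
  \<comment> \<open>The centres. Isolated vertices are among them, without leaves. For a component
    that is one edge \<open>xy\<close>, the choice depends only on the set \<open>{x, y}\<close>, so
    exactly one end is taken.\<close>
  define Z where "Z = {x \<in> verts F. (\<forall>y\<in>N x. N y = {x}) \<and> (\<forall>y. N x = {y} \<longrightarrow> x = (SOME z. z \<in> {x, y}))}"
  define S where "S = (\<lambda>c. with_proj \<lparr>pverts = insert c (N c), parcs = {c} \<times> N c \<union> N c \<times> {c}\<rparr>)"
  have dom: "x \<in> Z \<or> (\<exists>y\<in>Z. N x = {y})" if x: "x \<in> verts F" for x
  proof (cases "\<exists>y\<in>N x. N y \<noteq> {x}")
    case True
    then obtain y where y: "y \<in> N x" "N y \<noteq> {x}" by blast
    have Nx: "N x = {y}" using lf[OF y(1)] y(2) by blast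
    have xy: "x \<in> N y" using y(1) Nsym by blast
    have "N z = {y}" if z: "z \<in> N y" for z
    proof (rule ccontr)
      assume "N z \<noteq> {y}"
      then have "N y = {z}" using lf[OF z] by blast
      then show False using xy y(2) by auto
    qed
    moreover have "N y \<noteq> {w}" for w using xy y(2) by auto
    moreover have "y \<in> verts F" using y(1) NV[of x] by blast
    ultimately have "y \<in> Z" unfolding Z_def by auto
    then show ?thesis using Nx by blast
  next
    case False
    then have all: "\<forall>y\<in>N x. N y = {x}" by blast
    show ?thesis
    proof (rule disjCI)
      assume "\<not> (\<exists>y\<in>Z. N x = {y})"
      have "x = (SOME z. z \<in> {x, y})" if y: "N x = {y}" for y
      proof (rule ccontr)
        assume n: "x \<noteq> (SOME z. z \<in> {x, y})"
        have "(SOME z. z \<in> {x, y}) \<in> {x, y}" by (rule someI[of _ x]) simp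
        then have s: "y = (SOME z. z \<in> {y, x})" using n by (simp add: insert_commute)
        have Ny: "N y = {x}" using all y by blast
        then have "y \<in> Z" unfolding Z_def using y s NV[of x] by auto
        then show False using y \<open>\<not> (\<exists>y\<in>Z. N x = {y})\<close> by blast
      qed
      then show "x \<in> Z" unfolding Z_def using x all by blast
    qed
  qed
  have star: "star (S c)" if "c \<in> Z" for c
  proof -
    let ?P = "\<lparr>pverts = insert c (N c), parcs = {c} \<times> N c \<union> N c \<times> {c}\<rparr>"
    have "finite (N c)" using NV fin finite_subset by blast
    then have "finite (pverts ?P)" by simp
    moreover have "pverts ?P = {c} \<union> N c \<and> {c} \<inter> N c = {} \<and> card {c} = 1 \<and> card (N c) = card (N c)
        \<and> parcs ?P = {c} \<times> N c \<union> N c \<times> {c}" using Nirr by simp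
    ultimately have "complete_bipartite_digraph 1 (card (N c)) (S c)"
      unfolding S_def complete_bipartite_digraph_pair_def by blast
    then show ?thesis unfolding star_def by blast
  qed
  have subg: "subgraph (S c) F" if "c \<in> Z" for c
  proof -
    have "wf_digraph F" using sub proj by unfold_locales auto
    moreover have "wf_digraph (S c)" unfolding S_def by unfold_locales auto
    moreover have "compatible F (S c)" unfolding compatible_def S_def using proj by simp
    moreover have "verts (S c) \<subseteq> verts F" unfolding S_def using that NV Z_def by auto
    moreover have "arcs (S c) \<subseteq> arcs F" unfolding S_def N_def using sym by auto
    ultimately show ?thesis unfolding subgraph_def by blast
  qed
  have disj: "c = c'" if c: "c \<in> Z" "c' \<in> Z" and v: "v \<in> verts (S c)" "v \<in> verts (S c')" for c c' v
  proof -
    have leafZ: "N y = {c}" if "c \<in> Z" "y \<in> N c" for c y using that unfolding Z_def by blast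
    have adj: "c = c'" if "c \<in> Z" "c' \<in> Z" "c \<in> N c'" for c c'
    proof -
      have 1: "N c = {c'}" using leafZ[OF that(2,3)] .
      have 2: "N c' = {c}" using leafZ[OF that(1), of c'] 1 by simp
      have "c = (SOME z. z \<in> {c, c'})" "c' = (SOME z. z \<in> {c', c})" using that(1,2) 1 2 unfolding Z_def by blast+
      then show ?thesis by (metis insert_commute)
    qed
    have "v = c \<or> v \<in> N c" "v = c' \<or> v \<in> N c'" using v unfolding S_def by auto
    then consider "v = c" "v = c'" | "v = c" "c \<in> N c'" | "v = c'" "c' \<in> N c" | "v \<in> N c" "v \<in> N c'" by blast
    then show ?thesis
    proof cases
      case 4
      then have "{c} = {c'}" using leafZ c by metis
      then show ?thesis by simp
    qed (use adj c in auto)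
  qed
  show ?thesis unfolding star_forest_def
  proof (intro exI[of _ "S ` Z"] conjI)
    show "\<forall>T\<in>S ` Z. subgraph T F \<and> star T" using star subg by blast
    show "pairwise (\<lambda>T T'. verts T \<inter> verts T' = {}) (S ` Z)"
      unfolding pairwise_def using disj by blast
    show "verts F = (\<Union>T\<in>S ` Z. verts T)"
    proof (intro equalityI subsetI)
      fix x assume x: "x \<in> verts F"
      from dom[OF x] show "x \<in> (\<Union>T\<in>S ` Z. verts T)"
      proof
        assume "\<exists>y\<in>Z. N x = {y}"
        then obtain y where "y \<in> Z" "x \<in> N y" using Nsym by blast
        then show ?thesis unfolding S_def by auto
      qed (auto simp: S_def)
    next
      fix x assume "x \<in> (\<Union>T\<in>S ` Z. verts T)"
      then show "x \<in> verts F" using NV unfolding S_def Z_def by auto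
    qed
    show "arcs F = (\<Union>T\<in>S ` Z. arcs T)"
    proof (intro equalityI subsetI)
      fix e assume e: "e \<in> arcs F"
      obtain x y where xy: "e = (x, y)" by (cases e)
      have "x \<in> verts F" "y \<in> N x" using e sub unfolding xy N_def by auto
      from dom[OF this(1)] show "e \<in> (\<Union>T\<in>S ` Z. arcs T)"
      proof
        assume "x \<in> Z"
        then show ?thesis using \<open>y \<in> N x\<close> unfolding xy S_def by auto
      next
        assume "\<exists>y\<in>Z. N x = {y}"
        then have "y \<in> Z" using \<open>y \<in> N x\<close> by auto
        moreover have "x \<in> N y" using \<open>y \<in> N x\<close> Nsym by blast
        ultimately show ?thesis unfolding xy S_def by auto
      qed
    next
      fix e assume "e \<in> (\<Union>T\<in>S ` Z. arcs T)"
      then obtain c where "c \<in> Z" "e \<in> arcs (S c)" by blast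
      then show "e \<in> arcs F" using subg unfolding subgraph_def by blast
    qed
  qed
qed

text \<open>Enlarge \<open>A\<close> to exactly \<open>a\<close> vertices and map it onto
  \<open>H_A\<close>. Every edge of \<open>G\<close> meets the enlarged set, and the vertices of
  \<open>H_A\<close> are adjacent to all others.\<close>

lemma iso_subgraph_H_graph:
  fixes G :: "'a pair_pre_digraph"
  assumes G: "pair_graph G" and A: "A \<subseteq> pverts G" "card A \<le> a"
    and a: "2 * a < k" "k \<le> card (pverts G)"
    and indep: "\<And>x y. x \<in> pverts G - A \<Longrightarrow> y \<in> pverts G - A \<Longrightarrow> (x, y) \<notin> parcs G"
  shows "\<exists>S. subgraph S (with_proj (H_graph (card (pverts G)) k a)) \<and> digraph_iso (with_proj G) S"
proof -
  interpret pair_graph G by (rule G)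
  let ?V = "pverts G" and ?n = "card (pverts G)"
  have fV: "finite ?V" by (rule pair_finite_verts)
  have "a \<le> ?n" using a by linarith
  then obtain A' where A': "A \<subseteq> A'" "A' \<subseteq> ?V" "card A' = a"
    using exists_subset_between[of A a ?V] A fV by blast
  have fA: "finite A'" using A'(2) fV finite_subset by blast
  obtain g where g: "bij_betw g A' {0..<a}" using ex_bij_betw_finite_nat[OF fA] A'(3) by blast
  have "card (?V - A') = card {a..<?n}" using A' fA by (simp add: card_Diff_subset)
  then obtain h where h: "bij_betw h (?V - A') {a..<?n}"
    using finite_same_card_bij[of "?V - A'" "{a..<?n}"] fV by auto
  define f where "f = (\<lambda>x. if x \<in> A' then g x else h x)"
  have fA': "f x < a" if "x \<in> A'" for x using bij_betw_apply[OF g that] that unfolding f_def by simp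
  have fB': "a \<le> f x \<and> f x < ?n" if "x \<in> ?V" "x \<notin> A'" for x
    using bij_betw_apply[OF h, of x] that unfolding f_def by simp
  have inj: "inj_on f ?V"
  proof (rule inj_onI)
    fix x y assume xy: "x \<in> ?V" "y \<in> ?V" "f x = f y"
    have "x \<in> A' \<longleftrightarrow> y \<in> A'" using fA' fB' xy by (metis not_less)
    then show "x = y" using xy bij_betw_imp_inj_on[OF g] bij_betw_imp_inj_on[OF h]
      unfolding f_def by (auto dest: inj_onD split: if_splits)
  qed
  have fn: "f x < ?n" if "x \<in> ?V" for x using fA'[of x] fB'[of x] that \<open>a \<le> ?n\<close> by fastforce
  let ?H = "H_graph ?n k a"
  have vH: "pverts ?H = {0..<?n}"
    using a unfolding H_graph_def H_A_def H_B_def H_C_def by auto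
  have arc: "(f x, f y) \<in> parcs ?H" if e: "(x, y) \<in> parcs G" for x y
  proof -
    have V: "x \<in> ?V" "y \<in> ?V" using e arc_fst_in_verts[OF e] arc_snd_in_verts[OF e] by auto
    have ne: "f x \<noteq> f y" using pair_no_loops[OF e] inj V by (auto dest: inj_onD)
    have "x \<in> A' \<or> y \<in> A'" using indep[of x y] e V A'(1) by blast
    then have "f x < a \<or> f y < a" using fA' by blast
    then show ?thesis using ne fn[OF V(1)] fn[OF V(2)] a
      unfolding H_graph_def H_A_def H_B_def H_C_def by auto
  qed
  define hom where "hom = \<lparr>iso_verts = f, iso_arcs = (\<lambda>(x, y). (f x, f y)), iso_head = snd, iso_tail = fst\<rparr>"
  have wfG: "wf_digraph (with_proj G)" by unfold_locales
  have hom: "pre_digraph.digraph_isomorphism (with_proj G) hom"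
    unfolding pre_digraph.digraph_isomorphism_def
  proof (intro conjI)
    show "inj_on (iso_arcs hom) (arcs (with_proj G))"
    proof (rule inj_onI)
      fix d e assume de: "d \<in> arcs (with_proj G)" "e \<in> arcs (with_proj G)" "iso_arcs hom d = iso_arcs hom e"
      then have "f (fst d) = f (fst e)" "f (snd d) = f (snd e)" unfolding hom_def by (auto simp: case_prod_beta)
      moreover have "fst d \<in> ?V" "snd d \<in> ?V" "fst e \<in> ?V" "snd e \<in> ?V"
        using de arc_fst_in_verts arc_snd_in_verts by auto
      ultimately show "d = e" using inj by (metis inj_onD prod.expand)
    qed
  qed (use wfG inj in \<open>auto simp: hom_def case_prod_beta\<close>)
  have wfH: "wf_digraph (with_proj ?H)"
  proof -
    interpret H: pair_graph ?H by (rule H_graph_pair_graph[OF a(1)])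
    show ?thesis by unfold_locales
  qed
  have "subgraph (app_iso hom (with_proj G)) (with_proj ?H)"
    unfolding subgraph_def
  proof (intro conjI)
    show "verts (app_iso hom (with_proj G)) \<subseteq> verts (with_proj ?H)" using fn vH unfolding hom_def by auto
    show "arcs (app_iso hom (with_proj G)) \<subseteq> arcs (with_proj ?H)" using arc unfolding hom_def by auto
    show "wf_digraph (app_iso hom (with_proj G))"
      by unfold_locales (auto simp: hom_def dest: arc_fst_in_verts arc_snd_in_verts)
    show "compatible (with_proj ?H) (app_iso hom (with_proj G))" unfolding compatible_def hom_def by simp
  qed (rule wfH)
  then show ?thesis using hom unfolding digraph_iso_def by blast
qed

section \<open>Transfer to the given graph\<close>

lemma two_times_choose_two: "2 * (m choose 2) = m * (m - 1)"
  using times_binomial_minus1_eq[of 2 m] by (cases m) auto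

theorem theorem1p6:
  fixes t n k :: nat and G :: "'a pair_pre_digraph"
  assumes "t \<ge> 2" and "n \<ge> 3 * t - 1" and "k \<in> {2 * t, 2 * t + 1}"
    and "pair_graph G" and "connected (with_proj G)" and "card (pverts G) = n"
    and "\<not> has_path_on k (with_proj G)"
  shows "int (num_edges G) \<le> int (h_edges (n + 1) (k + 1) (t - 1)) - int n
    \<or> (k = 2 * t \<and> k \<noteq> 6 \<and>
        (\<exists>S. subgraph S (with_proj (H_graph n k (t - 1))) \<and> digraph_iso (with_proj G) S))
    \<or> ((k = 2 * t + 1 \<or> k = 6) \<and>
        (\<exists>A. A \<subseteq> pverts G \<and> card A \<le> t - 1 \<and>
          star_forest (induce_subgraph (with_proj G) (pverts G - A))))"
proof (rule disjCI)
  assume neg: "\<not> ((k = 2 * t \<and> k \<noteq> 6 \<and>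
        (\<exists>S. subgraph S (with_proj (H_graph n k (t - 1))) \<and> digraph_iso (with_proj G) S))
    \<or> ((k = 2 * t + 1 \<or> k = 6) \<and>
        (\<exists>A. A \<subseteq> pverts G \<and> card A \<le> t - 1 \<and>
          star_forest (induce_subgraph (with_proj G) (pverts G - A)))))"
  interpret G: pair_graph G by (rule assms(4))
  define V where "V = pverts G"
  define E where "E = (\<lambda>x y. (x, y) \<in> parcs G)"
  define \<epsilon> where "\<epsilon> = k - 2 * t"
  have \<epsilon>: "\<epsilon> \<le> 1" "k = 2 * t + \<epsilon>" using assms(3) unfolding \<epsilon>_def by auto
  have symG: "(y, x) \<in> parcs G" if "(x, y) \<in> parcs G" for x y
    using G.pair_sym_arcs that unfolding symmetric_def by (auto dest: symD)
  have ug: "ugraph V E"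
  proof
    show "finite V" unfolding V_def by (rule G.pair_finite_verts)
    show "E y x" if "E x y" for x y using that symG unfolding E_def by blast
    show "\<not> E x x" for x using G.pair_no_loops unfolding E_def by fastforce
    show "x \<in> V" if "E x y" for x y using G.arc_fst_in_verts that unfolding E_def V_def by fastforce
  qed
  interpret u: ugraph V E by (rule ug)
  have nopath: "length xs < k" if xs: "u.path xs" for xs
  proof (rule ccontr)
    assume "\<not> length xs < k"
    \<comment> \<open>\<open>has_path_on\<close> asks for exactly \<open>k\<close> vertices, so a
      longer path is truncated.\<close>
    then have p: "u.path (take k xs)" "length (take k xs) = k" using u.path_take[OF xs] by auto
    have k0: "k \<noteq> 0" using assms(1,3) by auto
    have Ed: "(x, y) \<in> parcs G" if "E x y" for x y using that unfolding E_def .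
    have arcs: "set (vwalk_arcs ys) \<subseteq> parcs G" if "u.path ys" for ys
      using that by (induction ys rule: vwalk_arcs.induct) (auto simp: u.path_Cons dest: Ed)
    have "vpath (take k xs) (with_proj G)"
      unfolding vpath_def vwalk_def using arcs[OF p(1)] p k0 u.path_subset[OF p(1)] u.path_distinct[OF p(1)]
      unfolding V_def by auto
    then show False using assms(7) p(2) unfolding has_path_on_def by blast
  qed
  obtain E' where E': "ugraph V E'" "\<And>x y. E x y \<Longrightarrow> E' x y" "\<And>xs. ugraph.path V E' xs \<Longrightarrow> length xs < k"
    "\<And>x y. x \<in> V \<Longrightarrow> y \<in> V \<Longrightarrow> x \<noteq> y \<Longrightarrow> \<not> E' x y \<Longrightarrow>
      \<exists>A B. ugraph.path V E' A \<and> ugraph.path V E' B \<and> A \<noteq> [] \<and> B \<noteq> [] \<and> hd A = x \<and> hd B = y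
        \<and> set A \<inter> set B = {} \<and> k \<le> length A + length B"
    using ex_saturated_extension[OF ug nopath] by blast
  interpret e: ugraph V E' by (rule E'(1))
  have conn: "(x, y) \<in> {(a, b). E' a b}\<^sup>*" if "x \<in> V" "y \<in> V" for x y
  proof -
    have "strongly_connected (with_proj G)"
      by (rule G.symmetric_connected_imp_strongly_connected) (use G.pair_sym_arcs assms(5) in auto)
    then have "(x, y) \<in> rtrancl_on (pverts G) (parcs G)"
      using that unfolding strongly_connected_def reachable_def V_def by simp
    then have "(x, y) \<in> (parcs G)\<^sup>*" by (rule rtrancl_on_rtranclI)
    moreover have "parcs G \<subseteq> {(a, b). E' a b}" using E'(2) unfolding E_def by auto
    ultimately show ?thesis using rtrancl_mono by blast
  qed
  have kn: "k \<le> n" using assms(1-3) by auto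
  interpret pf: path_free_graph V E' t \<epsilon>
  proof
    show "2 \<le> t" "\<epsilon> \<le> 1" "3 * t - 1 \<le> card V" using assms \<epsilon> unfolding V_def by auto
    show "length xs \<le> 2 * t - 1 + \<epsilon>" if "e.path xs" for xs using E'(3)[OF that] \<epsilon>(2) assms(1) by linarith
  qed (rule conn)
  have bound: "2 * (int (h_edges (n + 1) (k + 1) (t - 1)) - int n) = pf.bound2 n"
  proof -
    have e2: "int \<epsilon> * int \<epsilon> = int \<epsilon>" using \<epsilon>(1) by (cases "\<epsilon> = 0") auto
    have m: "k + 1 - (t - 1) = t + 2 + \<epsilon>" "t + 2 + \<epsilon> - 1 = t + 1 + \<epsilon>" using \<epsilon>(2) assms(1) by auto
    have "2 * h_edges (n + 1) (k + 1) (t - 1) = (t + 2 + \<epsilon>) * (t + 1 + \<epsilon>) + 2 * ((t - 1) * (n - k + (t - 1)))"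
      using two_times_choose_two[of "t + 2 + \<epsilon>"] unfolding h_edges_def m by simp
    then have "int (2 * h_edges (n + 1) (k + 1) (t - 1)) = int ((t + 2 + \<epsilon>) * (t + 1 + \<epsilon>) + 2 * ((t - 1) * (n - k + (t - 1))))"
      by (rule arg_cong)
    moreover have "int (t - 1) = int t - 1" "int (n - k) = int n - 2 * int t - int \<epsilon>" using assms(1) kn \<epsilon>(2) by auto
    ultimately have "2 * int (h_edges (n + 1) (k + 1) (t - 1))
        = (int t + 2 + int \<epsilon>) * (int t + 1 + int \<epsilon>) + 2 * ((int t - 1) * (int n - 2 * int t - int \<epsilon> + (int t - 1)))"
      by (simp only: of_nat_add of_nat_mult of_nat_numeral of_nat_1)
    then show ?thesis unfolding pf.bound2_def using e2 by (simp add: algebra_simps)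
  qed
  have ne: "num_edges G = card (u.edges V)"
  proof -
    have "parcs G = {(x, y). x \<in> V \<and> y \<in> V \<and> E x y}"
      unfolding E_def V_def by (auto dest: G.arc_fst_in_verts G.arc_snd_in_verts)
    then show ?thesis unfolding num_edges_def u.edges_def by (rule arg_cong)
  qed
  have "u.edges V \<subseteq> e.edges V" unfolding u.edges_def e.edges_def using E'(2) by (intro image_mono) auto
  then have le: "num_edges G \<le> card (e.edges V)" unfolding ne by (intro card_mono e.finite_edges e.fin)
  show "int (num_edges G) \<le> int (h_edges (n + 1) (k + 1) (t - 1)) - int n"
  proof (rule ccontr)
    assume "\<not> ?thesis"
    then have "int (h_edges (n + 1) (k + 1) (t - 1)) - int n < int (card (e.edges V))" using le by linarith
    then have "2 * (int (h_edges (n + 1) (k + 1) (t - 1)) - int n) < 2 * int (card (e.edges V))" by simp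
    then have "pf.bound2 n < 2 * int (card (e.edges V))" unfolding bound .
    then interpret dpf: dense_path_free_graph V E' t \<epsilon>
      using E'(4) assms(6) \<epsilon>(2) by unfold_locales (auto simp: V_def)
    obtain A where A: "A \<subseteq> V" "card A \<le> t - 1" "e.star_cond (V - A)"
      "\<epsilon> = 0 \<Longrightarrow> t \<noteq> 3 \<Longrightarrow> \<forall>x\<in>V - A. \<forall>y\<in>V - A. \<not> E' x y" using dpf.star_structure by blast
    \<comment> \<open>The condition holds for \<open>E'\<close>, which contains \<open>E\<close>;
      deleting edges keeps leaves leaves or isolates them.\<close>
    have sf: "star_forest (induce_subgraph (with_proj G) (pverts G - A))"
    proof (rule star_forestI)
      fix x y assume xy: "(x, y) \<in> arcs (induce_subgraph (with_proj G) (pverts G - A))"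
      then have "x \<in> V - A" "y \<in> V - A" "E' x y" using E'(2) unfolding V_def E_def by auto
      then have "(\<forall>z\<in>V - A. E' x z \<longrightarrow> z = y) \<or> (\<forall>z\<in>V - A. E' y z \<longrightarrow> z = x)"
        using A(3) unfolding e.star_cond_def by blast
      then show "(\<forall>z. (x, z) \<in> arcs (induce_subgraph (with_proj G) (pverts G - A)) \<longrightarrow> z = y)
          \<or> (\<forall>z. (y, z) \<in> arcs (induce_subgraph (with_proj G) (pverts G - A)) \<longrightarrow> z = x)"
        using E'(2) unfolding V_def E_def by auto
      show "(y, x) \<in> arcs (induce_subgraph (with_proj G) (pverts G - A))" using xy symG by auto
    next
      show "(x, x) \<notin> arcs (induce_subgraph (with_proj G) (pverts G - A))" for x using G.pair_no_loops by fastforce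
    qed (use G.pair_finite_verts in auto)
    show False
    proof (cases "k = 2 * t + 1 \<or> k = 6")
      case True
      then show False using neg sf A(1,2) unfolding V_def by blast
    next
      case False
      \<comment> \<open>\<open>k \<noteq> 6\<close> excludes \<open>t = 3\<close>, the one value for
        which \<open>star_structure\<close> promises no independent set when \<epsilon> = 0.\<close>
      then have e0: "k = 2 * t" "\<epsilon> = 0" "t \<noteq> 3" using \<epsilon> by auto
      have "\<exists>S. subgraph S (with_proj (H_graph (card (pverts G)) k (t - 1))) \<and> digraph_iso (with_proj G) S"
      proof (rule iso_subgraph_H_graph[OF assms(4)])
        show "A \<subseteq> pverts G" "card A \<le> t - 1" using A(1,2) unfolding V_def by auto
        show "2 * (t - 1) < k" "k \<le> card (pverts G)" using e0(1) assms(1,6) kn by auto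
        show "(x, y) \<notin> parcs G" if "x \<in> pverts G - A" "y \<in> pverts G - A" for x y
          using A(4)[OF e0(2,3)] that E'(2) unfolding V_def E_def by blast
      qed
      then show False using neg e0(1) False assms(6) by blast
    qed
  qed
qed

end
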